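(* Let $\{p_n\}_{n\in\mathbb N}\subset(1,2)$ be such that $p_n\searrow1$. For $1\le p<2$ let $f^{\delta,p}_{\alpha,N}$ denote the minimizer over $X_p$ of $$J^{\delta,p}_{\alpha,N}(f)=\frac12\|A_{\mathbf u}f-\mathbf g_N^\delta\|_{V_N}^2+\alpha\,\frac1p\|Mf\|_{\ell^p}^p+\iota_+(f).$$ Then $$\big\|f^{\delta,p_n}_{\alpha,N}-f^{\delta,1}_{\alpha,N}\big\|_{X_2}\to0\qquad\text{as }n\to\infty .$$
   Context: $X_p$ ($1\le p\le2$) denotes either the Besov space $B_p^s(\Omega)$ with $s=d\left(\frac1p-\frac12\right)$, or the shearlet coorbit space $\mathscr{SC}_{p,m}$ with weight $m\equiv1$ (elements supported in $\Omega=[0,1]^2$). $M$ is the corresponding coefficient transform $Mf=\{\langle f,\psi_\lambda\rangle\}_\lambda$, where $\{\psi_\lambda\}$ is an orthonormal wavelet basis (Besov case), respectively a discrete shearlet system forming a Banach frame for the coorbit spaces (shearlet case). Definitions for the shearlet case ($d=2$): $\psi_\lambda=\pi((a,s,t)_\lambda)\psi$ for a discrete parameter set $\Lambda$, with $\pi(a,s,t)f(x)=|\det A_a|^{-1/2}f(A_a^{-1}S_s^{-1}(x-t))$, $A_a=\begin{pmatrix}a&0\\0&\operatorname{sign}(a)|a|^{1/2}\end{pmatrix}$, $S_s=\begin{pmatrix}1&s\\0&1\end{pmatrix}$, $a\neq0$, $s\in\mathbb R$, $t\in\mathbb R^2$; $\psi$ is an admissible compactly supported generator, and $\mathscr{SC}_{p,m}$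 consists of those $f$ in the anti-dual of $\mathscr H_{1,\omega}=\{f\in L^2(\mathbb R^2):(a,s,t)\mapsto\langle f,\pi(a,s,t)\psi\rangle\in L^1_\omega(\mathbb S)\}$ (for a weight $\omega$, $\mathbb S$ being the shearlet group of parameters $(a,s,t)$ with Haar measure) for which $(a,s,t)\mapsto\langle f,\pi(a,s,t)\psi\rangle$ belongs to $L^p_m(\mathbb S)$. The frame property means: $f\in\mathscr{SC}_{p,m}$ iff $Mf\in\ell^p$, with equivalent norms, and there is a bounded linear operator $M^\dagger:\ell^p\to\mathscr{SC}_{p,m}$ with $M^\dagger Mf=f$. In both cases $X_p$ is equipped with the norm $\|f\|_{X_p}=\|Mf\|_{\ell^p}$, so that $X_1\subset X_p\subset X_2$ and $\|f\|_{X_{p'}}\le\|f\|_{X_p}$ for $p'\ge p$. $V$ is a Hilbert space, $V_N=\bigoplus_{n=1}^NV$ has inner product $\langle\mathbf v,\tilde{\mathbf v}\rangle_{V_N}=\frac1N\sum_n\langle v_n,\tilde v_n\rangle_V$; for fixed points $\mathbf u=(u_1,\dots,u_N)$ of a set $U$, $A_{\mathbf u}f=((Af)(u_n))_{n=1}^N$ is the sampled version of a linear operator $A$ mapping into $V$-valued continuous functions on $U$, and $A_{\mathbf u}$ is continuous on $X_2$ with values in $V_N$. $\mathbf g_N^\delta\in V_N$ is the given data and $\alpha>0$; $\mathbf u$, $\mathbf g^\delta_N$, $\alpha$, $\delta$, $N$ are fixed. $\iota_+(f)=0$ if $f\ge0$ a.e. and $\iota_+(f)=\infty$ otherwise. 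*)

theory Defs
  imports "HOL-Analysis.Analysis"
begin

section \<open>Lebesgue and sequence spaces\<close>

text \<open>Elements are complex-valued representatives; they are identified almost everywhere.
  The choice \<open>M = count_space L\<close> gives the sequence space of p-summable families over \<open>L\<close>.\<close>

definition Lp_space :: "'a measure \<Rightarrow> real \<Rightarrow> ('a \<Rightarrow> complex) set" where
  "Lp_space M p = {f \<in> borel_measurable M. integrable M (\<lambda>x. norm (f x) powr p)}"

definition Lp_norm :: "'a measure \<Rightarrow> real \<Rightarrow> ('a \<Rightarrow> complex) \<Rightarrow> real" where
  "Lp_norm M p f = (\<integral>x. norm (f x) powr p \<partial>M) powr (1 / p)"

abbreviation ell :: "'l set \<Rightarrow> real \<Rightarrow> ('l \<Rightarrow> complex) set" where
  "ell L p \<equiv> Lp_space (count_space L) p"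

abbreviation ell_norm :: "'l set \<Rightarrow> real \<Rightarrow> ('l \<Rightarrow> complex) \<Rightarrow> real" where
  "ell_norm L p \<equiv> Lp_norm (count_space L) p"

definition L2_inner :: "('a::euclidean_space \<Rightarrow> complex) \<Rightarrow> ('a \<Rightarrow> complex) \<Rightarrow> complex" where
  "L2_inner f h = (\<integral>x. f x * cnj (h x) \<partial>lborel)"

text \<open>Functions on \<open>\<Omega>\<close> are extended by zero to the whole space.\<close>

definition supported_in :: "'a::euclidean_space set \<Rightarrow> ('a \<Rightarrow> complex) \<Rightarrow> bool" where
  "supported_in \<Omega> f \<longleftrightarrow> (AE x in lborel. x \<notin> \<Omega> \<longrightarrow> f x = 0)"

definition L2_on :: "'a::euclidean_space set \<Rightarrow> ('a \<Rightarrow> complex) set" where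
  "L2_on \<Omega> = {f \<in> Lp_space lborel 2. supported_in \<Omega> f}"

text \<open>The coefficient transform of a system \<open>\<psi>\<close>, and the norm it induces.\<close>

definition coeffs :: "('l \<Rightarrow> 'a::euclidean_space \<Rightarrow> complex) \<Rightarrow> ('a \<Rightarrow> complex) \<Rightarrow> 'l \<Rightarrow> complex" where
  "coeffs \<psi> f = (\<lambda>l. L2_inner f (\<psi> l))"

definition X_norm ::
  "'l set \<Rightarrow> ('l \<Rightarrow> 'a::euclidean_space \<Rightarrow> complex) \<Rightarrow> real \<Rightarrow> ('a \<Rightarrow> complex) \<Rightarrow> real" where
  "X_norm L \<psi> p f = ell_norm L p (coeffs \<psi> f)"


section \<open>Besov spaces and wavelet bases\<close>

definition fin_diff :: "nat \<Rightarrow> 'a::real_vector \<Rightarrow> ('a \<Rightarrow> complex) \<Rightarrow> 'a \<Rightarrow> complex" where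
  "fin_diff r h f x = (\<Sum>k\<le>r. (-1) ^ (r - k) * of_nat (r choose k) * f (x + real k *\<^sub>R h))"

text \<open>The p-th power of the p-modulus of smoothness of order \<open>r\<close> on \<open>\<Omega>\<close>. Only differences all of
  whose nodes lie in \<open>\<Omega>\<close> enter.\<close>

definition modulus_pow ::
  "nat \<Rightarrow> real \<Rightarrow> 'a::euclidean_space set \<Rightarrow> ('a \<Rightarrow> complex) \<Rightarrow> real \<Rightarrow> ennreal" where
  "modulus_pow r p \<Omega> f t =
     (SUP h\<in>{h. norm h \<le> t}.
        \<integral>\<^sup>+x\<in>{x. \<forall>k\<le>r. x + real k *\<^sub>R h \<in> \<Omega>}. ennreal (norm (fin_diff r h f x) powr p) \<partial>lborel)"

text \<open>The p-th power of the norm of the Besov space with both integrability indices equal to \<open>p\<close>,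
  in its modulus-of-smoothness form with a modulus of order \<open>\<lfloor>s\<rfloor> + 1\<close>. That form is valid for
  \<open>s > 0\<close>. Smoothness zero is only needed for \<open>p = 2\<close>, where the Besov space is the space of
  square-integrable functions.\<close>

definition besov_pow ::
  "real \<Rightarrow> real \<Rightarrow> 'a::euclidean_space set \<Rightarrow> ('a \<Rightarrow> complex) \<Rightarrow> ennreal" where
  "besov_pow s p \<Omega> f =
     (\<integral>\<^sup>+x\<in>\<Omega>. ennreal (norm (f x) powr p) \<partial>lborel) +
     (if s = 0 then 0
      else \<integral>\<^sup>+t\<in>{0<..1}. ennreal (t powr (- s * p - 1)) * modulus_pow (nat \<lfloor>s\<rfloor> + 1) p \<Omega> f t \<partial>lborel)"

definition besov_space ::
  "real \<Rightarrow> real \<Rightarrow> 'a::euclidean_space set \<Rightarrow> ('a \<Rightarrow> complex) set" where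
  "besov_space s p \<Omega> =
     {f \<in> borel_measurable lborel. supported_in \<Omega> f \<and> besov_pow s p \<Omega> f < \<infinity>}"

definition besov_norm ::
  "real \<Rightarrow> real \<Rightarrow> 'a::euclidean_space set \<Rightarrow> ('a \<Rightarrow> complex) \<Rightarrow> real" where
  "besov_norm s p \<Omega> f = enn2real (besov_pow s p \<Omega> f) powr (1 / p)"

definition besov_smoothness :: "nat \<Rightarrow> real \<Rightarrow> real" where
  "besov_smoothness d p = real d * (1 / p - 1 / 2)"

definition besov_X :: "(real ^ 'd) set \<Rightarrow> real \<Rightarrow> (real ^ 'd \<Rightarrow> complex) set" where
  "besov_X \<Omega> p = besov_space (besov_smoothness CARD('d) p) p \<Omega>"

definition integer_lattice :: "(real ^ 'd) set" where
  "integer_lattice = {k. \<forall>i. k $ i \<in> \<int>}"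

definition dyadic_atom ::
  "(real ^ 'd \<Rightarrow> complex) \<Rightarrow> int \<Rightarrow> real ^ 'd \<Rightarrow> real ^ 'd \<Rightarrow> complex" where
  "dyadic_atom \<eta> j k x =
     of_real (2 powr (real_of_int j * real CARD('d) / 2)) * \<eta> ((2 powr real_of_int j) *\<^sub>R x - k)"

text \<open>An orthonormal basis of the square-integrable functions on \<open>\<Omega>\<close> consisting of dyadic
  dilates and integer translates, restricted to \<open>\<Omega>\<close>, of finitely many generators: scaling
  functions, wavelets and, for adapted bases on a cube, boundary functions. With \<open>P\<close> the integer
  lattice instead of \<open>{0}\<close>, periodized wavelets are covered as well.\<close>

definition orthonormal_wavelet_basis ::
  "(real ^ 'd) set \<Rightarrow> 'l set \<Rightarrow> ('l \<Rightarrow> real ^ 'd \<Rightarrow> complex) \<Rightarrow> bool" where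
  "orthonormal_wavelet_basis \<Omega> L \<psi> \<longleftrightarrow>
     (\<forall>l\<in>L. \<psi> l \<in> L2_on \<Omega>) \<and>
     (\<forall>l\<in>L. \<forall>l'\<in>L. L2_inner (\<psi> l) (\<psi> l') = (if l = l' then 1 else 0)) \<and>
     (\<forall>f\<in>L2_on \<Omega>. (\<forall>l\<in>L. L2_inner f (\<psi> l) = 0) \<longrightarrow> (AE x in lborel. f x = 0)) \<and>
     (\<exists>G P. finite G \<and> (P = {0} \<or> P = integer_lattice) \<and>
        (\<forall>l\<in>L. \<exists>\<eta>\<in>G. \<exists>j. \<exists>k\<in>integer_lattice.
           AE x in lborel. x \<in> \<Omega> \<longrightarrow> \<psi> l x = (\<Sum>\<^sub>\<infinity>m\<in>P. dyadic_atom \<eta> j k (x + m))))"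

text \<open>The wavelet norm equivalence. With \<open>s = d (1/p - 1/2)\<close> the level-dependent weight
  of the general Besov norm equivalence is identically one. The wavelets are regular enough for
  this to hold.\<close>

definition characterizes_besov ::
  "(real ^ 'd) set \<Rightarrow> 'l set \<Rightarrow> ('l \<Rightarrow> real ^ 'd \<Rightarrow> complex) \<Rightarrow> real \<Rightarrow> bool" where
  "characterizes_besov \<Omega> L \<psi> p \<longleftrightarrow>
     (\<forall>f. f \<in> besov_X \<Omega> p \<longleftrightarrow> f \<in> L2_on \<Omega> \<and> coeffs \<psi> f \<in> ell L p) \<and>
     (\<exists>c>0. \<exists>C. \<forall>f\<in>besov_X \<Omega> p.
        c * besov_norm (besov_smoothness CARD('d) p) p \<Omega> f \<le> X_norm L \<psi> p f \<and>
        X_norm L \<psi> p f \<le> C * besov_norm (besov_smoothness CARD('d) p) p \<Omega> f)"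

definition besov_setting ::
  "(real ^ 'd) set \<Rightarrow> 'l set \<Rightarrow> ('l \<Rightarrow> real ^ 'd \<Rightarrow> complex) \<Rightarrow> bool" where
  "besov_setting \<Omega> L \<psi> \<longleftrightarrow>
     \<Omega> \<in> sets borel \<and> orthonormal_wavelet_basis \<Omega> L \<psi> \<and>
     (\<forall>p\<in>{1..2}. characterizes_besov \<Omega> L \<psi> p)"


section \<open>Shearlet coorbit spaces\<close>

type_synonym shear_par = "real \<times> real \<times> (real ^ 2)"

definition dilation_mat :: "real \<Rightarrow> real ^ 2 ^ 2" where
  "dilation_mat a = vector [vector [a, 0], vector [0, sgn a * sqrt \<bar>a\<bar>]]"

definition shear_mat :: "real \<Rightarrow> real ^ 2 ^ 2" where
  "shear_mat s = vector [vector [1, s], vector [0, 1]]"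

definition shearlet_group :: "shear_par set" where
  "shearlet_group = {(a, s, t). a \<noteq> 0}"

fun shear_mult :: "shear_par \<Rightarrow> shear_par \<Rightarrow> shear_par" where
  "shear_mult (a, s, t) (a', s', t') =
     (a * a', s + s' * sqrt \<bar>a\<bar>, t + shear_mat s *v (dilation_mat a *v t'))"

fun shear_rep :: "shear_par \<Rightarrow> (real ^ 2 \<Rightarrow> complex) \<Rightarrow> real ^ 2 \<Rightarrow> complex" where
  "shear_rep (a, s, t) f x =
     of_real (\<bar>det (dilation_mat a)\<bar> powr (- 1 / 2)) *
     f (matrix_inv (dilation_mat a) *v (matrix_inv (shear_mat s) *v (x - t)))"

text \<open>Left Haar measure: left translation by \<open>(a, s, t)\<close> has Jacobian \<open>\<bar>a\<bar>\<^sup>3\<close>.\<close>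

definition shear_haar :: "shear_par measure" where
  "shear_haar = density (restrict_space lborel shearlet_group) (\<lambda>g. ennreal (1 / \<bar>fst g\<bar> ^ 3))"

definition Lpw_space :: "(shear_par \<Rightarrow> real) \<Rightarrow> real \<Rightarrow> (shear_par \<Rightarrow> complex) set" where
  "Lpw_space m p = {\<Phi> \<in> borel_measurable shear_haar. (\<lambda>g. of_real (m g) * \<Phi> g) \<in> Lp_space shear_haar p}"

definition Lpw_norm :: "(shear_par \<Rightarrow> real) \<Rightarrow> real \<Rightarrow> (shear_par \<Rightarrow> complex) \<Rightarrow> real" where
  "Lpw_norm m p \<Phi> = Lp_norm shear_haar p (\<lambda>g. of_real (m g) * \<Phi> g)"

definition group_weight :: "(shear_par \<Rightarrow> real) \<Rightarrow> bool" where
  "group_weight \<omega> \<longleftrightarrow> continuous_on shearlet_group \<omega> \<and> (\<forall>g\<in>shearlet_group. 1 \<le> \<omega> g) \<and>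
     (\<forall>g\<in>shearlet_group. \<forall>h\<in>shearlet_group. \<omega> (shear_mult g h) \<le> \<omega> g * \<omega> h)"

definition shear_transform :: "(real ^ 2 \<Rightarrow> complex) \<Rightarrow> (real ^ 2 \<Rightarrow> complex) \<Rightarrow> shear_par \<Rightarrow> complex" where
  "shear_transform \<psi> f = (\<lambda>g. L2_inner f (shear_rep g \<psi>))"

definition H1 :: "(shear_par \<Rightarrow> real) \<Rightarrow> (real ^ 2 \<Rightarrow> complex) \<Rightarrow> (real ^ 2 \<Rightarrow> complex) set" where
  "H1 \<omega> \<psi> = {f \<in> Lp_space lborel 2. shear_transform \<psi> f \<in> Lpw_space \<omega> 1}"

definition H1_norm :: "(shear_par \<Rightarrow> real) \<Rightarrow> (real ^ 2 \<Rightarrow> complex) \<Rightarrow> (real ^ 2 \<Rightarrow> complex) \<Rightarrow> real" where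
  "H1_norm \<omega> \<psi> f = Lpw_norm \<omega> 1 (shear_transform \<psi> f)"

text \<open>Bounded conjugate-linear functionals on \<open>H1 \<omega> \<psi>\<close>, set to zero off their domain.
  Boundedness forces them to respect equality almost everywhere.\<close>

definition antidual ::
  "(shear_par \<Rightarrow> real) \<Rightarrow> (real ^ 2 \<Rightarrow> complex) \<Rightarrow> ((real ^ 2 \<Rightarrow> complex) \<Rightarrow> complex) set" where
  "antidual \<omega> \<psi> = {F.
     (\<forall>h. h \<notin> H1 \<omega> \<psi> \<longrightarrow> F h = 0) \<and>
     (\<forall>h\<in>H1 \<omega> \<psi>. \<forall>k\<in>H1 \<omega> \<psi>. F (\<lambda>x. h x + k x) = F h + F k) \<and>
     (\<forall>z. \<forall>h\<in>H1 \<omega> \<psi>. F (\<lambda>x. z * h x) = cnj z * F h) \<and>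
     (\<exists>C. \<forall>h\<in>H1 \<omega> \<psi>. norm (F h) \<le> C * H1_norm \<omega> \<psi> h)}"

text \<open>The extended transform: \<open>F (shear_rep g \<psi>)\<close> is the pairing of \<open>F\<close> with
  \<open>shear_rep g \<psi>\<close>.\<close>

definition voice :: "(real ^ 2 \<Rightarrow> complex) \<Rightarrow> ((real ^ 2 \<Rightarrow> complex) \<Rightarrow> complex) \<Rightarrow> shear_par \<Rightarrow> complex" where
  "voice \<psi> F = (\<lambda>g. F (shear_rep g \<psi>))"

definition shearlet_coorbit ::
  "(shear_par \<Rightarrow> real) \<Rightarrow> (real ^ 2 \<Rightarrow> complex) \<Rightarrow> real \<Rightarrow> (shear_par \<Rightarrow> real) \<Rightarrow>
   ((real ^ 2 \<Rightarrow> complex) \<Rightarrow> complex) set" where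
  "shearlet_coorbit \<omega> \<psi> p m = {F \<in> antidual \<omega> \<psi>. voice \<psi> F \<in> Lpw_space m p}"

definition shearlet_coorbit_norm ::
  "(real ^ 2 \<Rightarrow> complex) \<Rightarrow> real \<Rightarrow> (shear_par \<Rightarrow> real) \<Rightarrow> ((real ^ 2 \<Rightarrow> complex) \<Rightarrow> complex) \<Rightarrow> real" where
  "shearlet_coorbit_norm \<psi> p m F = Lpw_norm m p (voice \<psi> F)"

text \<open>Square integrability of the representation at \<open>\<psi>\<close>.\<close>

definition admissible :: "(real ^ 2 \<Rightarrow> complex) \<Rightarrow> bool" where
  "admissible \<psi> \<longleftrightarrow> \<psi> \<in> Lp_space lborel 2 \<and> \<not> (AE x in lborel. \<psi> x = 0) \<and>
     shear_transform \<psi> \<psi> \<in> Lp_space shear_haar 2"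

definition shearlet_system ::
  "(real ^ 2 \<Rightarrow> complex) \<Rightarrow> ('l \<Rightarrow> shear_par) \<Rightarrow> 'l \<Rightarrow> real ^ 2 \<Rightarrow> complex" where
  "shearlet_system \<psi> par l = shear_rep (par l) \<psi>"

definition banach_frame ::
  "(shear_par \<Rightarrow> real) \<Rightarrow> (real ^ 2 \<Rightarrow> complex) \<Rightarrow> 'l set \<Rightarrow> ('l \<Rightarrow> shear_par) \<Rightarrow> real \<Rightarrow>
   (shear_par \<Rightarrow> real) \<Rightarrow> bool" where
  "banach_frame \<omega> \<psi> L par p m \<longleftrightarrow>
     (let SC = shearlet_coorbit \<omega> \<psi> p m;
          nrm = shearlet_coorbit_norm \<psi> p m;
          M = (\<lambda>F l. F (shearlet_system \<psi> par l))
      in (\<forall>F\<in>antidual \<omega> \<psi>. F \<in> SC \<longleftrightarrow> M F \<in> ell L p) \<and>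
         (\<exists>c>0. \<exists>C. \<forall>F\<in>SC. c * nrm F \<le> ell_norm L p (M F) \<and> ell_norm L p (M F) \<le> C * nrm F) \<and>
         (\<exists>R C. (\<forall>c\<in>ell L p. R c \<in> SC \<and> nrm (R c) \<le> C * ell_norm L p c) \<and>
            (\<forall>c\<in>ell L p. \<forall>d\<in>ell L p. R (\<lambda>l. c l + d l) = (\<lambda>h. R c h + R d h)) \<and>
            (\<forall>z. \<forall>c\<in>ell L p. R (\<lambda>l. z * c l) = (\<lambda>h. z * R c h)) \<and>
            (\<forall>F\<in>SC. R (M F) = F)))"

text \<open>The condition \<open>\<psi> \<in> H1 \<omega> \<psi>\<close> makes the pairing with \<open>shear_rep g \<psi>\<close> meaningful
  on the anti-dual.\<close>

definition shearlet_setting ::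
  "(shear_par \<Rightarrow> real) \<Rightarrow> (real ^ 2 \<Rightarrow> complex) \<Rightarrow> 'l set \<Rightarrow> ('l \<Rightarrow> shear_par) \<Rightarrow> bool" where
  "shearlet_setting \<omega> \<psi> L par \<longleftrightarrow>
     group_weight \<omega> \<and> admissible \<psi> \<and> compact (closure {x. \<psi> x \<noteq> 0}) \<and> \<psi> \<in> H1 \<omega> \<psi> \<and>
     countable L \<and> par ` L \<subseteq> shearlet_group \<and>
     (\<forall>p\<in>{1..2}. banach_frame \<omega> \<psi> L par p (\<lambda>g. 1))"

text \<open>A square-integrable function as an element of the anti-dual.\<close>

definition embed ::
  "(shear_par \<Rightarrow> real) \<Rightarrow> (real ^ 2 \<Rightarrow> complex) \<Rightarrow> (real ^ 2 \<Rightarrow> complex) \<Rightarrow>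
   (real ^ 2 \<Rightarrow> complex) \<Rightarrow> complex" where
  "embed \<omega> \<psi> f = (\<lambda>h. if h \<in> H1 \<omega> \<psi> then L2_inner f h else 0)"

text \<open>The coorbit elements supported in the unit square, represented by functions. No element is
  lost by asking for a square-integrable representative: for \<open>p \<le> 2\<close> and trivial weight the
  coorbit space is contained in the one for \<open>p = 2\<close>, which is the space of square-integrable
  functions.\<close>

definition shearlet_X ::
  "(shear_par \<Rightarrow> real) \<Rightarrow> (real ^ 2 \<Rightarrow> complex) \<Rightarrow> real \<Rightarrow> (real ^ 2 \<Rightarrow> complex) set" where
  "shearlet_X \<omega> \<psi> p = {f \<in> L2_on (cbox 0 1). embed \<omega> \<psi> f \<in> shearlet_coorbit \<omega> \<psi> p (\<lambda>g. 1)}"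


section \<open>The sampled operator and the functional\<close>

text \<open>Only the components with index in \<open>{1..N}\<close> of an element of the direct sum of \<open>N\<close> copies of
  \<open>'v\<close> matter.\<close>

definition VN_inner :: "nat \<Rightarrow> (nat \<Rightarrow> 'v::real_inner) \<Rightarrow> (nat \<Rightarrow> 'v) \<Rightarrow> real" where
  "VN_inner N v w = (1 / real N) * (\<Sum>n=1..N. v n \<bullet> w n)"

definition VN_norm :: "nat \<Rightarrow> (nat \<Rightarrow> 'v::real_inner) \<Rightarrow> real" where
  "VN_norm N v = sqrt (VN_inner N v v)"

definition sampled :: "('f \<Rightarrow> 'u \<Rightarrow> 'v) \<Rightarrow> (nat \<Rightarrow> 'u) \<Rightarrow> 'f \<Rightarrow> nat \<Rightarrow> 'v" where
  "sampled A u f = (\<lambda>n. A f (u n))"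

text \<open>Linearity is required over the reals only. This covers complex Hilbert spaces \<open>'v\<close> (with the
  real part of the inner product) and complex-linear \<open>A\<close>.\<close>

definition forward_operator ::
  "'l set \<Rightarrow> ('l \<Rightarrow> 'a::euclidean_space \<Rightarrow> complex) \<Rightarrow> ('a \<Rightarrow> complex) set \<Rightarrow>
   (('a \<Rightarrow> complex) \<Rightarrow> 'u::topological_space \<Rightarrow> 'v::real_inner) \<Rightarrow> 'u set \<Rightarrow>
   nat \<Rightarrow> (nat \<Rightarrow> 'u) \<Rightarrow> bool" where
  "forward_operator L \<psi> X2 A U N u \<longleftrightarrow>
     (\<forall>f\<in>X2. continuous_on U (A f)) \<and>
     (\<forall>f\<in>X2. \<forall>h\<in>X2. \<forall>y\<in>U. A (\<lambda>x. f x + h x) y = A f y + A h y) \<and>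
     (\<forall>c. \<forall>f\<in>X2. \<forall>y\<in>U. A (\<lambda>x. of_real c * f x) y = c *\<^sub>R A f y) \<and>
     (\<exists>C. \<forall>f\<in>X2. VN_norm N (sampled A u f) \<le> C * X_norm L \<psi> 2 f)"

definition iota_plus :: "('a::euclidean_space \<Rightarrow> complex) \<Rightarrow> ereal" where
  "iota_plus f = (if (AE x in lborel. Im (f x) = 0 \<and> 0 \<le> Re (f x)) then 0 else \<infinity>)"

definition J_functional ::
  "'l set \<Rightarrow> ('l \<Rightarrow> 'a::euclidean_space \<Rightarrow> complex) \<Rightarrow>
   (('a \<Rightarrow> complex) \<Rightarrow> 'u \<Rightarrow> 'v::real_inner) \<Rightarrow> nat \<Rightarrow> (nat \<Rightarrow> 'u) \<Rightarrow> (nat \<Rightarrow> 'v) \<Rightarrow>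
   real \<Rightarrow> real \<Rightarrow> ('a \<Rightarrow> complex) \<Rightarrow> ereal" where
  "J_functional L \<psi> A N u g \<alpha> p f =
     ereal (1 / 2 * (VN_norm N (\<lambda>n. sampled A u f n - g n))\<^sup>2
            + \<alpha> * (1 / p) * (ell_norm L p (coeffs \<psi> f)) powr p)
     + iota_plus f"

definition the_minimizer ::
  "(('a::euclidean_space \<Rightarrow> complex) \<Rightarrow> ereal) \<Rightarrow> ('a \<Rightarrow> complex) set \<Rightarrow> ('a \<Rightarrow> complex) \<Rightarrow> bool" where
  "the_minimizer J X f \<longleftrightarrow>
     is_arg_min J (\<lambda>h. h \<in> X) f \<and>
     (\<forall>h. is_arg_min J (\<lambda>h. h \<in> X) h \<longrightarrow> (AE x in lborel. h x = f x))"

end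

theory Submission
  imports Defs "HOL-Probability.Probability"
begin

text \<open>
  Comparing with \<open>f 1\<close> bounds the coefficients of the minimizers \<open>f (p n)\<close> in \<open>\<ell>\<^sup>2\<close>. By convexity of
  the functionals, every weak cluster point minimizes the limit functional and is thus \<open>f 1\<close>; here
  Young's inequality \<open>t \<le> t powr r / r + (1 - 1 / r)\<close> compares the \<open>\<ell>\<^sup>1\<close> penalty with the \<open>\<ell>\<^sup>r\<close> penalty.
  Since the data term is weakly lower semicontinuous, the penalties converge as well, so the
  coefficients outside a finite set are uniformly small, and coordinatewise convergence becomes
  convergence in \<open>\<ell>\<^sup>2\<close>.

  Weak limits must be functions again, which needs completeness of \<open>X\<^sub>2\<close>, i.e. a lower frame bound
  in the \<open>L\<^sup>2\<close> norm. In the Besov case it is the norm equivalence for \<open>p = 2\<close>. In the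
  shearlet case it rests on the orthogonality relation of the shearlet transform, proved with
  Plancherel's theorem; the same relation shows that square-integrable functions
  belong to the anti-dual.
\<close>

section \<open>Square-integrable functions\<close>

text \<open>The minimizers \<open>f (p n)\<close> live in larger spaces than \<open>f 1\<close> and
  need not have summable coefficients, so the \<open>\<ell>\<^sup>1\<close> penalty can be evaluated
  only on finite index sets \<open>G\<close>. There Young's inequality costs
  \<open>card G * (1 - 1 / p n)\<close>, which vanishes for fixed \<open>G\<close>; a bound uniform
  in \<open>G\<close> then makes the coefficients of the limit summable. No weak topology appears.
  Weakly closed convex sets are replaced by closed midpoint-convex ones, and weak lower
  semicontinuity by the fact that sublevel sets are of this kind. Coordinatewise convergence is the
  case of real and imaginary parts of coefficients, with both signs. Elements are representatives
  identified almost everywhere, so the Hilbert space facts are phrased through a squared distance on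
  functions, and limits are determined only up to null sets. In the shearlet case the frame
  inequality compares coefficients with the norm of the transform; the orthogonality relation leads
  from there back to the function. Its constant may be infinite, so only a positive lower bound for
  it is extracted.\<close>

lemma borel_measurable_cnj [measurable (raw)]:
  "f \<in> borel_measurable M \<Longrightarrow> (\<lambda>x. cnj (f x)) \<in> borel_measurable M"
  by (rule measurable_compose[OF _ borel_measurable_continuous_onI]) (auto intro: continuous_intros)

lemma tendsto_0_squeeze:
  fixes a b :: "nat \<Rightarrow> real"
  assumes "\<And>k. 0 \<le> a k" "\<And>k. a k \<le> b k" "b \<longlonglongrightarrow> 0"
  shows "a \<longlonglongrightarrow> 0"
  by (rule tendsto_sandwich[OF _ _ tendsto_const assms(3)]) (simp_all add: assms(1,2))

lemma tendsto_of_norm_sq_le: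
  fixes z :: "nat \<Rightarrow> 'b::real_normed_vector"
  assumes "\<And>k. (norm (z k - w))\<^sup>2 \<le> b k" "b \<longlonglongrightarrow> 0"
  shows "z \<longlonglongrightarrow> w"
proof -
  have "(\<lambda>k. (norm (z k - w))\<^sup>2) \<longlonglongrightarrow> 0"
    by (rule tendsto_0_squeeze[OF zero_le_power2 assms])
  then have "(\<lambda>k. sqrt ((norm (z k - w))\<^sup>2)) \<longlonglongrightarrow> sqrt 0" by (rule tendsto_real_sqrt)
  then show ?thesis by (simp add: tendsto_norm_zero_iff LIM_zero_iff)
qed

text \<open>Squares instead of norms keep the parallelogram law and the frame bounds linear. By the
  convention of the Bochner integral the value is 0 if the square is not integrable.\<close>

definition sqnorm :: "'a measure \<Rightarrow> ('a \<Rightarrow> complex) \<Rightarrow> real" where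
  "sqnorm M f = (\<integral>x. (norm (f x))\<^sup>2 \<partial>M)"

lemma Lp_space_2_iff:
  "f \<in> Lp_space M 2 \<longleftrightarrow> f \<in> borel_measurable M \<and> integrable M (\<lambda>x. (norm (f x))\<^sup>2)"
  by (simp add: Lp_space_def)

lemma Lp_norm_2: "Lp_norm M 2 f = sqrt (sqnorm M f)"
  by (simp add: Lp_norm_def sqnorm_def powr_half_sqrt)

lemma sqnorm_nonneg [simp]: "0 \<le> sqnorm M f"
  by (simp add: sqnorm_def)

lemma L2_measurable: "f \<in> Lp_space M 2 \<Longrightarrow> f \<in> borel_measurable M"
  and L2_integrable: "f \<in> Lp_space M 2 \<Longrightarrow> integrable M (\<lambda>x. (norm (f x))\<^sup>2)"
  by (auto simp: Lp_space_2_iff)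

lemma L2_bound:
  assumes "f \<in> borel_measurable M" "integrable M b" "AE x in M. (norm (f x))\<^sup>2 \<le> b x"
  shows "f \<in> Lp_space M 2"
  unfolding Lp_space_2_iff
proof
  have [measurable]: "f \<in> borel_measurable M" by fact
  show "integrable M (\<lambda>x. (norm (f x))\<^sup>2)"
    using assms(3) by (intro Bochner_Integration.integrable_bound[OF assms(2)]) (auto elim!: eventually_mono)
qed fact

lemma norm_add_sq_le: "(norm (a + b :: complex))\<^sup>2 \<le> 2 * (norm a)\<^sup>2 + 2 * (norm b)\<^sup>2"
proof -
  have "(norm (a + b))\<^sup>2 \<le> (norm a + norm b)\<^sup>2"
    by (intro power_mono norm_triangle_ineq norm_ge_zero)
  also have "\<dots> \<le> 2 * (norm a)\<^sup>2 + 2 * (norm b)\<^sup>2"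
    using zero_le_power2[of "norm a - norm b"] by (simp add: power2_eq_square algebra_simps)
  finally show ?thesis .
qed

lemma L2_add:
  assumes "f \<in> Lp_space M 2" "g \<in> Lp_space M 2"
  shows "(\<lambda>x. f x + g x) \<in> Lp_space M 2"
  using assms norm_add_sq_le
  by (intro L2_bound[where b = "\<lambda>x. 2 * (norm (f x))\<^sup>2 + 2 * (norm (g x))\<^sup>2"])
     (auto simp: Lp_space_2_iff)

lemma L2_scale:
  assumes "f \<in> Lp_space M 2"
  shows "(\<lambda>x. c * f x) \<in> Lp_space M 2"
  using assms by (auto simp: Lp_space_2_iff norm_mult power_mult_distrib)

lemma L2_diff:
  assumes "f \<in> Lp_space M 2" "g \<in> Lp_space M 2"
  shows "(\<lambda>x. f x - g x) \<in> Lp_space M 2"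
  using L2_add[OF assms(1) L2_scale[OF assms(2), of "-1"]] by simp

lemma L2_zero: "(\<lambda>x. 0) \<in> Lp_space M 2"
  by (simp add: Lp_space_2_iff)

lemma sqnorm_add_le:
  assumes "f \<in> Lp_space M 2" "g \<in> Lp_space M 2"
  shows "sqnorm M (\<lambda>x. f x + g x) \<le> 2 * sqnorm M f + 2 * sqnorm M g"
proof -
  have "sqnorm M (\<lambda>x. f x + g x) \<le> (\<integral>x. 2 * (norm (f x))\<^sup>2 + 2 * (norm (g x))\<^sup>2 \<partial>M)"
    unfolding sqnorm_def using assms L2_add[OF assms] norm_add_sq_le
    by (intro integral_mono) (auto simp: Lp_space_2_iff)
  then show ?thesis using assms by (simp add: sqnorm_def Lp_space_2_iff)
qed

lemma sqnorm_parallelogram: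
  assumes "f \<in> Lp_space M 2" "g \<in> Lp_space M 2"
  shows "sqnorm M (\<lambda>x. f x - g x) = 2 * sqnorm M f + 2 * sqnorm M g - 4 * sqnorm M (\<lambda>x. (f x + g x) / 2)"
proof -
  have "(norm (a - b))\<^sup>2 = 2 * (norm a)\<^sup>2 + 2 * (norm b)\<^sup>2 - 4 * (norm ((a + b) / 2))\<^sup>2" for a b :: complex
    unfolding cmod_power2 by (simp add: power2_eq_square field_simps)
  then have "sqnorm M (\<lambda>x. f x - g x) =
      (\<integral>x. 2 * (norm (f x))\<^sup>2 + 2 * (norm (g x))\<^sup>2 - 4 * (norm ((f x + g x) / 2))\<^sup>2 \<partial>M)"
    unfolding sqnorm_def by presburger
  also have "\<dots> = 2 * sqnorm M f + 2 * sqnorm M g - 4 * sqnorm M (\<lambda>x. (f x + g x) / 2)"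
  proof -
    have "(\<lambda>x. (f x + g x) / 2) \<in> Lp_space M 2"
      using L2_scale[OF L2_add[OF assms], of "1/2"] by simp
    then show ?thesis using assms by (simp add: sqnorm_def Lp_space_2_iff del: norm_divide)
  qed
  finally show ?thesis .
qed

lemma ennreal_sqnorm:
  assumes "f \<in> Lp_space M 2"
  shows "(\<integral>\<^sup>+x. ennreal ((norm (f x))\<^sup>2) \<partial>M) = ennreal (sqnorm M f)"
  unfolding sqnorm_def using assms by (intro nn_integral_eq_integral) (auto simp: Lp_space_2_iff)

lemma L2_I_nn:
  assumes "f \<in> borel_measurable M" "(\<integral>\<^sup>+x. ennreal ((norm (f x))\<^sup>2) \<partial>M) < \<infinity>"
  shows "f \<in> Lp_space M 2"
  using assms by (auto simp: Lp_space_2_iff intro!: integrableI_nonneg)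

lemma sqnorm_leI:
  assumes "f \<in> borel_measurable M" "(\<integral>\<^sup>+x. ennreal ((norm (f x))\<^sup>2) \<partial>M) \<le> ennreal c" "0 \<le> c"
  shows "sqnorm M f \<le> c"
  using ennreal_sqnorm[OF L2_I_nn[OF assms(1)]] assms
  by (metis ennreal_le_iff ennreal_less_top infinity_ennreal_def order_le_less_trans)

lemma sqnorm_eq_0_AE:
  assumes "f \<in> Lp_space M 2" "sqnorm M f = 0"
  shows "AE x in M. f x = 0"
  using assms integral_nonneg_eq_0_iff_AE[of M "\<lambda>x. (norm (f x))\<^sup>2"]
  by (auto simp: Lp_space_2_iff sqnorm_def)

text \<open>Arithmetic-geometric mean inequality optimized over \<open>t\<close>: the infimum of the
  right-hand side is the square root of \<open>A * B\<close>. The optimal \<open>t\<close>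
  degenerates when \<open>A\<close> or \<open>B\<close> is zero, hence the perturbation of both by
  \<open>d\<close>.\<close>

lemma sq_le_prodI:
  fixes X A B :: real
  assumes "\<And>t. t > 0 \<Longrightarrow> X \<le> (t * A + B / t) / 2" "0 \<le> A" "0 \<le> B" "0 \<le> X"
  shows "X\<^sup>2 \<le> A * B"
proof (rule field_le_epsilon)
  fix e :: real assume "e > 0"
  \<comment> \<open>Chosen so that the error \<open>d * (A + B) + d\<^sup>2\<close> of the perturbed
    product is at most \<open>e\<close>.\<close>
  define d where "d = min 1 (e / (A + B + 1))"
  have d: "0 < d" "d \<le> 1" "d * (A + B + 1) \<le> e"
  proof -
    have "0 < A + B + 1" using assms by simp
    then have "d \<le> e / (A + B + 1)" "0 < e / (A + B + 1)" using \<open>e > 0\<close> by (auto simp: d_def)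
    with \<open>0 < A + B + 1\<close> show "0 < d" "d \<le> 1" "d * (A + B + 1) \<le> e"
      by (simp_all add: d_def pos_le_divide_eq[symmetric])
  qed
  \<comment> \<open>The minimizer of \<open>t * (A + d) + (B + d) / t\<close> over positive
    \<open>t\<close>.\<close>
  define s where "s = sqrt ((B + d) / (A + d))"
  have s: "s > 0" "s\<^sup>2 = (B + d) / (A + d)"
    using d assms by (auto simp: s_def)
  have s3: "s\<^sup>2 * (A + d) = B + d" using s d assms by simp
  have "X \<le> (s * A + B / s) / 2" by (rule assms(1)) (rule s)
  also have "\<dots> \<le> (s * (A + d) + (B + d) / s) / 2"
    using s d by (intro divide_right_mono add_mono mult_left_mono divide_right_mono) auto
  finally have "X * (2 * s) \<le> s * s * (A + d) + (B + d)"
    using s(1) by (simp add: field_simps)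
  also have "\<dots> = 2 * s\<^sup>2 * (A + d)" using s3 by (simp add: power2_eq_square)
  finally have "X \<le> s * (A + d)" using s by (simp add: power2_eq_square)
  then have "X\<^sup>2 \<le> (s * (A + d))\<^sup>2" using assms by (intro power_mono) auto
  also have "\<dots> = (A + d) * (B + d)"
    using s3 by (simp add: power_mult_distrib power2_eq_square)
  also have "\<dots> \<le> A * B + d * (A + B + 1)"
    using d assms by (simp add: algebra_simps mult_left_le)
  finally show "X\<^sup>2 \<le> A * B + e" using d by simp
qed

lemma L2_mult_bound:
  fixes a b :: complex assumes "t > 0"
  shows "norm (a * b) \<le> (t * (norm a)\<^sup>2 + (norm b)\<^sup>2 / t) / 2"
proof -
  have "0 \<le> (t * norm a - norm b)\<^sup>2 / t" using assms by simp
  then show ?thesis using assms by (simp add: norm_mult power2_eq_square field_simps)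
qed

lemma L2_mult_integrable:
  assumes "f \<in> Lp_space M 2" "g \<in> Lp_space M 2"
  shows "integrable M (\<lambda>x. f x * cnj (g x))"
proof (rule Bochner_Integration.integrable_bound[where f = "\<lambda>x. (1 * (norm (f x))\<^sup>2 + (norm (g x))\<^sup>2 / 1) / 2"])
  show "AE x in M. norm (f x * cnj (g x)) \<le> norm ((1 * (norm (f x))\<^sup>2 + (norm (g x))\<^sup>2 / 1) / 2)"
  proof (intro AE_I2)
    fix x show "norm (f x * cnj (g x)) \<le> norm ((1 * (norm (f x))\<^sup>2 + (norm (g x))\<^sup>2 / 1) / 2)"
      using L2_mult_bound[of 1 "f x" "cnj (g x)"] by simp
  qed
qed (use assms in \<open>auto simp: Lp_space_2_iff\<close>)

text \<open>The norm stands inside the integral; this stronger form is what the Young inequality for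
  correlations uses.\<close>

lemma L2_Cauchy_Schwarz_norm:
  assumes "f \<in> Lp_space M 2" "g \<in> Lp_space M 2"
  shows "(\<integral>x. norm (f x * cnj (g x)) \<partial>M)\<^sup>2 \<le> sqnorm M f * sqnorm M g"
proof (rule sq_le_prodI)
  fix t :: real assume t: "t > 0"
  have "(\<integral>x. norm (f x * cnj (g x)) \<partial>M) \<le> (\<integral>x. (t * (norm (f x))\<^sup>2 + (norm (g x))\<^sup>2 / t) / 2 \<partial>M)"
    using L2_mult_integrable[OF assms] assms L2_mult_bound[OF t, of "f _" "cnj (g _)"]
    by (intro integral_mono) (auto simp: Lp_space_2_iff)
  then show "(\<integral>x. norm (f x * cnj (g x)) \<partial>M) \<le> (t * sqnorm M f + sqnorm M g / t) / 2"
    using assms by (simp add: sqnorm_def Lp_space_2_iff)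
qed simp_all

lemma L2_Cauchy_Schwarz:
  assumes "f \<in> Lp_space M 2" "g \<in> Lp_space M 2"
  shows "(norm (\<integral>x. f x * cnj (g x) \<partial>M))\<^sup>2 \<le> sqnorm M f * sqnorm M g"
  using L2_Cauchy_Schwarz_norm[OF assms] power_mono[OF integral_norm_bound[of M "\<lambda>x. f x * cnj (g x)"] norm_ge_zero, of 2]
  by linarith

text \<open>Along a subsequence the increments \<open>d k\<close> satisfy \<open>sqnorm M (d k) \<le> 4\<^sup>-\<^sup>k\<close>; the weighted sum of
  the squares \<open>2^k * \<bar>d k\<bar>\<^sup>2\<close> is then integrable, which bounds the sum of the increments.\<close>

lemma L2_complete:
  assumes F: "\<And>k. F k \<in> Lp_space M 2"
    and Cauchy: "\<And>e. e > 0 \<Longrightarrow> \<exists>n0. \<forall>m\<ge>n0. \<forall>n\<ge>n0. sqnorm M (\<lambda>x. F m x - F n x) \<le> e"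
  obtains f where "f \<in> Lp_space M 2" "(\<lambda>k. sqnorm M (\<lambda>x. F k x - f x)) \<longlonglongrightarrow> 0"
proof -
  have "\<forall>k. \<exists>n0. \<forall>m\<ge>n0. \<forall>n\<ge>n0. sqnorm M (\<lambda>x. F m x - F n x) \<le> (1/4)^k"
    using Cauchy by simp
  then obtain \<nu> where \<nu>: "\<And>k m n. m \<ge> \<nu> k \<Longrightarrow> n \<ge> \<nu> k \<Longrightarrow> sqnorm M (\<lambda>x. F m x - F n x) \<le> (1/4)^k"
    by metis
  \<comment> \<open>Partial sums make the subsequence strictly increasing while it still dominates
    \<open>\<nu>\<close>.\<close>
  define r where "r = (\<lambda>k. \<Sum>i\<le>k. \<nu> i + 1)"
  have r_ge: "\<nu> k \<le> r k" for k
    unfolding r_def using member_le_sum[of k "{..k}" "\<lambda>i. \<nu> i + 1"] by simp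
  have r_mono: "strict_mono r"
    by (rule strict_monoI_Suc) (simp add: r_def)
  define G where "G k = F (r k)" for k
  define d where "d k x = G (Suc k) x - G k x" for k x
  have G: "G k \<in> Lp_space M 2" for k unfolding G_def by (rule F)
  have d: "d k \<in> Lp_space M 2" for k unfolding d_def by (intro L2_diff G)
  note [measurable] = L2_measurable[OF F] L2_measurable[OF G] L2_measurable[OF d]
  have dk: "sqnorm M (d k) \<le> (1/4)^k" for k
    unfolding d_def G_def using r_ge[of k] r_mono
    by (intro \<nu>) (auto intro: order_trans[OF _ less_imp_le[OF strict_monoD[OF r_mono]]])
  have "(\<integral>\<^sup>+x. (\<Sum>k. ennreal (2^k * (norm (d k x))\<^sup>2)) \<partial>M) = (\<Sum>k. \<integral>\<^sup>+x. ennreal (2^k * (norm (d k x))\<^sup>2) \<partial>M)"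
    by (intro nn_integral_suminf) measurable
  also have "\<dots> = (\<Sum>k. ennreal (2^k * sqnorm M (d k)))"
    by (simp add: ennreal_mult nn_integral_cmult ennreal_sqnorm[OF d])
  also have "\<dots> \<le> (\<Sum>k. ennreal ((1/2)^k))"
  proof (intro suminf_le ennreal_leI)
    show "2^k * sqnorm M (d k) \<le> (1/2)^k" for k
      using mult_left_mono[OF dk[of k], of "2^k"] by (simp add: power_mult_distrib[symmetric])
  qed auto
  also have "\<dots> = ennreal (\<Sum>k. (1/2)^k)"
    by (intro suminf_ennreal2) auto
  also have "\<dots> < \<infinity>" by simp
  finally have "AE x in M. (\<Sum>k. ennreal (2^k * (norm (d k x))\<^sup>2)) \<noteq> \<infinity>"
    by (intro nn_integral_PInf_AE) auto
  then have conv: "AE x in M. convergent (\<lambda>k. G k x)"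
  proof eventually_elim
    case (elim x)
    have "summable (\<lambda>k. 2^k * (norm (d k x))\<^sup>2)"
      using elim by (intro summable_suminf_not_top) auto
    moreover have "summable (\<lambda>k. (1/2)^k :: real)" by simp
    ultimately have S: "summable (\<lambda>k. 2^k * (norm (d k x))\<^sup>2 + (1/2)^k)"
      by (rule summable_add)
    have "summable (\<lambda>k. d k x)"
    proof (rule summable_comparison_test'[OF S])
      fix k :: nat
      \<comment> \<open>The weight \<open>2^k\<close>, played against the constant 1, trades the
        increment for its weighted square plus a geometric term.\<close>
      have "norm (d k x * 1) \<le> (2^k * (norm (d k x))\<^sup>2 + (norm (1::complex))\<^sup>2 / 2^k) / 2"
        by (rule L2_mult_bound) simp
      also have "\<dots> \<le> 2^k * (norm (d k x))\<^sup>2 + (1/2)^k"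
      proof -
        have "(a + b) / 2 \<le> a + b" if "0 \<le> a" "0 \<le> b" for a b :: real
          using that by simp
        from this[of "2^k * (norm (d k x))\<^sup>2" "1 / 2^k"] show ?thesis
          by (simp add: power_one_over)
      qed
      finally show "norm (d k x) \<le> 2^k * (norm (d k x))\<^sup>2 + (1/2)^k" by simp
    qed
    then have "convergent (\<lambda>n. \<Sum>k<n. d k x)" by (simp add: summable_iff_convergent)
    then have "convergent (\<lambda>n. (\<Sum>k<n. d k x) + G 0 x)" by (intro convergent_add convergent_const)
    moreover have "(\<Sum>k<n. d k x) + G 0 x = G n x" for n
      using sum_lessThan_telescope[of "\<lambda>k. G k x" n] by (simp add: d_def)
    ultimately show ?case by simp
  qed
  define f where "f x = lim (\<lambda>k. G k x)" for x
  have [measurable]: "f \<in> borel_measurable M"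
    unfolding f_def by (rule borel_measurable_lim_metric) measurable
  have Gf: "AE x in M. (\<lambda>k. G k x) \<longlonglongrightarrow> f x"
    using conv by eventually_elim (simp add: f_def convergent_LIMSEQ_iff)
  \<comment> \<open>Fatou's lemma along the subsequence: the Cauchy estimate for
    \<open>F n - G k\<close> passes to \<open>F n - f\<close>.\<close>
  have key: "(\<integral>\<^sup>+x. ennreal ((norm (F n x - f x))\<^sup>2) \<partial>M) \<le> ennreal e"
    if e: "e > 0" "\<And>m n. m \<ge> n0 \<Longrightarrow> n \<ge> n0 \<Longrightarrow> sqnorm M (\<lambda>x. F m x - F n x) \<le> e" and n: "n \<ge> n0" for e n0 n
  proof -
    have "(\<integral>\<^sup>+x. ennreal ((norm (F n x - f x))\<^sup>2) \<partial>M) = (\<integral>\<^sup>+x. liminf (\<lambda>k. ennreal ((norm (F n x - G k x))\<^sup>2)) \<partial>M)"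
    proof (intro nn_integral_cong_AE)
      show "AE x in M. ennreal ((norm (F n x - f x))\<^sup>2) = liminf (\<lambda>k. ennreal ((norm (F n x - G k x))\<^sup>2))"
        using Gf
      proof eventually_elim
        case (elim x)
        have "(\<lambda>k. ennreal ((norm (F n x - G k x))\<^sup>2)) \<longlonglongrightarrow> ennreal ((norm (F n x - f x))\<^sup>2)"
          by (intro tendsto_ennrealI tendsto_intros elim)
        then show ?case by (metis lim_imp_Liminf sequentially_bot)
      qed
    qed
    also have "\<dots> \<le> liminf (\<lambda>k. \<integral>\<^sup>+x. ennreal ((norm (F n x - G k x))\<^sup>2) \<partial>M)"
      by (intro nn_integral_liminf) measurable
    also have "\<dots> \<le> ennreal e"
    proof -
      have "\<forall>\<^sub>F k in sequentially. (\<integral>\<^sup>+x. ennreal ((norm (F n x - G k x))\<^sup>2) \<partial>M) \<le> ennreal e"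
        unfolding eventually_sequentially
      proof (intro exI[of _ n0] allI impI)
        fix k assume "k \<ge> n0"
        then have "r k \<ge> n0" using seq_suble[OF r_mono, of k] by simp
        then have "sqnorm M (\<lambda>x. F n x - G k x) \<le> e" unfolding G_def using e n by blast
        then show "(\<integral>\<^sup>+x. ennreal ((norm (F n x - G k x))\<^sup>2) \<partial>M) \<le> ennreal e"
          by (subst ennreal_sqnorm[OF L2_diff[OF F G]]) (rule ennreal_leI)
      qed
      then show ?thesis
        by (intro order_trans[OF Liminf_le_Limsup Limsup_bounded]) auto
    qed
    finally show ?thesis .
  qed
  have Ff: "(\<lambda>x. F n x - f x) \<in> Lp_space M 2"
    if e: "e > 0" "\<And>m n. m \<ge> n0 \<Longrightarrow> n \<ge> n0 \<Longrightarrow> sqnorm M (\<lambda>x. F m x - F n x) \<le> e" and n: "n \<ge> n0" for e n0 n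
    using key[OF that] by (intro L2_I_nn) (auto simp: order_le_less_trans)
  obtain n0 where "\<forall>m\<ge>n0. \<forall>n\<ge>n0. sqnorm M (\<lambda>x. F m x - F n x) \<le> 1" using Cauchy[of 1] by auto
  then have "(\<lambda>x. F n0 x - f x) \<in> Lp_space M 2" using Ff[of 1 n0 n0] by auto
  from L2_diff[OF F[of n0] this] have fL: "f \<in> Lp_space M 2" by simp
  have "(\<lambda>k. sqnorm M (\<lambda>x. F k x - f x)) \<longlonglongrightarrow> 0"
  proof (rule LIMSEQ_I)
    fix e :: real assume "e > 0"
    then obtain n0 where "\<forall>m\<ge>n0. \<forall>n\<ge>n0. sqnorm M (\<lambda>x. F m x - F n x) \<le> e/2" using Cauchy[of "e/2"] by auto
    then have "sqnorm M (\<lambda>x. F n x - f x) \<le> e/2" if "n \<ge> n0" for n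
      using key[of "e/2" n0 n] that \<open>e > 0\<close> by (intro sqnorm_leI) auto
    then show "\<exists>n0. \<forall>n\<ge>n0. norm (sqnorm M (\<lambda>x. F n x - f x) - 0) < e"
      using \<open>e > 0\<close> by (intro exI[of _ n0]) (force intro: order_le_less_trans[of _ "e/2"])
  qed
  with fL that show thesis by blast
qed

section \<open>Weak limits by convexity\<close>

text \<open>Closed convex sets, with \<open>e\<close> read as a squared distance. Midpoints replace
  general convex combinations because the parallelogram law sees only midpoints. \<open>H\<close>,
  \<open>mid\<close> and \<open>e\<close> are parameters since functions equal almost everywhere are
  not equal as elements.\<close>

definition closed_midconvex :: "'b set \<Rightarrow> ('b \<Rightarrow> 'b \<Rightarrow> 'b) \<Rightarrow> ('b \<Rightarrow> 'b \<Rightarrow> real) \<Rightarrow> 'b set \<Rightarrow> bool" where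
  "closed_midconvex H mid e Z \<longleftrightarrow> Z \<subseteq> H \<and> (\<forall>x\<in>Z. \<forall>y\<in>Z. mid x y \<in> Z) \<and>
     (\<forall>y x. (\<forall>k. y k \<in> Z) \<longrightarrow> x \<in> H \<longrightarrow> (\<lambda>k. e (y k) x) \<longlonglongrightarrow> 0 \<longrightarrow> x \<in> Z)"

text \<open>A substitute for weak sequential compactness. The closed convex hulls of the tails of the
  sequence are nested, and by the parallelogram law their nearly norm-minimal elements form a
  Cauchy sequence.\<close>

lemma closed_midconvex_cluster:
  fixes q :: "'b \<Rightarrow> real"
  assumes mid: "\<And>x y. x \<in> H \<Longrightarrow> y \<in> H \<Longrightarrow> mid x y \<in> H"
    and par: "\<And>x y. x \<in> H \<Longrightarrow> y \<in> H \<Longrightarrow> e x y = 2 * q x + 2 * q y - 4 * q (mid x y)"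
    and pos: "\<And>x. x \<in> H \<Longrightarrow> 0 \<le> q x"
    and complete: "\<And>y. (\<And>k. y k \<in> H) \<Longrightarrow>
        (\<And>\<epsilon>. \<epsilon> > 0 \<Longrightarrow> \<exists>n0. \<forall>m\<ge>n0. \<forall>n\<ge>n0. e (y m) (y n) \<le> \<epsilon>) \<Longrightarrow> \<exists>x\<in>H. (\<lambda>k. e (y k) x) \<longlonglongrightarrow> 0"
    and f: "\<And>k. f k \<in> H" "\<And>k. q (f k) \<le> B"
  obtains x where "x \<in> H"
    "\<And>Z. closed_midconvex H mid e Z \<Longrightarrow> (\<forall>\<^sub>F k in sequentially. f k \<in> Z) \<Longrightarrow> x \<in> Z"
proof -
  let ?cc = "closed_midconvex H mid e"
  define D where "D n = \<Inter>{Z. ?cc Z \<and> (\<forall>m\<ge>n. f m \<in> Z)}" for n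
  have ccH: "?cc H" using mid by (auto simp: closed_midconvex_def)
  have DH: "D n \<subseteq> H" for n using ccH f by (auto simp: D_def)
  have fD: "f n \<in> D n" for n by (auto simp: D_def)
  have D_mid: "mid x y \<in> D n" if "x \<in> D n" "y \<in> D n" for x y n
    using that unfolding D_def closed_midconvex_def by blast
  have D_closed: "x \<in> D n" if "\<And>k. y k \<in> D n" "x \<in> H" "(\<lambda>k. e (y k) x) \<longlonglongrightarrow> 0" for x y n
    unfolding D_def
  proof (intro InterI)
    fix Z assume Z: "Z \<in> {Z. ?cc Z \<and> (\<forall>m\<ge>n. f m \<in> Z)}"
    then have "\<And>k. y k \<in> Z" using that(1) by (auto simp: D_def)
    then show "x \<in> Z" using Z that unfolding closed_midconvex_def by blast
  qed
  have D_anti: "D n \<subseteq> D m" if "m \<le> n" for m n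
  proof -
    have "{Z. ?cc Z \<and> (\<forall>k\<ge>m. f k \<in> Z)} \<subseteq> {Z. ?cc Z \<and> (\<forall>k\<ge>n. f k \<in> Z)}" using that by auto
    then show ?thesis unfolding D_def by (rule Inter_anti_mono)
  qed
  \<comment> \<open>With \<open>q\<close> a squared norm this is the squared distance of the hull
    from the origin. It increases because the hulls are nested, and \<open>q (f n) \<le> B\<close>
    bounds it.\<close>
  define d where "d n = Inf (q ` D n)" for n
  have bdd: "bdd_below (q ` D n)" for n
    using DH pos by (intro bdd_belowI[of _ 0]) blast
  have d_le: "d n \<le> q x" if "x \<in> D n" for n x
    unfolding d_def using that by (intro cInf_lower bdd) auto
  have "\<exists>x\<in>D n. q x < d n + inverse (Suc n)" for n
    using cInf_lessD[of "q ` D n" "d n + inverse (Suc n)"] fD[of n] by (auto simp: d_def)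
  then obtain y where y: "\<And>n. y n \<in> D n" "\<And>n. q (y n) < d n + inverse (Suc n)" by metis
  have "incseq d"
    unfolding incseq_def d_def using fD
    by (intro allI impI cInf_superset_mono bdd image_mono D_anti) blast+
  moreover have "d n \<le> B" for n using d_le[OF fD[of n]] f(2)[of n] by simp
  ultimately obtain l where l: "d \<longlonglongrightarrow> l" "\<And>n. d n \<le> l"
    using incseq_convergent[of d B] by metis
  have dist: "e (y m) (y n) \<le> 2 * (l - d n0) + 2 * (l - d n0) + 4 * inverse (Suc n0)"
    if "m \<ge> n0" "n \<ge> n0" for m n n0
  proof -
    have ym: "y m \<in> D n0" and yn: "y n \<in> D n0" using y(1) D_anti that by blast+
    have "inverse (real (Suc m)) \<le> inverse (real (Suc n0))" "inverse (real (Suc n)) \<le> inverse (real (Suc n0))"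
      using that by (auto intro!: le_imp_inverse_le)
    \<comment> \<open>The midpoint stays in \<open>D n0\<close>, so the term subtracted in the
      parallelogram law is at least \<open>4 * d n0\<close>.\<close>
    moreover have "d n0 \<le> q (mid (y m) (y n))" by (intro d_le D_mid ym yn)
    moreover have "e (y m) (y n) = 2 * q (y m) + 2 * q (y n) - 4 * q (mid (y m) (y n))"
      using ym yn DH by (intro par) auto
    ultimately show ?thesis using y(2)[of m] y(2)[of n] l(2)[of m] l(2)[of n] by argo
  qed
  have "\<exists>x\<in>H. (\<lambda>k. e (y k) x) \<longlonglongrightarrow> 0"
  proof (rule complete)
    show "y k \<in> H" for k using y(1) DH by blast
    fix \<epsilon> :: real assume "\<epsilon> > 0"
    have "(\<lambda>n0. 2 * (l - d n0) + 2 * (l - d n0) + 4 * inverse (Suc n0)) \<longlonglongrightarrow> 2 * (l - l) + 2 * (l - l) + 4 * 0"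
      by (intro tendsto_intros l LIMSEQ_inverse_real_of_nat)
    then have "\<forall>\<^sub>F n0 in sequentially. 2 * (l - d n0) + 2 * (l - d n0) + 4 * inverse (Suc n0) < \<epsilon>"
      using \<open>\<epsilon> > 0\<close> by (intro order_tendstoD(2)) auto
    then obtain n0 where "2 * (l - d n0) + 2 * (l - d n0) + 4 * inverse (Suc n0) < \<epsilon>"
      by (auto simp: eventually_sequentially)
    then show "\<exists>n0. \<forall>m\<ge>n0. \<forall>n\<ge>n0. e (y m) (y n) \<le> \<epsilon>"
      using dist by (intro exI[of _ n0]) (meson less_imp_le order_trans)
  qed
  then obtain x where x: "x \<in> H" "(\<lambda>k. e (y k) x) \<longlonglongrightarrow> 0" by blast
  have xD: "x \<in> D n" for n
  proof (rule D_closed[of "\<lambda>k. y (k + n)"])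
    show "y (k + n) \<in> D n" for k using y(1) D_anti[of n "k + n"] by auto
    show "(\<lambda>k. e (y (k + n)) x) \<longlonglongrightarrow> 0" by (rule LIMSEQ_ignore_initial_segment) (rule x)
  qed (rule x)
  show thesis
  proof (rule that[OF x(1)])
    fix Z assume "?cc Z" "\<forall>\<^sub>F k in sequentially. f k \<in> Z"
    then obtain n where "\<forall>m\<ge>n. f m \<in> Z" by (auto simp: eventually_sequentially)
    then show "x \<in> Z" using xD[of n] \<open>?cc Z\<close> by (auto simp: D_def)
  qed
qed

section \<open>Closedness of the support and sign constraints under \<open>L\<^sup>2\<close>
  limits\<close>

lemma AE_eq_0_of_sqnorm_limit:
  fixes D :: "_ \<Rightarrow> complex"
  assumes "D \<in> borel_measurable M" "\<And>k. F k \<in> Lp_space M 2"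
    and "\<And>k. AE x in M. norm (D x) \<le> norm (F k x)"
    and "(\<lambda>k. sqnorm M (F k)) \<longlonglongrightarrow> 0"
  shows "AE x in M. D x = 0"
proof (rule sqnorm_eq_0_AE)
  have sq: "AE x in M. (norm (D x))\<^sup>2 \<le> (norm (F k x))\<^sup>2" for k
    using assms(3)[of k] by eventually_elim (simp add: power_mono)
  show D: "D \<in> Lp_space M 2"
    by (rule L2_bound[OF assms(1) L2_integrable[OF assms(2)[of 0]] sq])
  have "sqnorm M D \<le> sqnorm M (F k)" for k
    unfolding sqnorm_def using sq L2_integrable[OF D] L2_integrable[OF assms(2)] by (intro integral_mono_AE)
  then have "sqnorm M D \<le> 0" using assms(4) by (intro LIMSEQ_le_const) auto
  then show "sqnorm M D = 0" using sqnorm_nonneg[of M D] by linarith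
qed

lemma L2_on_closed:
  assumes F: "\<And>k. F k \<in> L2_on \<Omega>" and f: "f \<in> Lp_space lborel 2"
    and lim: "(\<lambda>k. sqnorm lborel (\<lambda>x. F k x - f x)) \<longlonglongrightarrow> 0"
  shows "f \<in> L2_on \<Omega>"
proof -
  have FL: "F k \<in> Lp_space lborel 2" and FS: "AE x in lborel. x \<notin> \<Omega> \<longrightarrow> F k x = 0" for k
    using F[of k] by (auto simp: L2_on_def supported_in_def)
  \<comment> \<open>\<open>\<Omega>\<close> need not be measurable, so we enlarge it by the null sets off which the \<open>F k\<close> vanish.\<close>
  have "AE x in lborel. \<forall>k. x \<notin> \<Omega> \<longrightarrow> F k x = 0" using FS by (subst AE_all_countable) auto
  then have AE1: "AE x in lborel. x \<notin> \<Omega> \<longrightarrow> (\<forall>k. F k x = 0)" by eventually_elim blast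
  \<comment> \<open>On the common zero set of the \<open>F k\<close> the value \<open>f x\<close> is
    minus the error \<open>F k x - f x\<close>, so \<open>D\<close> is dominated by every
    error.\<close>
  define D where "D x = indicator {x. \<forall>k. F k x = 0} x * f x" for x
  note [measurable] = L2_measurable[OF f] L2_measurable[OF FL]
  have "AE x in lborel. D x = 0"
  proof (rule AE_eq_0_of_sqnorm_limit[OF _ L2_diff[OF FL f] _ lim])
    show "D \<in> borel_measurable lborel" unfolding D_def by measurable
    show "AE x in lborel. norm (D x) \<le> norm (F k x - f x)" for k
      by (auto simp: D_def indicator_def)
  qed
  with AE1 have "AE x in lborel. x \<notin> \<Omega> \<longrightarrow> f x = 0"
    by eventually_elim (auto simp: D_def indicator_def)
  with f show ?thesis by (auto simp: L2_on_def supported_in_def)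
qed

definition nonneg_ae :: "('a::euclidean_space \<Rightarrow> complex) \<Rightarrow> bool" where
  "nonneg_ae f \<longleftrightarrow> (AE x in lborel. Im (f x) = 0 \<and> 0 \<le> Re (f x))"

lemma nonneg_ae_closed:
  assumes F: "\<And>k. F k \<in> Lp_space lborel 2" "\<And>k. nonneg_ae (F k)" and f: "f \<in> Lp_space lborel 2"
    and lim: "(\<lambda>k. sqnorm lborel (\<lambda>x. F k x - f x)) \<longlonglongrightarrow> 0"
  shows "nonneg_ae f"
proof -
  note [measurable] = L2_measurable[OF f]
  \<comment> \<open>The difference between \<open>f x\<close> and its projection onto the
    nonnegative half-line. The projection is the nearest point, so every nonnegative
    \<open>F k x\<close> is at least as far from \<open>f x\<close>.\<close>
  define D where "D x = f x - of_real (max 0 (Re (f x)))" for x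
  have le: "norm (z - of_real (max 0 (Re z))) \<le> norm (w - z)" if "Im w = 0" "0 \<le> Re w" for w z
  proof -
    have "0 \<le> Re w * (Re w - 2 * Re z)" if "Re z < 0"
      using that \<open>0 \<le> Re w\<close> by (intro mult_nonneg_nonneg) auto
    moreover have "2 * (Re w * Re z) \<le> Re w * Re w + Re z * Re z"
      using sum_squares_bound[of "Re w" "Re z"] by (simp add: power2_eq_square)
    ultimately have "(norm (z - of_real (max 0 (Re z))))\<^sup>2 \<le> (norm (w - z))\<^sup>2"
      using that unfolding cmod_power2 by (auto simp: max_def power2_eq_square algebra_simps)
    then show ?thesis by (rule power2_le_imp_le) simp
  qed
  have "AE x in lborel. D x = 0"
  proof (rule AE_eq_0_of_sqnorm_limit[OF _ L2_diff[OF F(1) f] _ lim])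
    show "D \<in> borel_measurable lborel" unfolding D_def by measurable
    show "AE x in lborel. norm (D x) \<le> norm (F k x - f x)" for k
      using F(2)[of k] unfolding nonneg_ae_def by eventually_elim (auto simp: D_def intro: le)
  qed
  then show ?thesis
    unfolding nonneg_ae_def
  proof eventually_elim
    case (elim x)
    then have "f x = of_real (max 0 (Re (f x)))" by (simp add: D_def)
    then show ?case by (metis Im_complex_of_real Re_complex_of_real max.cobounded1)
  qed
qed

section \<open>Integrals over counting measure as sums\<close>

lemma integral_count_space_split:
  fixes h :: "'l \<Rightarrow> real"
  assumes "finite G" "G \<subseteq> L" "integrable (count_space L) h"
  shows "integrable (count_space (L - G)) h"
    and "integral\<^sup>L (count_space L) h = sum h G + integral\<^sup>L (count_space (L - G)) h"
proof -
  have S: "Infinite_Set_Sum.abs_summable_on h L" using assms(3) by (simp add: abs_summable_on_def)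
  then have S': "Infinite_Set_Sum.abs_summable_on h (L - G)" by (rule abs_summable_on_subset) auto
  then show "integrable (count_space (L - G)) h" by (simp add: abs_summable_on_def)
  have "infsetsum h (G \<union> (L - G)) = infsetsum h G + infsetsum h (L - G)"
    using S S' assms by (intro infsetsum_Un_disjoint) auto
  moreover have "G \<union> (L - G) = L" using assms by auto
  ultimately show "integral\<^sup>L (count_space L) h = sum h G + integral\<^sup>L (count_space (L - G)) h"
    using assms by (simp add: infsetsum_def[symmetric])
qed

text \<open>For nonnegative terms the sum is the supremum of its finite partial sums, so some finite
  set exhausts it up to \<open>\<epsilon>\<close>.\<close>

lemma integral_count_space_tail:
  fixes h :: "'l \<Rightarrow> real"
  assumes "integrable (count_space L) h" "\<epsilon> > 0" "\<And>l. 0 \<le> h l"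
  obtains G where "finite G" "G \<subseteq> L" "integral\<^sup>L (count_space (L - G)) h < \<epsilon>"
proof -
  have "Infinite_Set_Sum.abs_summable_on h L" using assms(1) by (simp add: abs_summable_on_def)
  moreover from this have "h summable_on L"
    using summable_on_iff_abs_summable_on_real abs_summable_equivalent by blast
  ultimately have SUP: "infsetsum h L = (SUP F\<in>{F. finite F \<and> F \<subseteq> L}. sum h F)"
    using assms by (simp add: infsetsum_infsum infsum_nonneg_is_SUPREMUM_real)
  have "infsetsum h L - \<epsilon> < infsetsum h L" using assms by simp
  moreover have "bdd_above (sum h ` {F. finite F \<and> F \<subseteq> L})"
  proof (rule bdd_aboveI2)
    fix F assume "F \<in> {F. finite F \<and> F \<subseteq> L}"
    then show "sum h F \<le> integral\<^sup>L (count_space L) h"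
      using integral_count_space_split(2)[of F L h] assms by (simp add: integral_nonneg)
  qed
  ultimately obtain G where G: "finite G" "G \<subseteq> L" "infsetsum h L - \<epsilon> < sum h G"
    using SUP less_cSUP_iff[of "{F. finite F \<and> F \<subseteq> L}" "sum h" "infsetsum h L - \<epsilon>"] by auto
  then show thesis
    using integral_count_space_split(2)[of G L h] assms
    by (intro that[of G]) (auto simp: infsetsum_def)
qed

lemma sum_le_integral_count_space:
  fixes h :: "'l \<Rightarrow> real"
  assumes "finite G" "G \<subseteq> L" "integrable (count_space L) h" "\<And>l. 0 \<le> h l"
  shows "sum h G \<le> integral\<^sup>L (count_space L) h"
  using integral_count_space_split(2)[OF assms(1-3)] assms(4) by (simp add: integral_nonneg)

text \<open>This turns a bound on all finite index sets into membership in
  \<open>\<ell>\<^sup>1\<close>; the cluster point of the minimizers is treated in this way.\<close>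

lemma integrable_count_spaceI_bounded_sums:
  fixes h :: "'l \<Rightarrow> real"
  assumes "\<And>l. 0 \<le> h l" "\<And>G. finite G \<Longrightarrow> G \<subseteq> L \<Longrightarrow> sum h G \<le> B"
  shows "integrable (count_space L) h" "integral\<^sup>L (count_space L) h \<le> B"
proof -
  have "h summable_on L"
    using assms by (intro nonneg_bdd_above_summable_on bdd_aboveI2[where M = B]) auto
  then have S: "Infinite_Set_Sum.abs_summable_on h L"
    using summable_on_iff_abs_summable_on_real abs_summable_equivalent by blast
  then show I: "integrable (count_space L) h" by (simp add: abs_summable_on_def)
  show "integral\<^sup>L (count_space L) h \<le> B"
  proof (rule field_le_epsilon)
    fix \<epsilon> :: real assume "\<epsilon> > 0"
    obtain G where G: "finite G" "G \<subseteq> L" "integral\<^sup>L (count_space (L - G)) h < \<epsilon>"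
      by (rule integral_count_space_tail[OF I \<open>\<epsilon> > 0\<close> assms(1)])
    then show "integral\<^sup>L (count_space L) h \<le> B + \<epsilon>"
      using integral_count_space_split(2)[OF G(1,2) I] assms(2)[OF G(1,2)] by simp
  qed
qed

section \<open>Sequence spaces with varying exponent\<close>

lemma Lp_space_count_cong:
  assumes "\<And>l. l \<in> L \<Longrightarrow> c l = d l"
  shows "c \<in> ell L r \<longleftrightarrow> d \<in> ell L r"
proof -
  have "integrable (count_space L) (\<lambda>l. norm (c l) powr r) \<longleftrightarrow> integrable (count_space L) (\<lambda>l. norm (d l) powr r)"
    by (intro Bochner_Integration.integrable_cong) (auto simp: assms)
  then show ?thesis by (simp add: Lp_space_def)
qed

lemma sqnorm_count_cong:
  assumes "\<And>l. l \<in> L \<Longrightarrow> c l = d l"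
  shows "sqnorm (count_space L) c = sqnorm (count_space L) d"
  using assms by (auto simp: sqnorm_def intro!: Bochner_Integration.integral_cong)

lemma norm_sq_le_sqnorm_count:
  assumes "c \<in> ell L 2" "l \<in> L"
  shows "(norm (c l))\<^sup>2 \<le> sqnorm (count_space L) c"
  using sum_le_integral_count_space[of "{l}" L "\<lambda>l. (norm (c l))\<^sup>2"] assms
  by (simp add: sqnorm_def Lp_space_2_iff)

text \<open>For \<open>t \<le> 1\<close> a larger exponent gives a smaller power. For
  \<open>t > 1\<close> the missing factor \<open>t powr (2 - r)\<close> is at most
  \<open>t powr r\<close>, because \<open>2 - r \<le> r\<close>.\<close>

lemma square_le_powr:
  fixes t :: real
  assumes "0 \<le> t" "1 \<le> r" "r \<le> 2" "t powr r \<le> S"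
  shows "t\<^sup>2 \<le> max 1 S * t powr r"
proof (cases "t \<le> 1")
  case True
  have "t powr 2 \<le> t powr r"
    using assms True by (intro powr_mono') auto
  then have "t\<^sup>2 \<le> 1 * t powr r" using assms by simp
  also have "\<dots> \<le> max 1 S * t powr r" by (intro mult_right_mono) auto
  finally show ?thesis .
next
  case False
  then have t: "t > 1" by simp
  have "t powr (2 - r) \<le> t powr r" using t assms by (intro powr_mono) auto
  also have "\<dots> \<le> max 1 S" using assms by simp
  finally have "t powr (2 - r) * t powr r \<le> max 1 S * t powr r"
    by (intro mult_right_mono) auto
  then show ?thesis using t by (simp add: powr_add[symmetric])
qed

text \<open>The bound is not homogeneous but avoids roots: it stays bounded when the penalty does,
  and for a penalty at most 1 it is the penalty itself.\<close>

lemma ell_mono_2: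
  assumes "c \<in> ell L r" "1 \<le> r" "r \<le> 2"
  shows "c \<in> ell L 2"
    and "sqnorm (count_space L) c \<le> max 1 (\<integral>l. norm (c l) powr r \<partial>count_space L) * (\<integral>l. norm (c l) powr r \<partial>count_space L)"
proof -
  define S where "S = (\<integral>l. norm (c l) powr r \<partial>count_space L)"
  have I: "integrable (count_space L) (\<lambda>l. norm (c l) powr r)" using assms by (simp add: Lp_space_def)
  have le: "(norm (c l))\<^sup>2 \<le> max 1 S * norm (c l) powr r" if "l \<in> L" for l
    using sum_le_integral_count_space[of "{l}" L "\<lambda>l. norm (c l) powr r"] that I assms
    by (intro square_le_powr) (auto simp: S_def)
  show c: "c \<in> ell L 2"
    using I le by (intro L2_bound[where b = "\<lambda>l. max 1 S * norm (c l) powr r"]) (auto simp: AE_count_space)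
  have "sqnorm (count_space L) c \<le> (\<integral>l. max 1 S * norm (c l) powr r \<partial>count_space L)"
    unfolding sqnorm_def using L2_integrable[OF c] I le by (intro integral_mono) auto
  then show "sqnorm (count_space L) c \<le> max 1 (\<integral>l. norm (c l) powr r \<partial>count_space L) * (\<integral>l. norm (c l) powr r \<partial>count_space L)"
    by (simp add: S_def)
qed

text \<open>Dominated convergence with the majorant \<open>t + t\<^sup>2\<close>, valid for all
  exponents between 1 and 2 and summable by the inclusion into
  \<open>\<ell>\<^sup>2\<close>.\<close>

lemma ell_1_powr_tendsto:
  assumes c: "c \<in> ell L 1" and p: "\<And>n. 1 < p n \<and> p n < 2" "p \<longlonglongrightarrow> 1"
  shows "(\<lambda>n. \<integral>l. norm (c l) powr p n \<partial>count_space L) \<longlonglongrightarrow> (\<integral>l. norm (c l) \<partial>count_space L)"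
    and "\<And>n. c \<in> ell L (p n)"
proof -
  have c2: "c \<in> ell L 2" by (rule ell_mono_2[OF c]) auto
  have I: "integrable (count_space L) (\<lambda>l. norm (c l) + (norm (c l))\<^sup>2)"
    using c c2 by (auto simp: Lp_space_def)
  have le: "t powr p n \<le> t + t\<^sup>2" if "0 \<le> t" for t :: real and n
  proof (cases "t \<le> 1")
    case True
    then have "t powr p n \<le> t powr 1" using p(1)[of n] that by (intro powr_mono') auto
    then have "t powr p n \<le> t" using that by simp
    then show ?thesis using zero_le_power2[of t] by linarith
  next
    case False
    then have "t powr p n \<le> t powr 2" using p(1)[of n] that by (intro powr_mono) auto
    then show ?thesis using that by simp
  qed
  show "(\<lambda>n. \<integral>l. norm (c l) powr p n \<partial>count_space L) \<longlonglongrightarrow> (\<integral>l. norm (c l) \<partial>count_space L)"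
  proof (rule integral_dominated_convergence[OF _ _ I])
    show "AE l in count_space L. (\<lambda>n. norm (c l) powr p n) \<longlonglongrightarrow> norm (c l)"
    proof (rule AE_I2)
      fix l
      show "(\<lambda>n. norm (c l) powr p n) \<longlonglongrightarrow> norm (c l)"
      \<comment> \<open>At base zero the power is constantly 0, as \<open>0 powr x = 0\<close>;
        continuity in the exponent handles nonzero bases.\<close>
      proof (cases "c l = 0")
        case False
        then have "(\<lambda>n. norm (c l) powr p n) \<longlonglongrightarrow> norm (c l) powr 1"
          by (intro tendsto_powr tendsto_const p) auto
        then show ?thesis by simp
      qed simp
    qed
  qed (use le in auto)
  show "c \<in> ell L (p n)" for n
    using Bochner_Integration.integrable_bound[OF I, of "\<lambda>l. norm (c l) powr p n"] le[of "norm (c _)" n]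
    by (auto simp: Lp_space_def)
qed

lemma Young_1:
  fixes t r :: real
  assumes "0 \<le> t" "1 < r"
  shows "t \<le> t powr r / r + (1 - 1 / r)"
proof -
  have "0 < 1 - 1 / r" using assms by simp
  \<comment> \<open>Young's inequality with second factor 1; the conjugate exponent
    \<open>r / (r - 1)\<close> has reciprocal \<open>1 - 1 / r\<close>.\<close>
  have "t * 1 \<le> t powr r / r + 1 powr (r / (r - 1)) / (r / (r - 1))"
    using assms by (intro Youngs_inequality) (auto simp: field_simps)
  then show ?thesis using assms by (simp add: field_simps)
qed

text \<open>What the Besov and shearlet settings share. The lower bound makes a sequence that is
  Cauchy in its coefficients also Cauchy as a sequence of functions.\<close>

locale coefficient_frame =
  fixes \<Omega> :: "'a::euclidean_space set" and L :: "'l set" and \<psi> :: "'l \<Rightarrow> 'a \<Rightarrow> complex" and C :: real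
  assumes atoms: "\<And>l. l \<in> L \<Longrightarrow> \<psi> l \<in> Lp_space lborel 2"
    and lower_frame: "\<And>f. f \<in> L2_on \<Omega> \<Longrightarrow> coeffs \<psi> f \<in> ell L 2 \<Longrightarrow>
      sqnorm lborel f \<le> C * sqnorm (count_space L) (coeffs \<psi> f)"
begin

definition H :: "('a \<Rightarrow> complex) set" where
  "H = {f \<in> L2_on \<Omega>. coeffs \<psi> f \<in> ell L 2}"

definition q :: "('a \<Rightarrow> complex) \<Rightarrow> real" where
  "q f = sqnorm (count_space L) (coeffs \<psi> f)"

definition e :: "('a \<Rightarrow> complex) \<Rightarrow> ('a \<Rightarrow> complex) \<Rightarrow> real" where
  "e f h = q (\<lambda>x. f x - h x)"

definition mid :: "('a \<Rightarrow> complex) \<Rightarrow> ('a \<Rightarrow> complex) \<Rightarrow> 'a \<Rightarrow> complex" where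
  "mid f h = (\<lambda>x. (f x + h x) / 2)"

abbreviation "closed_midconvex_H \<equiv> closed_midconvex H mid e"

lemma X_norm_2: "X_norm L \<psi> 2 f = sqrt (q f)"
  by (simp add: X_norm_def q_def Lp_norm_2)

lemma q_nonneg [simp]: "0 \<le> q f"
  by (simp add: q_def)

lemma e_nonneg [simp]: "0 \<le> e f h"
  by (simp add: e_def)

lemma H_L2: "f \<in> H \<Longrightarrow> f \<in> Lp_space lborel 2"
  and H_ell: "f \<in> H \<Longrightarrow> coeffs \<psi> f \<in> ell L 2"
  by (auto simp: H_def L2_on_def)

lemma coeffs_comb:
  assumes "f \<in> Lp_space lborel 2" "h \<in> Lp_space lborel 2" "l \<in> L"
  shows "coeffs \<psi> (\<lambda>x. a * f x + b * h x) l = a * coeffs \<psi> f l + b * coeffs \<psi> h l"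
  using L2_mult_integrable[OF assms(1) atoms[OF assms(3)]] L2_mult_integrable[OF assms(2) atoms[OF assms(3)]]
  by (simp add: coeffs_def L2_inner_def distrib_right mult.assoc)

lemma coeffs_diff:
  assumes "f \<in> Lp_space lborel 2" "h \<in> Lp_space lborel 2" "l \<in> L"
  shows "coeffs \<psi> (\<lambda>x. f x - h x) l = coeffs \<psi> f l - coeffs \<psi> h l"
  using coeffs_comb[OF assms, of 1 "-1"] by simp

lemma coeffs_mid:
  assumes "f \<in> Lp_space lborel 2" "h \<in> Lp_space lborel 2" "l \<in> L"
  shows "coeffs \<psi> (mid f h) l = (coeffs \<psi> f l + coeffs \<psi> h l) / 2"
  using coeffs_comb[OF assms, of "1/2" "1/2"] by (simp add: mid_def add_divide_distrib)

lemma comb_H: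
  assumes "f \<in> H" "h \<in> H"
  shows "(\<lambda>x. a * f x + b * h x) \<in> H"
proof -
  have "supported_in \<Omega> f" "supported_in \<Omega> h" using assms by (auto simp: H_def L2_on_def)
  then have "supported_in \<Omega> (\<lambda>x. a * f x + b * h x)"
    unfolding supported_in_def by eventually_elim simp
  moreover have "(\<lambda>l. a * coeffs \<psi> f l + b * coeffs \<psi> h l) \<in> ell L 2"
    using assms by (intro L2_add L2_scale H_ell)
  then have "coeffs \<psi> (\<lambda>x. a * f x + b * h x) \<in> ell L 2"
    using coeffs_comb[OF H_L2[OF assms(1)] H_L2[OF assms(2)]] by (subst Lp_space_count_cong) auto
  ultimately show ?thesis
    using assms by (auto simp: H_def L2_on_def intro!: L2_add L2_scale)
qed

lemma diff_H: "f \<in> H \<Longrightarrow> h \<in> H \<Longrightarrow> (\<lambda>x. f x - h x) \<in> H"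
  using comb_H[of f h 1 "-1"] by simp

lemma mid_H: "f \<in> H \<Longrightarrow> h \<in> H \<Longrightarrow> mid f h \<in> H"
  using comb_H[of f h "1/2" "1/2"] by (simp add: mid_def add_divide_distrib)

lemma e_eq:
  assumes "f \<in> H" "h \<in> H"
  shows "e f h = sqnorm (count_space L) (\<lambda>l. coeffs \<psi> f l - coeffs \<psi> h l)"
  unfolding e_def q_def using coeffs_diff[OF H_L2[OF assms(1)] H_L2[OF assms(2)]]
  by (intro sqnorm_count_cong)

lemma e_parallelogram:
  assumes "f \<in> H" "h \<in> H"
  shows "e f h = 2 * q f + 2 * q h - 4 * q (mid f h)"
proof -
  have "q (mid f h) = sqnorm (count_space L) (\<lambda>l. (coeffs \<psi> f l + coeffs \<psi> h l) / 2)"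
    unfolding q_def using coeffs_mid[OF H_L2[OF assms(1)] H_L2[OF assms(2)]]
    by (intro sqnorm_count_cong)
  then show ?thesis
    unfolding e_eq[OF assms] q_def using assms by (simp add: sqnorm_parallelogram H_ell)
qed

text \<open>\<open>C\<close> has no prescribed sign, so its absolute value is used.\<close>

lemma sqnorm_diff_le: "f \<in> H \<Longrightarrow> h \<in> H \<Longrightarrow> sqnorm lborel (\<lambda>x. f x - h x) \<le> \<bar>C\<bar> * e f h"
  using lower_frame[of "\<lambda>x. f x - h x"] diff_H[of f h]
    mult_right_mono[OF abs_ge_self[of C] e_nonneg[of f h]]
  by (simp add: H_def e_def q_def)

lemma sqnorm_tendsto:
  assumes "\<And>k. y k \<in> H" "f \<in> H" "(\<lambda>k. e (y k) f) \<longlonglongrightarrow> 0"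
  shows "(\<lambda>k. sqnorm lborel (\<lambda>x. y k x - f x)) \<longlonglongrightarrow> 0"
proof (rule tendsto_sandwich[of "\<lambda>_. 0" _ _ "\<lambda>k. \<bar>C\<bar> * e (y k) f"])
  show "(\<lambda>k. \<bar>C\<bar> * e (y k) f) \<longlonglongrightarrow> 0" using tendsto_mult_right_zero[OF assms(3)] .
qed (use sqnorm_diff_le assms in auto)

lemma coeffs_tendsto:
  assumes "\<And>k. y k \<in> H" "f \<in> H" "(\<lambda>k. e (y k) f) \<longlonglongrightarrow> 0" "l \<in> L"
  shows "(\<lambda>k. coeffs \<psi> (y k) l) \<longlonglongrightarrow> coeffs \<psi> f l"
proof (rule tendsto_of_norm_sq_le[OF _ assms(3)])
  show "(norm (coeffs \<psi> (y k) l - coeffs \<psi> f l))\<^sup>2 \<le> e (y k) f" for k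
    unfolding e_eq[OF assms(1,2)] using assms
    by (intro norm_sq_le_sqnorm_count[where c = "\<lambda>l. coeffs \<psi> (y k) l - coeffs \<psi> f l"] L2_diff H_ell)
qed

text \<open>Functions and coefficient families converge separately, by completeness of two
  \<open>L\<^sup>2\<close> spaces. The limits match because each coefficient depends continuously on
  the function, by the Cauchy-Schwarz inequality with \<open>\<psi> l\<close>.\<close>

lemma H_complete:
  assumes y: "\<And>k. y k \<in> H"
    and Cauchy: "\<And>\<epsilon>. \<epsilon> > 0 \<Longrightarrow> \<exists>n0. \<forall>m\<ge>n0. \<forall>n\<ge>n0. e (y m) (y n) \<le> \<epsilon>"
  shows "\<exists>f\<in>H. (\<lambda>k. e (y k) f) \<longlonglongrightarrow> 0"
proof -
  have "\<exists>n0. \<forall>m\<ge>n0. \<forall>n\<ge>n0. sqnorm lborel (\<lambda>x. y m x - y n x) \<le> \<epsilon>" if "\<epsilon> > 0" for \<epsilon>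
  proof -
    \<comment> \<open>Adding 1 keeps the divisor positive even for \<open>C = 0\<close>.\<close>
    obtain n0 where n0: "\<forall>m\<ge>n0. \<forall>n\<ge>n0. e (y m) (y n) \<le> \<epsilon> / (\<bar>C\<bar> + 1)"
      using Cauchy[of "\<epsilon> / (\<bar>C\<bar> + 1)"] \<open>\<epsilon> > 0\<close> by (auto simp: add_nonneg_pos)
    have "sqnorm lborel (\<lambda>x. y m x - y n x) \<le> \<epsilon>" if "m \<ge> n0" "n \<ge> n0" for m n
    proof -
      have "sqnorm lborel (\<lambda>x. y m x - y n x) \<le> \<bar>C\<bar> * e (y m) (y n)" by (intro sqnorm_diff_le y)
      also have "\<dots> \<le> (\<bar>C\<bar> + 1) * (\<epsilon> / (\<bar>C\<bar> + 1))"
        using n0 that \<open>\<epsilon> > 0\<close> by (intro mult_mono) auto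
      finally show ?thesis by (simp add: add_nonneg_pos less_imp_neq[symmetric])
    qed
    then show ?thesis by blast
  qed
  then obtain f where f: "f \<in> Lp_space lborel 2" "(\<lambda>k. sqnorm lborel (\<lambda>x. y k x - f x)) \<longlonglongrightarrow> 0"
    using L2_complete[of y lborel] H_L2[OF y] by blast
  have "\<exists>n0. \<forall>m\<ge>n0. \<forall>n\<ge>n0. sqnorm (count_space L) (\<lambda>l. coeffs \<psi> (y m) l - coeffs \<psi> (y n) l) \<le> \<epsilon>" if "\<epsilon> > 0" for \<epsilon>
    using Cauchy[OF that] by (simp add: e_eq y)
  then obtain d where d: "d \<in> ell L 2" "(\<lambda>k. sqnorm (count_space L) (\<lambda>l. coeffs \<psi> (y k) l - d l)) \<longlonglongrightarrow> 0"
    using L2_complete[of "\<lambda>k. coeffs \<psi> (y k)" "count_space L"] H_ell[OF y] by blast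
  have "d l = coeffs \<psi> f l" if l: "l \<in> L" for l
  proof (rule LIMSEQ_unique)
    show "(\<lambda>k. coeffs \<psi> (y k) l) \<longlonglongrightarrow> d l"
      by (rule tendsto_of_norm_sq_le[OF _ d(2)]) (rule norm_sq_le_sqnorm_count[OF L2_diff[OF H_ell[OF y] d(1)] l])
    show "(\<lambda>k. coeffs \<psi> (y k) l) \<longlonglongrightarrow> coeffs \<psi> f l"
    proof (rule tendsto_of_norm_sq_le)
      show "(norm (coeffs \<psi> (y k) l - coeffs \<psi> f l))\<^sup>2 \<le> sqnorm lborel (\<lambda>x. y k x - f x) * sqnorm lborel (\<psi> l)" for k
        using L2_Cauchy_Schwarz[OF L2_diff[OF H_L2[OF y] f(1)] atoms[OF l], of k]
        unfolding coeffs_diff[OF H_L2[OF y] f(1) l, symmetric] by (simp only: coeffs_def L2_inner_def)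
      show "(\<lambda>k. sqnorm lborel (\<lambda>x. y k x - f x) * sqnorm lborel (\<psi> l)) \<longlonglongrightarrow> 0"
        using tendsto_mult_left_zero[OF f(2)] .
    qed
  qed
  note dc = this
  have "f \<in> H"
    using L2_on_closed[OF _ f, of \<Omega>] y d(1) Lp_space_count_cong[of L d "coeffs \<psi> f" 2] dc by (auto simp: H_def)
  moreover have "e (y k) f = sqnorm (count_space L) (\<lambda>l. coeffs \<psi> (y k) l - d l)" for k
    unfolding e_eq[OF y \<open>f \<in> H\<close>] by (rule sqnorm_count_cong) (simp add: dc)
  ultimately show ?thesis using d(2) by (intro bexI[of _ f]) simp_all
qed

lemma closed_midconvex_nonneg: "closed_midconvex_H {f \<in> H. nonneg_ae f}"
  unfolding closed_midconvex_def
proof (intro conjI ballI allI impI)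
  fix f h assume "f \<in> {f \<in> H. nonneg_ae f}" "h \<in> {f \<in> H. nonneg_ae f}"
  moreover from this have "nonneg_ae f" "nonneg_ae h" by auto
  then have "nonneg_ae (mid f h)"
    unfolding nonneg_ae_def by eventually_elim (simp add: mid_def)
  ultimately show "mid f h \<in> {f \<in> H. nonneg_ae f}" by (auto intro: mid_H)
next
  fix y f assume "\<forall>k. y k \<in> {f \<in> H. nonneg_ae f}" "f \<in> H" "(\<lambda>k. e (y k) f) \<longlonglongrightarrow> 0"
  then show "f \<in> {f \<in> H. nonneg_ae f}"
    using nonneg_ae_closed[of y f] sqnorm_tendsto[of y f] by (auto simp: H_L2)
qed auto

text \<open>For a continuous midpoint-convex functional this is weak lower semicontinuity, expressed
  by sublevel sets.\<close>

lemma closed_midconvex_sublevel: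
  assumes "\<And>f h. f \<in> H \<Longrightarrow> h \<in> H \<Longrightarrow> \<phi> (mid f h) \<le> (\<phi> f + \<phi> h) / 2"
    and "\<And>y f. (\<And>k. y k \<in> H) \<Longrightarrow> f \<in> H \<Longrightarrow> (\<lambda>k. e (y k) f) \<longlonglongrightarrow> 0 \<Longrightarrow> (\<lambda>k. \<phi> (y k)) \<longlonglongrightarrow> \<phi> f"
  shows "closed_midconvex_H {f \<in> H. \<phi> f \<le> (b::real)}"
  unfolding closed_midconvex_def
proof (intro conjI ballI allI impI)
  fix f h assume "f \<in> {f \<in> H. \<phi> f \<le> b}" "h \<in> {f \<in> H. \<phi> f \<le> b}"
  then show "mid f h \<in> {f \<in> H. \<phi> f \<le> b}" using assms(1)[of f h] by (auto intro: mid_H)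
next
  fix y f assume *: "\<forall>k. y k \<in> {f \<in> H. \<phi> f \<le> b}" "f \<in> H" "(\<lambda>k. e (y k) f) \<longlonglongrightarrow> 0"
  then have "\<phi> f \<le> b" by (intro LIMSEQ_le_const2[OF assms(2)[of y f]]) auto
  then show "f \<in> {f \<in> H. \<phi> f \<le> b}" using * by simp
qed auto

end

section \<open>Convergence of the minimizers\<close>

lemma VN_norm_sq: "(VN_norm N v)\<^sup>2 = (1 / real N) * (\<Sum>n=1..N. (norm (v n))\<^sup>2)"
  by (simp add: VN_norm_def VN_inner_def sum_nonneg dot_square_norm)

lemma iota_plus_eq: "iota_plus f = (if nonneg_ae f then 0 else \<infinity>)"
  by (simp add: iota_plus_def nonneg_ae_def)

text \<open>The gap is exactly the squared norm of \<open>(1/2) *\<^sub>R (a - b)\<close>; this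
  makes the data term midpoint convex.\<close>

lemma norm_sq_midpoint_le:
  fixes a b g :: "'v::real_inner"
  shows "(norm ((1/2) *\<^sub>R a + (1/2) *\<^sub>R b - g))\<^sup>2 \<le> ((norm (a - g))\<^sup>2 + (norm (b - g))\<^sup>2) / 2"
proof -
  have "((norm (a - g))\<^sup>2 + (norm (b - g))\<^sup>2) / 2 - (norm ((1/2) *\<^sub>R a + (1/2) *\<^sub>R b - g))\<^sup>2 = (norm ((1/2) *\<^sub>R (a - b)))\<^sup>2"
    unfolding power2_norm_eq_inner
    by (simp add: inner_diff_left inner_diff_right inner_add_left inner_add_right inner_commute field_simps)
  then show ?thesis using zero_le_power2[of "norm ((1/2) *\<^sub>R (a - b))"] by linarith
qed

text \<open>The function space enters only through the description of \<open>X r\<close> by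
  coefficients. Since \<open>f r\<close> is the minimizer for exponent \<open>r\<close>,
  \<open>f 1\<close> solves the limit problem.\<close>

locale sampled_problem = coefficient_frame \<Omega> L \<psi> C
  for \<Omega> :: "'a::euclidean_space set" and L :: "'l set" and \<psi> C +
  fixes A :: "('a \<Rightarrow> complex) \<Rightarrow> 'u::topological_space \<Rightarrow> 'v::real_inner" and U N u
    and g :: "nat \<Rightarrow> 'v" and \<alpha> :: real and p :: "nat \<Rightarrow> real" and X f
  assumes N: "N \<ge> 1" and u: "\<forall>n\<in>{1..N}. u n \<in> U" and \<alpha>: "\<alpha> > 0"
    and p: "\<And>n. 1 < p n \<and> p n < 2" "p \<longlonglongrightarrow> 1"
    and X: "\<And>r. 1 \<le> r \<Longrightarrow> r \<le> 2 \<Longrightarrow> X r = {f \<in> L2_on \<Omega>. coeffs \<psi> f \<in> ell L r}"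
    and A: "forward_operator L \<psi> (X 2) A U N u"
    and f_min: "\<And>r. 1 \<le> r \<Longrightarrow> r < 2 \<Longrightarrow> the_minimizer (J_functional L \<psi> A N u g \<alpha> r) (X r) (f r)"
begin

definition E :: "('a \<Rightarrow> complex) \<Rightarrow> real" where
  "E h = 1 / 2 * (VN_norm N (\<lambda>n. sampled A u h n - g n))\<^sup>2"

definition S :: "real \<Rightarrow> ('a \<Rightarrow> complex) \<Rightarrow> real" where
  "S r h = (\<integral>l. norm (coeffs \<psi> h l) powr r \<partial>count_space L)"

lemma X_2: "X 2 = H"
  by (simp add: X H_def)

lemma X_subset_H: "1 \<le> r \<Longrightarrow> r \<le> 2 \<Longrightarrow> X r \<subseteq> H"
  using ell_mono_2(1) by (auto simp: X H_def)

lemma S_nonneg [simp]: "0 \<le> S r h"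
  by (simp add: S_def integral_nonneg)

lemma J_eq:
  assumes "1 \<le> r"
  shows "J_functional L \<psi> A N u g \<alpha> r h = ereal (E h + \<alpha> * (1 / r) * S r h) + (if nonneg_ae h then 0 else \<infinity>)"
proof -
  have "(ell_norm L r (coeffs \<psi> h)) powr r = S r h"
    using assms by (simp add: Lp_norm_def powr_powr S_def[symmetric])
  then show ?thesis by (simp add: J_functional_def E_def iota_plus_eq)
qed

lemma zero_in_X: "1 \<le> r \<Longrightarrow> r \<le> 2 \<Longrightarrow> (\<lambda>x. 0) \<in> X r"
  by (simp add: X L2_on_def L2_zero supported_in_def coeffs_def L2_inner_def Lp_space_def)

lemma minimizer:
  assumes "1 \<le> r" "r < 2"
  shows "f r \<in> X r" "nonneg_ae (f r)"
    and "\<And>h. h \<in> X r \<Longrightarrow> nonneg_ae h \<Longrightarrow> E (f r) + \<alpha> * (1 / r) * S r (f r) \<le> E h + \<alpha> * (1 / r) * S r h"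
proof -
  let ?J = "J_functional L \<psi> A N u g \<alpha> r"
  have am: "is_arg_min ?J (\<lambda>h. h \<in> X r) (f r)" using f_min[OF assms] by (simp add: the_minimizer_def)
  then show "f r \<in> X r" by (simp add: is_arg_min_def)
  have le: "?J (f r) \<le> ?J h" if "h \<in> X r" for h using am that by (auto simp: is_arg_min_def not_less)
  have "nonneg_ae (\<lambda>x::'a. 0)" by (simp add: nonneg_ae_def)
  \<comment> \<open>The zero function has a finite value, so the minimal value is finite and the
    indicator term of the minimizer must vanish.\<close>
  then show nn: "nonneg_ae (f r)"
    using le[OF zero_in_X[of r]] assms by (auto simp: J_eq split: if_splits)
  show "E (f r) + \<alpha> * (1 / r) * S r (f r) \<le> E h + \<alpha> * (1 / r) * S r h" if "h \<in> X r" "nonneg_ae h" for h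
    using le[OF that(1)] that nn assms by (simp add: J_eq)
qed

text \<open>A competitor with no larger value is itself a minimizer, so uniqueness up to null sets
  applies.\<close>

lemma minimizer_unique:
  assumes "h \<in> X 1" "nonneg_ae h" "E h + \<alpha> * S 1 h \<le> E (f 1) + \<alpha> * S 1 (f 1)"
  shows "AE x in lborel. h x = f 1 x"
proof -
  let ?J = "J_functional L \<psi> A N u g \<alpha> 1"
  have am: "is_arg_min ?J (\<lambda>h. h \<in> X 1) (f 1)" using f_min[of 1] by (simp add: the_minimizer_def)
  have "?J h \<le> ?J (f 1)" using assms minimizer(2)[of 1] by (simp add: J_eq)
  then have "is_arg_min ?J (\<lambda>h. h \<in> X 1) h"
    using am assms(1) unfolding is_arg_min_def by (metis order_less_le_trans)
  then show ?thesis using f_min[of 1] by (simp add: the_minimizer_def)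
qed

lemma A_comb:
  assumes "h \<in> H" "k \<in> H" "n \<in> {1..N}"
  shows "A (\<lambda>x. of_real a * h x + of_real b * k x) (u n) = a *\<^sub>R A h (u n) + b *\<^sub>R A k (u n)"
proof -
  have "(\<lambda>x. of_real a * h x) \<in> H" "(\<lambda>x. of_real b * k x) \<in> H"
    using comb_H[OF assms(1,1), of "of_real a" 0] comb_H[OF assms(2,2), of "of_real b" 0] by auto
  then show ?thesis using A assms u by (auto simp: forward_operator_def X_2)
qed

lemma A_mid: "h \<in> H \<Longrightarrow> k \<in> H \<Longrightarrow> n \<in> {1..N} \<Longrightarrow> A (mid h k) (u n) = (1/2) *\<^sub>R A h (u n) + (1/2) *\<^sub>R A k (u n)"
  using A_comb[of h k n "1/2" "1/2"] by (simp add: mid_def add_divide_distrib)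

lemma A_diff: "h \<in> H \<Longrightarrow> k \<in> H \<Longrightarrow> n \<in> {1..N} \<Longrightarrow> A (\<lambda>x. h x - k x) (u n) = A h (u n) - A k (u n)"
  using A_comb[of h k n 1 "-1"] by simp

lemma E_eq: "E h = (\<Sum>n=1..N. (norm (A h (u n) - g n))\<^sup>2) / (2 * real N)"
  by (simp add: E_def VN_norm_sq sampled_def)

lemma E_nonneg [simp]: "0 \<le> E h"
  by (simp add: E_def)

lemma E_mid:
  assumes "h \<in> H" "k \<in> H"
  shows "E (mid h k) \<le> (E h + E k) / 2"
proof -
  have "(\<Sum>n=1..N. (norm (A (mid h k) (u n) - g n))\<^sup>2) \<le>
        (\<Sum>n=1..N. ((norm (A h (u n) - g n))\<^sup>2 + (norm (A k (u n) - g n))\<^sup>2) / 2)"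
  proof (intro sum_mono)
    fix n assume "n \<in> {1..N}"
    then show "(norm (A (mid h k) (u n) - g n))\<^sup>2 \<le> ((norm (A h (u n) - g n))\<^sup>2 + (norm (A k (u n) - g n))\<^sup>2) / 2"
      unfolding A_mid[OF assms \<open>n \<in> {1..N}\<close>] by (intro norm_sq_midpoint_le)
  qed
  also have "\<dots> = ((\<Sum>n=1..N. (norm (A h (u n) - g n))\<^sup>2) + (\<Sum>n=1..N. (norm (A k (u n) - g n))\<^sup>2)) / 2"
    by (simp add: sum.distrib sum_divide_distrib[symmetric])
  finally show ?thesis
    using N by (simp add: E_eq field_simps)
qed

lemma E_tendsto:
  assumes y: "\<And>k. y k \<in> H" and h: "h \<in> H" and lim: "(\<lambda>k. e (y k) h) \<longlonglongrightarrow> 0"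
  shows "(\<lambda>k. E (y k)) \<longlonglongrightarrow> E h"
proof -
  obtain B where B: "\<And>h. h \<in> H \<Longrightarrow> VN_norm N (sampled A u h) \<le> B * sqrt (q h)"
    using A unfolding forward_operator_def X_2 X_norm_2 by blast
  have "(\<lambda>k. A (y k) (u n)) \<longlonglongrightarrow> A h (u n)" if n: "n \<in> {1..N}" for n
  proof -
    \<comment> \<open>The inner product on the direct sum carries the factor \<open>1 / N\<close>,
      so a single sample is bounded by \<open>sqrt N\<close> times the norm there.\<close>
    have le: "norm (A (y k) (u n) - A h (u n)) \<le> sqrt (real N * (B * sqrt (e (y k) h))\<^sup>2)" for k
    proof (rule real_le_rsqrt)
      let ?w = "\<lambda>x. y k x - h x"
      have "(norm (A ?w (u n)))\<^sup>2 \<le> (\<Sum>n=1..N. (norm (A ?w (u n)))\<^sup>2)"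
        using n by (intro member_le_sum) auto
      also have "\<dots> = real N * (VN_norm N (sampled A u ?w))\<^sup>2"
        using N by (simp add: VN_norm_sq sampled_def)
      also have "\<dots> \<le> real N * (B * sqrt (e (y k) h))\<^sup>2"
      proof (intro mult_left_mono power_mono)
        show "VN_norm N (sampled A u ?w) \<le> B * sqrt (e (y k) h)"
          using B[OF diff_H[OF y h]] by (simp add: e_def)
        show "0 \<le> VN_norm N (sampled A u ?w)"
          by (simp add: VN_norm_def VN_inner_def sum_nonneg)
      qed auto
      finally show "(norm (A (y k) (u n) - A h (u n)))\<^sup>2 \<le> real N * (B * sqrt (e (y k) h))\<^sup>2"
        by (simp add: A_diff[OF y h n])
    qed
    have "(\<lambda>k. sqrt (real N * (B * sqrt (e (y k) h))\<^sup>2)) \<longlonglongrightarrow> sqrt (real N * (B * sqrt 0)\<^sup>2)"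
      by (intro tendsto_intros lim)
    then have lim0: "(\<lambda>k. sqrt (real N * (B * sqrt (e (y k) h))\<^sup>2)) \<longlonglongrightarrow> 0" by simp
    have "(\<lambda>k. norm (A (y k) (u n) - A h (u n))) \<longlonglongrightarrow> 0"
      by (rule tendsto_sandwich[OF _ _ tendsto_const lim0]) (intro always_eventually allI norm_ge_zero le)+
    then show ?thesis by (simp only: tendsto_norm_zero_iff LIM_zero_iff)
  qed
  then have "(\<lambda>k. (\<Sum>n=1..N. (norm (A (y k) (u n) - g n))\<^sup>2) / (2 * real N)) \<longlonglongrightarrow>
      (\<Sum>n=1..N. (norm (A h (u n) - g n))\<^sup>2) / (2 * real N)"
    using N by (intro tendsto_divide tendsto_sum tendsto_power tendsto_norm tendsto_diff tendsto_const) auto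
  then show ?thesis by (simp only: E_eq)
qed

section \<open>Comparison with the minimizer of the limit functional\<close>

lemma f1_coeffs: "coeffs \<psi> (f 1) \<in> ell L 1"
  using minimizer(1)[of 1] by (simp add: X)

lemma f1_H: "f 1 \<in> H"
  using minimizer(1)[of 1] X_subset_H[of 1] by auto

lemma fp_H: "f (p n) \<in> H"
  using minimizer(1)[of "p n"] X_subset_H[of "p n"] p(1)[of n] by auto

lemma fp_ell: "coeffs \<psi> (f (p n)) \<in> ell L (p n)"
  using minimizer(1)[of "p n"] X[of "p n"] p(1)[of n] by auto

lemma fp_integrable: "integrable (count_space L) (\<lambda>l. norm (coeffs \<psi> (f (p n)) l) powr p n)"
  using fp_ell by (simp add: Lp_space_def)

text \<open>The value of the functional with exponent \<open>p n\<close> at the competitor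
  \<open>f 1\<close>. It bounds the minimal value for \<open>p n\<close> from above and tends to the
  minimal value of the limit functional.\<close>

definition T :: "nat \<Rightarrow> real" where
  "T n = E (f 1) + \<alpha> * (1 / p n) * S (p n) (f 1)"

lemma fp_le: "E (f (p n)) + \<alpha> * (1 / p n) * S (p n) (f (p n)) \<le> T n"
  unfolding T_def using p(1)[of n] ell_1_powr_tendsto(2)[OF f1_coeffs p] minimizer(1)[of 1]
  by (intro minimizer) (auto simp: X intro: minimizer(2))

lemma S_1: "S 1 h = (\<integral>l. norm (coeffs \<psi> h l) \<partial>count_space L)"
  by (simp add: S_def)

lemma T_tendsto: "T \<longlonglongrightarrow> E (f 1) + \<alpha> * S 1 (f 1)"
proof -
  have "T \<longlonglongrightarrow> E (f 1) + \<alpha> * (1 / 1) * S 1 (f 1)"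
    unfolding T_def S_1 unfolding S_def
    by (intro tendsto_intros ell_1_powr_tendsto(1)[OF f1_coeffs p] p(2)) auto
  then show ?thesis by simp
qed

lemma fp_bounded: "\<exists>B. \<forall>n. q (f (p n)) \<le> B"
proof -
  obtain K where K: "\<And>n. T n \<le> K"
    using convergent_imp_Bseq[OF convergentI[OF T_tendsto]] by (auto simp: Bseq_def abs_le_iff)
  \<comment> \<open>The 2 bounds the exponents \<open>p n\<close>, which appear when the factor
    \<open>1 / p n\<close> is cleared.\<close>
  define B where "B = 2 * K / \<alpha>"
  have "S (p n) (f (p n)) \<le> B" for n
  proof -
    have "\<alpha> * (1 / p n) * S (p n) (f (p n)) \<le> K" using fp_le[of n] K[of n] E_nonneg[of "f (p n)"] by linarith
    then have "\<alpha> * S (p n) (f (p n)) \<le> K * p n" using p(1)[of n] by (simp add: field_simps)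
    moreover have "0 \<le> T 0" unfolding T_def using \<alpha> p(1)[of 0] by (intro add_nonneg_nonneg mult_nonneg_nonneg) auto
    then have "0 \<le> K" using K[of 0] by linarith
    then have "K * p n \<le> K * 2" using p(1)[of n] by (intro mult_left_mono) auto
    ultimately show ?thesis using \<alpha> by (simp add: B_def field_simps)
  qed
  moreover have "q (f (p n)) \<le> max 1 (S (p n) (f (p n))) * S (p n) (f (p n))" for n
    using ell_mono_2(2)[OF fp_ell, of n] p(1)[of n] by (simp add: q_def S_def)
  moreover have "max 1 s * s \<le> max 1 B * B" if "0 \<le> s" "s \<le> B" for s
    using that by (intro mult_mono) auto
  ultimately have "q (f (p n)) \<le> max 1 B * B" for n
    using S_nonneg order_trans by blast
  then show ?thesis by blast
qed

text \<open>Each index contributes the error \<open>1 - 1 / p n\<close>. The total vanishes in the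
  limit only for fixed finite \<open>G\<close>, so all later estimates truncate to such a
  \<open>G\<close> first.\<close>

lemma sum_le_powr_sum:
  "(\<Sum>l\<in>G. norm (coeffs \<psi> (f (p n)) l)) \<le>
    (\<Sum>l\<in>G. norm (coeffs \<psi> (f (p n)) l) powr p n) / p n + real (card G) * (1 - 1 / p n)"
proof -
  have "(\<Sum>l\<in>G. norm (coeffs \<psi> (f (p n)) l)) \<le> (\<Sum>l\<in>G. norm (coeffs \<psi> (f (p n)) l) powr p n / p n + (1 - 1 / p n))"
    using p(1)[of n] by (intro sum_mono Young_1) auto
  then show ?thesis by (simp add: sum.distrib sum_divide_distrib)
qed

lemma sum_le_penalty:
  assumes "finite G" "G \<subseteq> L"
  shows "(\<Sum>l\<in>G. norm (coeffs \<psi> (f (p n)) l)) \<le> (1 / p n) * S (p n) (f (p n)) + real (card G) * (1 - 1 / p n)"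
proof -
  have "(\<Sum>l\<in>G. norm (coeffs \<psi> (f (p n)) l) powr p n) / p n \<le> S (p n) (f (p n)) / p n"
    unfolding S_def using p(1)[of n] assms fp_integrable
    by (intro divide_right_mono sum_le_integral_count_space) auto
  then show ?thesis using sum_le_powr_sum[where G = G and n = n] by simp
qed

lemma card_term_tendsto: "(\<lambda>n. real (card G) * (1 - 1 / p n)) \<longlonglongrightarrow> 0"
proof -
  have "(\<lambda>n. real (card G) * (1 - 1 / p n)) \<longlonglongrightarrow> real (card G) * (1 - 1 / 1)"
    by (intro tendsto_intros p(2)) auto
  then show ?thesis by simp
qed

text \<open>This takes the place of weak convergence to \<open>f 1\<close>. Infinitely many
  \<open>f (p n)\<close> in \<open>Z\<close> form a subsequence; its cluster point lies in
  \<open>Z\<close>, is nonnegative and minimizes the limit functional, so it is \<open>f 1\<close>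
  up to a null set.\<close>

lemma frequently_closed_midconvex:
  assumes Z: "closed_midconvex_H Z" and freq: "\<exists>\<^sub>F n in sequentially. f (p n) \<in> Z"
  shows "f 1 \<in> Z"
proof -
  have "infinite {n. f (p n) \<in> Z}" using freq by (simp only: frequently_cofinite[symmetric] cofinite_eq_sequentially mem_Collect_eq)
  then obtain \<sigma> :: "nat \<Rightarrow> nat" where \<sigma>: "strict_mono \<sigma>" "\<And>k. f (p (\<sigma> k)) \<in> Z"
    using infinite_enumerate by blast
  obtain B where B: "\<And>n. q (f (p n)) \<le> B" using fp_bounded by blast
  obtain x where x: "x \<in> H" and
    cl: "\<And>Z. closed_midconvex_H Z \<Longrightarrow> (\<forall>\<^sub>F k in sequentially. f (p (\<sigma> k)) \<in> Z) \<Longrightarrow> x \<in> Z"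
  proof (rule closed_midconvex_cluster[where H = H and mid = mid and e = e and q = q and f = "\<lambda>k. f (p (\<sigma> k))" and B = B])
    show "\<exists>x\<in>H. (\<lambda>k. e (y k) x) \<longlonglongrightarrow> 0"
      if "\<And>k. y k \<in> H" "\<And>\<epsilon>. \<epsilon> > 0 \<Longrightarrow> \<exists>n0. \<forall>m\<ge>n0. \<forall>n\<ge>n0. e (y m) (y n) \<le> \<epsilon>" for y
      using that by (rule H_complete)
    show "q (f (p (\<sigma> k))) \<le> B" for k by (rule B)
  qed (auto intro: mid_H e_parallelogram fp_H)
  have "x \<in> {h \<in> H. nonneg_ae h}"
    using minimizer(2)[OF less_imp_le] p(1) fp_H by (intro cl closed_midconvex_nonneg always_eventually allI) blast
  then have xnn: "nonneg_ae x" by simp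
  define T1 where "T1 = E (f 1) + \<alpha> * S 1 (f 1)"
  \<comment> \<open>For finite \<open>G\<close> the truncated functional is continuous and midpoint
    convex, and at \<open>f (p n)\<close> it is eventually below \<open>T1 + \<epsilon>\<close>;
    hence the cluster point inherits the bound.\<close>
  have xG: "E x + \<alpha> * (\<Sum>l\<in>G. norm (coeffs \<psi> x l)) \<le> T1" if G: "finite G" "G \<subseteq> L" for G
  proof (rule field_le_epsilon)
    fix \<epsilon> :: real assume "\<epsilon> > 0"
    let ?\<phi> = "\<lambda>h. E h + \<alpha> * (\<Sum>l\<in>G. norm (coeffs \<psi> h l))"
    have "x \<in> {h \<in> H. ?\<phi> h \<le> T1 + \<epsilon>}"
    proof (rule cl)
      show "closed_midconvex_H {h \<in> H. ?\<phi> h \<le> T1 + \<epsilon>}"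
      proof (rule closed_midconvex_sublevel)
        fix h k assume hk: "h \<in> H" "k \<in> H"
        have "(\<Sum>l\<in>G. norm (coeffs \<psi> (mid h k) l)) \<le> (\<Sum>l\<in>G. (norm (coeffs \<psi> h l) + norm (coeffs \<psi> k l)) / 2)"
        proof (intro sum_mono)
          fix l assume "l \<in> G"
          then have l: "l \<in> L" using G by auto
          show "norm (coeffs \<psi> (mid h k) l) \<le> (norm (coeffs \<psi> h l) + norm (coeffs \<psi> k l)) / 2"
            unfolding coeffs_mid[OF H_L2[OF hk(1)] H_L2[OF hk(2)] l] norm_divide
            using norm_triangle_ineq[of "coeffs \<psi> h l" "coeffs \<psi> k l"] by simp
        qed
        also have "\<dots> = ((\<Sum>l\<in>G. norm (coeffs \<psi> h l)) + (\<Sum>l\<in>G. norm (coeffs \<psi> k l))) / 2"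
          by (simp add: sum.distrib sum_divide_distrib[symmetric])
        finally have "\<alpha> * (\<Sum>l\<in>G. norm (coeffs \<psi> (mid h k) l)) \<le> \<alpha> * (((\<Sum>l\<in>G. norm (coeffs \<psi> h l)) + (\<Sum>l\<in>G. norm (coeffs \<psi> k l))) / 2)"
          using \<alpha> by (intro mult_left_mono) auto
        also have "\<dots> = (\<alpha> * (\<Sum>l\<in>G. norm (coeffs \<psi> h l)) + \<alpha> * (\<Sum>l\<in>G. norm (coeffs \<psi> k l))) / 2"
          by (simp add: distrib_left)
        finally have pen: "\<alpha> * (\<Sum>l\<in>G. norm (coeffs \<psi> (mid h k) l)) \<le>
            (\<alpha> * (\<Sum>l\<in>G. norm (coeffs \<psi> h l)) + \<alpha> * (\<Sum>l\<in>G. norm (coeffs \<psi> k l))) / 2" .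
        show "?\<phi> (mid h k) \<le> (?\<phi> h + ?\<phi> k) / 2"
          using add_mono[OF E_mid[OF hk] pen] by (simp add: add_divide_distrib add_ac)
      next
        fix y h assume "\<And>k. y k \<in> H" "h \<in> H" "(\<lambda>k. e (y k) h) \<longlonglongrightarrow> 0"
        then have "(\<lambda>k. E (y k)) \<longlonglongrightarrow> E h" "\<And>l. l \<in> G \<Longrightarrow> (\<lambda>k. coeffs \<psi> (y k) l) \<longlonglongrightarrow> coeffs \<psi> h l"
          using G E_tendsto coeffs_tendsto by blast+
        then show "(\<lambda>k. ?\<phi> (y k)) \<longlonglongrightarrow> ?\<phi> h" by (intro tendsto_intros)
      qed
      have "(\<lambda>n. T n + \<alpha> * (real (card G) * (1 - 1 / p n))) \<longlonglongrightarrow> T1 + \<alpha> * 0"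
        unfolding T1_def by (intro tendsto_intros T_tendsto card_term_tendsto)
      then have "\<forall>\<^sub>F n in sequentially. T n + \<alpha> * (real (card G) * (1 - 1 / p n)) < T1 + \<epsilon>"
        using \<open>\<epsilon> > 0\<close> by (intro order_tendstoD(2)) auto
      then have "\<forall>\<^sub>F n in sequentially. f (p n) \<in> {h \<in> H. ?\<phi> h \<le> T1 + \<epsilon>}"
      proof eventually_elim
        case (elim n)
        then show ?case
          using fp_le[of n] mult_left_mono[OF sum_le_penalty[OF G, of n] less_imp_le[OF \<alpha>]] fp_H[of n]
          by (simp add: distrib_left)
      qed
      then show "\<forall>\<^sub>F k in sequentially. f (p (\<sigma> k)) \<in> {h \<in> H. ?\<phi> h \<le> T1 + \<epsilon>}"
        by (rule eventually_subseq[OF \<sigma>(1)])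
    qed
    then show "?\<phi> x \<le> T1 + \<epsilon>" by simp
  qed
  \<comment> \<open>The bound is uniform in \<open>G\<close>, so the coefficients of
    \<open>x\<close> are absolutely summable.\<close>
  then have sums: "(\<Sum>l\<in>G. norm (coeffs \<psi> x l)) \<le> (T1 - E x) / \<alpha>" if "finite G" "G \<subseteq> L" for G
  proof -
    have "(\<Sum>l\<in>G. norm (coeffs \<psi> x l)) * \<alpha> \<le> T1 - E x" using xG[OF that] by (simp add: mult.commute)
    then show ?thesis by (simp only: pos_le_divide_eq[OF \<alpha>])
  qed
  have int: "integrable (count_space L) (\<lambda>l. norm (coeffs \<psi> x l))" "S 1 x \<le> (T1 - E x) / \<alpha>"
    unfolding S_1
    by (rule integrable_count_spaceI_bounded_sums[where B = "(T1 - E x) / \<alpha>"]; use sums in simp)+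
  then have "x \<in> X 1" using x by (auto simp: X H_def Lp_space_def)
  moreover have "S 1 x * \<alpha> \<le> T1 - E x" using int(2) by (simp only: pos_le_divide_eq[OF \<alpha>])
  then have "E x + \<alpha> * S 1 x \<le> T1" by (simp add: mult.commute)
  ultimately have AE: "AE t in lborel. x t = f 1 t"
    using minimizer_unique xnn by (simp add: T1_def)
  have "coeffs \<psi> (\<lambda>t. x t - f 1 t) = (\<lambda>l. 0)"
  proof
    fix l
    have "(\<integral>t. (x t - f 1 t) * cnj (\<psi> l t) \<partial>lborel) = (\<integral>t. 0 \<partial>(lborel :: 'a measure))"
    \<comment> \<open>For \<open>l\<close> outside \<open>L\<close> the product with
      \<open>\<psi> l\<close> need not be measurable; then its Bochner integral is 0 by
      convention.\<close>
    proof (cases "(\<lambda>t. (x t - f 1 t) * cnj (\<psi> l t)) \<in> borel_measurable lborel")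
      case True
      then show ?thesis using AE by (intro integral_cong_AE) auto
    next
      case False
      then have "\<not> integrable lborel (\<lambda>t. (x t - f 1 t) * cnj (\<psi> l t))"
        using borel_measurable_integrable by blast
      then show ?thesis by (simp add: not_integrable_integral_eq)
    qed
    then show "coeffs \<psi> (\<lambda>t. x t - f 1 t) l = 0" by (simp add: coeffs_def L2_inner_def)
  qed
  \<comment> \<open>The representatives \<open>x\<close> and \<open>f 1\<close> may differ on a null
    set. The constant sequence \<open>x\<close> nevertheless converges to \<open>f 1\<close> in
    \<open>e\<close>, and closedness puts \<open>f 1\<close> into \<open>Z\<close>.\<close>
  then have "(\<lambda>k::nat. e x (f 1)) \<longlonglongrightarrow> 0" by (simp add: e_def q_def sqnorm_def)
  moreover have "x \<in> Z" using \<sigma> by (intro cl Z) auto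
  moreover have "\<forall>y z. (\<forall>k. y k \<in> Z) \<longrightarrow> z \<in> H \<longrightarrow> (\<lambda>k. e (y k) z) \<longlonglongrightarrow> 0 \<longrightarrow> z \<in> Z"
    using Z unfolding closed_midconvex_def by (elim conjE)
  from this[rule_format, of "\<lambda>_. x" "f 1"] have "x \<in> Z \<Longrightarrow> (\<lambda>k::nat. e x (f 1)) \<longlonglongrightarrow> 0 \<Longrightarrow> f 1 \<in> Z"
    using f1_H by simp
  ultimately show ?thesis by simp
qed

text \<open>Otherwise a closed sublevel set missing \<open>f 1\<close> would contain
  \<open>f (p n)\<close> for infinitely many \<open>n\<close>.\<close>

lemma eventually_lower_semicontinuous:
  assumes "\<And>f h. f \<in> H \<Longrightarrow> h \<in> H \<Longrightarrow> \<phi> (mid f h) \<le> (\<phi> f + \<phi> h) / 2"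
    and "\<And>y f. (\<And>k. y k \<in> H) \<Longrightarrow> f \<in> H \<Longrightarrow> (\<lambda>k. e (y k) f) \<longlonglongrightarrow> 0 \<Longrightarrow> (\<lambda>k. \<phi> (y k)) \<longlonglongrightarrow> \<phi> f"
    and "\<epsilon> > (0::real)"
  shows "\<forall>\<^sub>F n in sequentially. \<phi> (f 1) - \<epsilon> < \<phi> (f (p n))"
proof (rule ccontr)
  assume "\<not> ?thesis"
  then have "\<exists>\<^sub>F n in sequentially. f (p n) \<in> {h \<in> H. \<phi> h \<le> \<phi> (f 1) - \<epsilon>}"
    by (simp add: not_eventually not_less fp_H)
  moreover have "closed_midconvex_H {h \<in> H. \<phi> h \<le> \<phi> (f 1) - \<epsilon>}"
    by (rule closed_midconvex_sublevel[where \<phi> = \<phi>]) (fact assms(1), fact assms(2))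
  ultimately have "f 1 \<in> {h \<in> H. \<phi> h \<le> \<phi> (f 1) - \<epsilon>}"
    by (intro frequently_closed_midconvex)
  then show False using assms(3) by simp
qed

lemma coeffs_fp_tendsto:
  assumes l: "l \<in> L"
  shows "(\<lambda>n. coeffs \<psi> (f (p n)) l) \<longlonglongrightarrow> coeffs \<psi> (f 1) l"
proof -
  \<comment> \<open>The choices 1, -1, -i and i of \<open>\<zeta>\<close> give lower bounds for the
    real and imaginary parts and for their negatives, hence two-sided convergence.\<close>
  have ev: "\<forall>\<^sub>F n in sequentially. Re (\<zeta> * coeffs \<psi> (f 1) l) - \<epsilon> < Re (\<zeta> * coeffs \<psi> (f (p n)) l)"
    if "\<epsilon> > 0" for \<zeta> \<epsilon>
  proof (rule eventually_lower_semicontinuous[OF _ _ that])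
    show "Re (\<zeta> * coeffs \<psi> (mid f h) l) \<le> (Re (\<zeta> * coeffs \<psi> f l) + Re (\<zeta> * coeffs \<psi> h l)) / 2"
      if "f \<in> H" "h \<in> H" for f h
      unfolding coeffs_mid[OF H_L2[OF that(1)] H_L2[OF that(2)] l] by (simp add: algebra_simps)
    show "(\<lambda>k. Re (\<zeta> * coeffs \<psi> (y k) l)) \<longlonglongrightarrow> Re (\<zeta> * coeffs \<psi> f l)"
      if "\<And>k. y k \<in> H" "f \<in> H" "(\<lambda>k. e (y k) f) \<longlonglongrightarrow> 0" for y f
      using coeffs_tendsto[OF that l] by (intro tendsto_intros)
  qed
  have lim: "a \<longlonglongrightarrow> b"
    if "\<And>\<epsilon>. \<epsilon> > 0 \<Longrightarrow> \<forall>\<^sub>F n in sequentially. b - \<epsilon> < a n" "\<And>\<epsilon>. \<epsilon> > 0 \<Longrightarrow> \<forall>\<^sub>F n in sequentially. a n < b + \<epsilon>"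
    for a :: "nat \<Rightarrow> real" and b
  proof (rule order_tendstoI)
    show "\<forall>\<^sub>F n in sequentially. c < a n" if "c < b" for c
      using \<open>\<And>\<epsilon>. \<epsilon> > 0 \<Longrightarrow> \<forall>\<^sub>F n in sequentially. b - \<epsilon> < a n\<close>[of "b - c"] that by simp
    show "\<forall>\<^sub>F n in sequentially. a n < c" if "b < c" for c
      using \<open>\<And>\<epsilon>. \<epsilon> > 0 \<Longrightarrow> \<forall>\<^sub>F n in sequentially. a n < b + \<epsilon>\<close>[of "c - b"] that by simp
  qed
  show ?thesis
  proof (subst tendsto_complex_iff, intro conjI lim)
    fix \<epsilon> :: real assume e: "\<epsilon> > 0"
    show "\<forall>\<^sub>F n in sequentially. Re (coeffs \<psi> (f 1) l) - \<epsilon> < Re (coeffs \<psi> (f (p n)) l)"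
      using ev[OF e, of 1] by simp
    show "\<forall>\<^sub>F n in sequentially. Re (coeffs \<psi> (f (p n)) l) < Re (coeffs \<psi> (f 1) l) + \<epsilon>"
      using ev[OF e, of "-1"] by eventually_elim simp
    show "\<forall>\<^sub>F n in sequentially. Im (coeffs \<psi> (f 1) l) - \<epsilon> < Im (coeffs \<psi> (f (p n)) l)"
      using ev[OF e, of "-\<i>"] by eventually_elim simp
    show "\<forall>\<^sub>F n in sequentially. Im (coeffs \<psi> (f (p n)) l) < Im (coeffs \<psi> (f 1) l) + \<epsilon>"
      using ev[OF e, of "\<i>"] by eventually_elim simp
  qed
qed

text \<open>Coordinatewise convergence together with lower semicontinuity of the data term forces the
  penalty outside a finite set \<open>G\<close> to be asymptotically at most that of the limit.\<close>

lemma eventually_tail_le: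
  assumes G: "finite G" "G \<subseteq> L" and tail: "(\<integral>l. norm (coeffs \<psi> (f 1) l) \<partial>count_space (L - G)) < \<eta>"
  shows "\<forall>\<^sub>F n in sequentially. (\<integral>l. norm (coeffs \<psi> (f (p n)) l) powr p n \<partial>count_space (L - G)) < 4 * \<eta>"
proof -
  let ?R = "\<lambda>n. (\<integral>l. norm (coeffs \<psi> (f (p n)) l) powr p n \<partial>count_space (L - G))"
  let ?t = "\<integral>l. norm (coeffs \<psi> (f 1) l) \<partial>count_space (L - G)"
  let ?s = "\<lambda>n. \<Sum>l\<in>G. norm (coeffs \<psi> (f (p n)) l)"
  define T1 where "T1 = E (f 1) + \<alpha> * S 1 (f 1)"
  have \<eta>: "\<eta> > 0" using tail Bochner_Integration.integral_nonneg[of "count_space (L - G)" "\<lambda>l. norm (coeffs \<psi> (f 1) l)"] by (meson norm_ge_zero order_le_less_trans)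
  have int1: "integrable (count_space L) (\<lambda>l. norm (coeffs \<psi> (f 1) l))"
    using f1_coeffs by (simp add: Lp_space_def)
  \<comment> \<open>Young's inequality is spent only on \<open>G\<close>; outside \<open>G\<close>
    the penalty keeps the exponent \<open>p n\<close>.\<close>
  have bound: "\<alpha> * (1 / p n) * ?R n \<le> T n - E (f (p n)) - \<alpha> * (?s n - real (card G) * (1 - 1 / p n))" for n
  proof -
    have "?s n - real (card G) * (1 - 1 / p n) \<le> (\<Sum>l\<in>G. norm (coeffs \<psi> (f (p n)) l) powr p n) / p n"
      using sum_le_powr_sum[where G = G and n = n] by simp
    then have "\<alpha> * (?s n - real (card G) * (1 - 1 / p n)) \<le> \<alpha> * ((\<Sum>l\<in>G. norm (coeffs \<psi> (f (p n)) l) powr p n) / p n)"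
      using \<alpha> by (intro mult_left_mono) auto
    moreover have "S (p n) (f (p n)) = (\<Sum>l\<in>G. norm (coeffs \<psi> (f (p n)) l) powr p n) + ?R n"
      unfolding S_def by (rule integral_count_space_split(2)[OF G fp_integrable])
    then have "\<alpha> * (1 / p n) * S (p n) (f (p n)) =
        \<alpha> * ((\<Sum>l\<in>G. norm (coeffs \<psi> (f (p n)) l) powr p n) / p n) + \<alpha> * (1 / p n) * ?R n"
      by (simp add: distrib_left add_divide_distrib)
    ultimately show ?thesis using fp_le[of n] by linarith
  qed
  have "(\<lambda>n. T n - \<alpha> * (?s n - real (card G) * (1 - 1 / p n))) \<longlonglongrightarrow>
        T1 - \<alpha> * ((\<Sum>l\<in>G. norm (coeffs \<psi> (f 1) l)) - 0)"
    using G unfolding T1_def by (intro tendsto_intros T_tendsto card_term_tendsto coeffs_fp_tendsto) auto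
  moreover have "T1 - \<alpha> * ((\<Sum>l\<in>G. norm (coeffs \<psi> (f 1) l)) - 0) = E (f 1) + \<alpha> * ?t"
    unfolding T1_def S_1 integral_count_space_split(2)[OF G int1] by (simp add: algebra_simps)
  moreover have "E (f 1) + \<alpha> * ?t < E (f 1) + \<alpha> * \<eta>" using tail \<alpha> by simp
  ultimately have "\<forall>\<^sub>F n in sequentially. T n - \<alpha> * (?s n - real (card G) * (1 - 1 / p n)) < E (f 1) + \<alpha> * \<eta>"
    by (intro order_tendstoD(2)) auto
  moreover have "\<forall>\<^sub>F n in sequentially. E (f 1) - \<alpha> * \<eta> < E (f (p n))"
    using E_mid E_tendsto \<alpha> \<eta> by (intro eventually_lower_semicontinuous) auto
  ultimately show ?thesis
  proof eventually_elim
    case (elim n)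
    \<comment> \<open>One \<open>\<eta>\<close> comes from the tail of the limit, one from lower
      semicontinuity of the data term; clearing \<open>1 / p n\<close> with \<open>p n < 2\<close>
      doubles them to \<open>4 * \<eta>\<close>.\<close>
    then have "\<alpha> * (1 / p n) * ?R n < \<alpha> * (2 * \<eta>)" using bound[of n] by simp
    then have "?R n < 2 * \<eta> * p n" using \<alpha> p(1)[of n] by (simp add: field_simps)
    also have "\<dots> \<le> 2 * \<eta> * 2" using p(1)[of n] \<eta> by (intro mult_left_mono) auto
    finally show ?case by simp
  qed
qed

text \<open>With a tail below 1 the factor \<open>max 1\<close> of \<open>ell_mono_2\<close>
  disappears, so smallness of the penalty passes to the squared norm.\<close>

lemma sqnorm_tail_le:
  assumes c: "c \<in> ell L r" and r: "1 \<le> r" "r \<le> 2" and G: "finite G" "G \<subseteq> L"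
    and small: "(\<integral>l. norm (c l) powr r \<partial>count_space (L - G)) < \<eta>" "\<eta> \<le> 1"
  shows "sqnorm (count_space (L - G)) c \<le> \<eta>" "c \<in> ell (L - G) 2"
proof -
  let ?I = "\<integral>l. norm (c l) powr r \<partial>count_space (L - G)"
  have c': "c \<in> ell (L - G) r"
    using integral_count_space_split(1)[OF G, of "\<lambda>l. norm (c l) powr r"] c by (simp add: Lp_space_def)
  show "c \<in> ell (L - G) 2" by (rule ell_mono_2(1)[OF c' r])
  have "sqnorm (count_space (L - G)) c \<le> max 1 ?I * ?I" by (rule ell_mono_2(2)[OF c' r])
  also have "max 1 ?I = 1" using small by simp
  finally show "sqnorm (count_space (L - G)) c \<le> \<eta>" using small by simp
qed

theorem minimizers_tendsto: "(\<lambda>n. X_norm L \<psi> 2 (\<lambda>x. f (p n) x - f 1 x)) \<longlonglongrightarrow> 0"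
proof -
  have "(\<lambda>n. e (f (p n)) (f 1)) \<longlonglongrightarrow> 0"
  proof (rule LIMSEQ_I)
    fix \<epsilon> :: real assume "\<epsilon> > 0"
    \<comment> \<open>The tails need \<open>4 * \<eta> \<le> 1\<close>. The finite part contributes
      less than \<open>4 * \<eta>\<close> and the two tails at most \<open>10 * \<eta>\<close>, in
      total less than \<open>20 * \<eta> \<le> \<epsilon>\<close>.\<close>
    define \<eta> where "\<eta> = min (1/4) (\<epsilon> / 20)"
    have \<eta>: "\<eta> > 0" "4 * \<eta> \<le> 1" "20 * \<eta> \<le> \<epsilon>" using \<open>\<epsilon> > 0\<close> by (auto simp: \<eta>_def)
    obtain G where G: "finite G" "G \<subseteq> L" and tail: "(\<integral>l. norm (coeffs \<psi> (f 1) l) \<partial>count_space (L - G)) < \<eta>"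
      using integral_count_space_tail[of L "\<lambda>l. norm (coeffs \<psi> (f 1) l)" \<eta>] f1_coeffs \<eta>
      by (auto simp: Lp_space_def)
    have tail1: "sqnorm (count_space (L - G)) (coeffs \<psi> (f 1)) \<le> \<eta>" "coeffs \<psi> (f 1) \<in> ell (L - G) 2"
      using sqnorm_tail_le[OF f1_coeffs _ _ G, of \<eta>] tail \<eta> by auto
    have "(\<lambda>n. \<Sum>l\<in>G. (norm (coeffs \<psi> (f (p n)) l - coeffs \<psi> (f 1) l))\<^sup>2) \<longlonglongrightarrow>
        (\<Sum>l\<in>G. (norm (coeffs \<psi> (f 1) l - coeffs \<psi> (f 1) l))\<^sup>2)"
      using G by (intro tendsto_intros coeffs_fp_tendsto) auto
    then have "\<forall>\<^sub>F n in sequentially. (\<Sum>l\<in>G. (norm (coeffs \<psi> (f (p n)) l - coeffs \<psi> (f 1) l))\<^sup>2) < 4 * \<eta>"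
      using \<eta> by (intro order_tendstoD(2)) auto
    then have "\<forall>\<^sub>F n in sequentially. e (f (p n)) (f 1) < \<epsilon>"
      using eventually_tail_le[OF G tail]
    proof eventually_elim
      case (elim n)
      have tailn: "sqnorm (count_space (L - G)) (coeffs \<psi> (f (p n))) \<le> 4 * \<eta>" "coeffs \<psi> (f (p n)) \<in> ell (L - G) 2"
        using sqnorm_tail_le[OF fp_ell[of n] _ _ G elim(2)] p(1)[of n] \<eta> by auto
      let ?d = "\<lambda>l. coeffs \<psi> (f (p n)) l - coeffs \<psi> (f 1) l"
      have "e (f (p n)) (f 1) = (\<Sum>l\<in>G. (norm (?d l))\<^sup>2) + sqnorm (count_space (L - G)) ?d"
        unfolding e_eq[OF fp_H f1_H] sqnorm_def
        using L2_integrable[OF L2_diff[OF H_ell[OF fp_H] H_ell[OF f1_H]]]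
        by (intro integral_count_space_split(2)[OF G])
      also have "sqnorm (count_space (L - G)) ?d \<le> 2 * (4 * \<eta>) + 2 * \<eta>"
        using sqnorm_add_le[OF tailn(2) L2_scale[OF tail1(2), of "-1"]] tailn(1) tail1(1)
        by (simp add: sqnorm_def)
      finally show ?case using elim(1) \<eta> by simp
    qed
    then show "\<exists>n0. \<forall>n\<ge>n0. norm (e (f (p n)) (f 1) - 0) < \<epsilon>"
      by (simp add: eventually_sequentially)
  qed
  then have "(\<lambda>n. sqrt (e (f (p n)) (f 1))) \<longlonglongrightarrow> sqrt 0" by (rule tendsto_real_sqrt)
  then show ?thesis by (simp add: X_norm_2 e_def)
qed

end

section \<open>The Besov setting\<close>

text \<open>Smoothness zero removes the modulus term by definition, and the support condition allows
  integration over the whole space instead of \<open>\<Omega>\<close>.\<close>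

lemma besov_norm_0_2:
  assumes "f \<in> L2_on \<Omega>"
  shows "besov_norm 0 2 \<Omega> f = sqrt (sqnorm lborel f)"
proof -
  have f: "f \<in> Lp_space lborel 2" and S: "AE x in lborel. x \<notin> \<Omega> \<longrightarrow> f x = 0"
    using assms by (auto simp: L2_on_def supported_in_def)
  have "besov_pow 0 2 \<Omega> f = (\<integral>\<^sup>+x. ennreal ((norm (f x))\<^sup>2) \<partial>lborel)"
    unfolding besov_pow_def using S
    by (auto intro!: nn_integral_cong_AE elim!: eventually_mono simp: indicator_def)
  then show ?thesis
    by (simp add: besov_norm_def ennreal_sqnorm[OF f] powr_half_sqrt)
qed

lemma sqnorm_le_of_sqrt_le:
  assumes "c > 0" "c * sqrt a \<le> sqrt b" "0 \<le> a" "0 \<le> b"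
  shows "a \<le> (1 / c\<^sup>2) * b"
proof -
  have "(c * sqrt a)\<^sup>2 \<le> (sqrt b)\<^sup>2" using assms by (intro power_mono) auto
  then show ?thesis using assms by (simp add: power_mult_distrib field_simps)
qed

lemma besov_coefficient_frame:
  fixes \<Omega> :: "(real ^ 'd) set"
  assumes "besov_setting \<Omega> L \<psi>"
  obtains C where "coefficient_frame \<Omega> L \<psi> C"
    "\<And>r. 1 \<le> r \<Longrightarrow> r \<le> 2 \<Longrightarrow> besov_X \<Omega> r = {f \<in> L2_on \<Omega>. coeffs \<psi> f \<in> ell L r}"
proof -
  have s0: "besov_smoothness CARD('d) 2 = 0" by (simp add: besov_smoothness_def)
  have ch: "characterizes_besov \<Omega> L \<psi> r" if "1 \<le> r" "r \<le> 2" for r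
    using assms that by (auto simp: besov_setting_def)
  have X: "besov_X \<Omega> r = {f \<in> L2_on \<Omega>. coeffs \<psi> f \<in> ell L r}" if "1 \<le> r" "r \<le> 2" for r
    using ch[OF that] by (auto simp: characterizes_besov_def)
  obtain c where c: "c > 0" "\<And>f. f \<in> besov_X \<Omega> 2 \<Longrightarrow> c * besov_norm 0 2 \<Omega> f \<le> X_norm L \<psi> 2 f"
    using ch[of 2] unfolding characterizes_besov_def s0 by auto
  \<comment> \<open>At exponent 2 the smoothness is 0 and the Besov norm is the
    \<open>L\<^sup>2\<close> norm; squaring the lower half of the equivalence produces
    \<open>1 / c\<^sup>2\<close>.\<close>
  have "coefficient_frame \<Omega> L \<psi> (1 / c\<^sup>2)"
  proof
    show "\<psi> l \<in> Lp_space lborel 2" if "l \<in> L" for l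
      using assms that by (auto simp: besov_setting_def orthonormal_wavelet_basis_def L2_on_def)
    show "sqnorm lborel f \<le> 1 / c\<^sup>2 * sqnorm (count_space L) (coeffs \<psi> f)"
      if "f \<in> L2_on \<Omega>" "coeffs \<psi> f \<in> ell L 2" for f
      using c(2)[of f] that X[of 2]
      by (intro sqnorm_le_of_sqrt_le[OF c(1)]) (auto simp: besov_norm_0_2 X_norm_def Lp_norm_2)
  qed
  with X that show thesis by blast
qed

section \<open>Continuity of translations\<close>

lemma
  fixes f :: "'a::euclidean_space \<Rightarrow> 'b::{banach, second_countable_topology}"
  assumes c: "c \<noteq> 0"
  shows lborel_integrable_affine: "integrable lborel f \<Longrightarrow> integrable lborel (\<lambda>x. f (t + c *\<^sub>R x))"
    and lborel_integral_affine:
      "integrable lborel f \<Longrightarrow> (\<integral>x. f x \<partial>lborel) = \<bar>c\<bar> ^ DIM('a) *\<^sub>R (\<integral>x. f (t + c *\<^sub>R x) \<partial>lborel)"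
proof -
  note eq = lborel_affine[OF c, of t]
  have pos: "0 < \<bar>c\<bar> ^ DIM('a)" using c by simp
  show int: "integrable lborel (\<lambda>x. f (t + c *\<^sub>R x))" if f: "integrable lborel f"
  proof -
    have [measurable]: "f \<in> borel_measurable borel" using f by auto
    have "integrable (density (distr lborel borel (\<lambda>x. t + c *\<^sub>R x)) (\<lambda>_. ennreal (\<bar>c\<bar> ^ DIM('a)))) f"
      using f eq by simp
    then have "integrable (distr lborel borel (\<lambda>x. t + c *\<^sub>R x)) (\<lambda>x. \<bar>c\<bar> ^ DIM('a) *\<^sub>R f x)"
      by (subst (asm) integrable_density) auto
    then have "integrable lborel (\<lambda>x. \<bar>c\<bar> ^ DIM('a) *\<^sub>R f (t + c *\<^sub>R x))"
      by (subst (asm) integrable_distr_eq) auto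
    from integrable_scaleR_right[OF this, of "inverse (\<bar>c\<bar> ^ DIM('a))"] show ?thesis
      using c by simp
  qed
  show "(\<integral>x. f x \<partial>lborel) = \<bar>c\<bar> ^ DIM('a) *\<^sub>R (\<integral>x. f (t + c *\<^sub>R x) \<partial>lborel)" if f: "integrable lborel f"
  proof -
    have [measurable]: "f \<in> borel_measurable borel" using f by auto
    have "(\<integral>x. f x \<partial>lborel) = (\<integral>x. f x \<partial>density (distr lborel borel (\<lambda>x. t + c *\<^sub>R x)) (\<lambda>_. ennreal (\<bar>c\<bar> ^ DIM('a))))"
      using eq by simp
    also have "\<dots> = (\<integral>x. \<bar>c\<bar> ^ DIM('a) *\<^sub>R f x \<partial>distr lborel borel (\<lambda>x. t + c *\<^sub>R x))"
      by (subst integral_density) auto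
    also have "\<dots> = \<bar>c\<bar> ^ DIM('a) *\<^sub>R (\<integral>x. f (t + c *\<^sub>R x) \<partial>lborel)"
      by (subst integral_distr) auto
    finally show ?thesis .
  qed
qed

lemma lborel_nn_integral_affine:
  fixes f :: "'a::euclidean_space \<Rightarrow> ennreal"
  assumes c: "c \<noteq> 0" and [measurable]: "f \<in> borel_measurable borel"
  shows "(\<integral>\<^sup>+x. f x \<partial>lborel) = ennreal (\<bar>c\<bar> ^ DIM('a)) * (\<integral>\<^sup>+x. f (t + c *\<^sub>R x) \<partial>lborel)"
proof -
  have "(\<integral>\<^sup>+x. f x \<partial>lborel) = (\<integral>\<^sup>+x. f x \<partial>density (distr lborel borel (\<lambda>x. t + c *\<^sub>R x)) (\<lambda>_. ennreal (\<bar>c\<bar> ^ DIM('a))))"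
    using lborel_affine[OF c, of t] by simp
  also have "\<dots> = ennreal (\<bar>c\<bar> ^ DIM('a)) * (\<integral>\<^sup>+x. f (t + c *\<^sub>R x) \<partial>lborel)"
    by (subst nn_integral_density, simp, simp) (subst nn_integral_distr, auto simp: nn_integral_cmult)
  finally show ?thesis .
qed

lemma L2_translate:
  fixes f :: "'a::euclidean_space \<Rightarrow> complex"
  assumes "f \<in> Lp_space lborel 2"
  shows "(\<lambda>x. f (x + z)) \<in> Lp_space lborel 2" "sqnorm lborel (\<lambda>x. f (x + z)) = sqnorm lborel f"
proof -
  have [measurable]: "f \<in> borel_measurable borel" using L2_measurable[OF assms] by simp
  show "(\<lambda>x. f (x + z)) \<in> Lp_space lborel 2"
    using lborel_integrable_affine[of 1 _ z, OF _ L2_integrable[OF assms]]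
    by (simp add: Lp_space_2_iff add.commute)
  show "sqnorm lborel (\<lambda>x. f (x + z)) = sqnorm lborel f"
    using lborel_integral_affine[of 1 _ z, OF _ L2_integrable[OF assms]]
    by (simp add: sqnorm_def add.commute)
qed

text \<open>This property makes the autocorrelation continuous at zero, which drives the proof of
  Plancherel's theorem. It is extended from open sets to Borel sets, to simple functions and to all
  square-integrable functions.\<close>

definition L2_translation_continuous :: "('a::euclidean_space \<Rightarrow> complex) \<Rightarrow> bool" where
  "L2_translation_continuous f \<longleftrightarrow> f \<in> Lp_space lborel 2 \<and>
     (\<forall>z. z \<longlonglongrightarrow> 0 \<longrightarrow> (\<lambda>k. sqnorm lborel (\<lambda>x. f (x + z k) - f x)) \<longlonglongrightarrow> 0)"

lemma L2_translation_continuousD: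
  "L2_translation_continuous f \<Longrightarrow> f \<in> Lp_space lborel 2"
  "L2_translation_continuous f \<Longrightarrow> z \<longlonglongrightarrow> 0 \<Longrightarrow> (\<lambda>k. sqnorm lborel (\<lambda>x. f (x + z k) - f x)) \<longlonglongrightarrow> 0"
  unfolding L2_translation_continuous_def by blast+

lemma L2_translation_continuous_add:
  assumes "L2_translation_continuous f" "L2_translation_continuous g"
  shows "L2_translation_continuous (\<lambda>x. f x + g x)"
  unfolding L2_translation_continuous_def
proof (intro conjI allI impI)
  have f: "f \<in> Lp_space lborel 2" and g: "g \<in> Lp_space lborel 2"
    using assms by (auto simp: L2_translation_continuous_def)
  then show "(\<lambda>x. f x + g x) \<in> Lp_space lborel 2" by (rule L2_add)
  fix z :: "nat \<Rightarrow> 'a" assume z: "z \<longlonglongrightarrow> 0"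
  have "sqnorm lborel (\<lambda>x. f (x + z k) + g (x + z k) - (f x + g x)) \<le>
      2 * sqnorm lborel (\<lambda>x. f (x + z k) - f x) + 2 * sqnorm lborel (\<lambda>x. g (x + z k) - g x)" for k
    using sqnorm_add_le[OF L2_diff[OF L2_translate(1)[OF f] f] L2_diff[OF L2_translate(1)[OF g] g], of "z k" "z k"]
    by (simp add: algebra_simps)
  note le = this
  have "(\<lambda>k. 2 * sqnorm lborel (\<lambda>x. f (x + z k) - f x) + 2 * sqnorm lborel (\<lambda>x. g (x + z k) - g x)) \<longlonglongrightarrow> 2 * 0 + 2 * 0"
    by (rule tendsto_add; rule tendsto_mult_left; rule L2_translation_continuousD(2)[OF _ z]; fact assms)
  then show "(\<lambda>k. sqnorm lborel (\<lambda>x. f (x + z k) + g (x + z k) - (f x + g x))) \<longlonglongrightarrow> 0"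
    by (intro tendsto_0_squeeze[OF _ le]) simp_all
qed

lemma L2_translation_continuous_scale:
  assumes "L2_translation_continuous f"
  shows "L2_translation_continuous (\<lambda>x. c * f x)"
  unfolding L2_translation_continuous_def
proof (intro conjI allI impI)
  show "(\<lambda>x. c * f x) \<in> Lp_space lborel 2"
    using assms by (auto simp: L2_translation_continuous_def intro: L2_scale)
  fix z :: "nat \<Rightarrow> 'a" assume z: "z \<longlonglongrightarrow> 0"
  have "sqnorm lborel (\<lambda>x. c * f (x + z k) - c * f x) = (norm c)\<^sup>2 * sqnorm lborel (\<lambda>x. f (x + z k) - f x)" for k
    by (simp add: sqnorm_def right_diff_distrib[symmetric] norm_mult power_mult_distrib)
  then show "(\<lambda>k. sqnorm lborel (\<lambda>x. c * f (x + z k) - c * f x)) \<longlonglongrightarrow> 0"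
    using L2_translation_continuousD(2)[OF assms z] by (simp add: tendsto_mult_right_zero)
qed

lemma L2_translation_continuous_sum:
  assumes "finite I" "\<And>i. i \<in> I \<Longrightarrow> L2_translation_continuous (f i)"
  shows "L2_translation_continuous (\<lambda>x. \<Sum>i\<in>I. f i x)"
  using assms
proof (induction I rule: finite_induct)
  case empty
  then show ?case by (simp add: L2_translation_continuous_def L2_zero sqnorm_def)
next
  case (insert i I)
  then show ?case by (simp add: L2_translation_continuous_add)
qed

lemma L2_translation_continuous_limit:
  assumes f: "f \<in> Lp_space lborel 2"
    and g: "\<And>\<epsilon>. \<epsilon> > 0 \<Longrightarrow> \<exists>g. L2_translation_continuous g \<and> sqnorm lborel (\<lambda>x. g x - f x) \<le> \<epsilon>"
  shows "L2_translation_continuous f"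
  unfolding L2_translation_continuous_def
proof (intro conjI allI impI f)
  fix z :: "nat \<Rightarrow> 'a" assume z: "z \<longlonglongrightarrow> 0"
  show "(\<lambda>k. sqnorm lborel (\<lambda>x. f (x + z k) - f x)) \<longlonglongrightarrow> 0"
  proof (rule LIMSEQ_I)
    fix \<epsilon> :: real assume "\<epsilon> > 0"
    \<comment> \<open>Two applications of \<open>sqnorm_add_le\<close> weight the three errors by 2,
      4 and 4, and 10/16 is below 1.\<close>
    obtain g where g: "L2_translation_continuous g" "sqnorm lborel (\<lambda>x. g x - f x) \<le> \<epsilon> / 16"
      using g[of "\<epsilon> / 16"] \<open>\<epsilon> > 0\<close> by auto
    then have gL: "g \<in> Lp_space lborel 2" by (simp add: L2_translation_continuous_def)
    note gf = L2_diff[OF gL f]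
    have fg: "sqnorm lborel (\<lambda>x. - (g (x + w) - f (x + w))) = sqnorm lborel (\<lambda>x. g x - f x)" for w
      using L2_translate(2)[OF gf, of w] by (simp add: sqnorm_def norm_minus_commute)
    have "(\<lambda>k. sqnorm lborel (\<lambda>x. g (x + z k) - g x)) \<longlonglongrightarrow> 0"
      using g z by (intro L2_translation_continuousD(2))
    then have "\<forall>\<^sub>F k in sequentially. sqnorm lborel (\<lambda>x. g (x + z k) - g x) < \<epsilon> / 16"
      using \<open>\<epsilon> > 0\<close> by (intro order_tendstoD(2)) auto
    then obtain n0 where n0: "\<And>k. k \<ge> n0 \<Longrightarrow> sqnorm lborel (\<lambda>x. g (x + z k) - g x) < \<epsilon> / 16"
      by (auto simp: eventually_sequentially)
    have "sqnorm lborel (\<lambda>x. f (x + z k) - f x) < \<epsilon>" if "k \<ge> n0" for k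
    proof -
      have tr: "(\<lambda>x. - (g (x + z k) - f (x + z k))) \<in> Lp_space lborel 2"
        using L2_scale[OF L2_translate(1)[OF gf], of "-1" "z k"] by simp
      have tg: "(\<lambda>x. g (x + z k) - g x) \<in> Lp_space lborel 2"
        by (intro L2_diff L2_translate gL)
      have "sqnorm lborel (\<lambda>x. f (x + z k) - f x) =
          sqnorm lborel (\<lambda>x. - (g (x + z k) - f (x + z k)) + ((g (x + z k) - g x) + (g x - f x)))"
        by simp
      also have "\<dots> \<le> 2 * sqnorm lborel (\<lambda>x. g x - f x) + 2 * sqnorm lborel (\<lambda>x. (g (x + z k) - g x) + (g x - f x))"
        using sqnorm_add_le[OF tr L2_add[OF tg gf]] by (simp only: fg)
      also have "\<dots> \<le> 2 * sqnorm lborel (\<lambda>x. g x - f x) +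
          2 * (2 * sqnorm lborel (\<lambda>x. g (x + z k) - g x) + 2 * sqnorm lborel (\<lambda>x. g x - f x))"
        using sqnorm_add_le[OF tg gf] by simp
      also have "\<dots> < \<epsilon>" using n0[OF that] g(2) \<open>\<epsilon> > 0\<close> by argo
      finally show ?thesis .
    qed
    then show "\<exists>n0. \<forall>k\<ge>n0. norm (sqnorm lborel (\<lambda>x. f (x + z k) - f x) - 0) < \<epsilon>" by auto
  qed
qed

lemma indicator_L2:
  assumes "A \<in> sets M" "emeasure M A < \<infinity>"
  shows "(\<lambda>x. indicator A x :: complex) \<in> Lp_space M 2"
proof -
  have "(norm (indicator A x :: complex))\<^sup>2 = (indicator A x :: real)" for x
    by (simp add: indicator_def)
  then show ?thesis using assms by (simp add: Lp_space_2_iff)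
qed

text \<open>The squared difference of the indicators reduces to their overlap. For \<open>x\<close>
  in the open set \<open>U\<close> the points \<open>x + z k\<close> are eventually in
  \<open>U\<close>, so the overlap tends to the measure of \<open>U\<close>.\<close>

lemma L2_translation_continuous_open:
  assumes U: "open U" "emeasure lborel U < \<infinity>"
  shows "L2_translation_continuous (indicator U :: 'a::euclidean_space \<Rightarrow> complex)"
  unfolding L2_translation_continuous_def
proof (intro conjI allI impI)
  have [measurable]: "U \<in> sets borel" using U by simp
  show UL: "indicator U \<in> Lp_space (lborel :: 'a measure) 2" using U by (intro indicator_L2) auto
  have iU: "integrable lborel (indicator U :: 'a \<Rightarrow> real)" using U by simp
  fix z :: "nat \<Rightarrow> 'a" assume z: "z \<longlonglongrightarrow> 0"
  let ?i = "indicator U :: 'a \<Rightarrow> real"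
  have it: "integrable lborel (\<lambda>x. ?i (x + z k))" "(\<integral>x. ?i (x + z k) \<partial>lborel) = (\<integral>x. ?i x \<partial>lborel)" for k
    using lborel_integrable_affine[of 1 ?i "z k"] lborel_integral_affine[of 1 ?i "z k"] iU by (auto simp: add.commute)
  have ip: "integrable lborel (\<lambda>x. ?i x * ?i (x + z k))" for k
    by (rule Bochner_Integration.integrable_bound[OF iU]) (auto simp: indicator_def)
  have "sqnorm lborel (\<lambda>x. indicator U (x + z k) - indicator U x) =
      (\<integral>x. ?i (x + z k) + ?i x - 2 * (?i x * ?i (x + z k)) \<partial>lborel)" for k
    unfolding sqnorm_def by (intro Bochner_Integration.integral_cong) (auto simp: indicator_def)
  also have "\<dots> k = 2 * (\<integral>x. ?i x \<partial>lborel) - 2 * (\<integral>x. ?i x * ?i (x + z k) \<partial>lborel)" for k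
    using it iU ip by simp
  finally have eq: "sqnorm lborel (\<lambda>x. indicator U (x + z k) - indicator U x) =
    2 * (\<integral>x. ?i x \<partial>lborel) - 2 * (\<integral>x. ?i x * ?i (x + z k) \<partial>lborel)" for k .
  have "(\<lambda>k. \<integral>x. ?i x * ?i (x + z k) \<partial>lborel) \<longlonglongrightarrow> (\<integral>x. ?i x \<partial>lborel)"
  proof (rule integral_dominated_convergence[OF _ _ iU])
    show "AE x in lborel. (\<lambda>k. ?i x * ?i (x + z k)) \<longlonglongrightarrow> ?i x"
    proof (rule AE_I2)
      fix x
      show "(\<lambda>k. ?i x * ?i (x + z k)) \<longlonglongrightarrow> ?i x"
      proof (cases "x \<in> U")
        case True
        have "(\<lambda>k. x + z k) \<longlonglongrightarrow> x + 0" by (intro tendsto_intros z)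
        then have "\<forall>\<^sub>F k in sequentially. x + z k \<in> U" using True U by (intro topological_tendstoD) auto
        then have "\<forall>\<^sub>F k in sequentially. ?i x = ?i x * ?i (x + z k)"
          using True by (auto elim!: eventually_mono)
        then show ?thesis by (rule Lim_transform_eventually[OF tendsto_const])
      qed simp
    qed
  qed (auto simp: indicator_def)
  then have "(\<lambda>k. 2 * (\<integral>x. ?i x \<partial>lborel) - 2 * (\<integral>x. ?i x * ?i (x + z k) \<partial>lborel)) \<longlonglongrightarrow>
      2 * (\<integral>x. ?i x \<partial>lborel) - 2 * (\<integral>x. ?i x \<partial>lborel)"
    by (intro tendsto_intros)
  then show "(\<lambda>k. sqnorm lborel (\<lambda>x. indicator U (x + z k) - indicator U x)) \<longlonglongrightarrow> 0"
    unfolding eq by simp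
qed

text \<open>Outer regularity: the squared distance to the indicator of an open superset is the
  measure of the difference.\<close>

lemma L2_translation_continuous_indicator:
  assumes A: "A \<in> sets borel" "emeasure lborel A < \<infinity>"
  shows "L2_translation_continuous (indicator A :: 'a::euclidean_space \<Rightarrow> complex)"
proof (rule L2_translation_continuous_limit)
  show "indicator A \<in> Lp_space (lborel :: 'a measure) 2" using A by (intro indicator_L2) auto
  fix \<epsilon> :: real assume "\<epsilon> > 0"
  obtain U where U: "open U" "A \<subseteq> U" "emeasure lborel (U - A) < \<epsilon>"
    using outer_regular_lborel[OF A(1) \<open>\<epsilon> > 0\<close>] by blast
  have [measurable]: "U \<in> sets borel" "A \<in> sets borel" using U A by auto
  have "emeasure lborel U = emeasure lborel (A \<union> (U - A))"
    using U by (metis Un_Diff_cancel sup.absorb_iff2)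
  also have "\<dots> \<le> emeasure lborel A + emeasure lborel (U - A)" by (intro emeasure_subadditive) auto
  also have "\<dots> < \<infinity>" using A(2) U(3) by (auto simp: less_top intro: order.strict_trans)
  finally have Ufin: "emeasure lborel U < \<infinity>" .
  have "sqnorm lborel (\<lambda>x. indicator U x - indicator A x) = (\<integral>x. indicator (U - A) x \<partial>(lborel :: 'a measure))"
    unfolding sqnorm_def using U by (intro Bochner_Integration.integral_cong) (auto simp: indicator_def)
  also have "\<dots> = measure lborel (U - A)" by simp
  also have "\<dots> \<le> \<epsilon>"
    unfolding measure_def using U(3) \<open>\<epsilon> > 0\<close> by (intro enn2real_leI) auto
  finally show "\<exists>g. L2_translation_continuous g \<and> sqnorm lborel (\<lambda>x. g x - indicator A x) \<le> \<epsilon>"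
    using L2_translation_continuous_open[OF U(1) Ufin] by blast
qed

lemma L2_translation_continuous_simple:
  assumes s: "simple_function lborel s" "s \<in> Lp_space lborel 2"
  shows "L2_translation_continuous (s :: 'a::euclidean_space \<Rightarrow> complex)"
proof -
  have fin: "finite (range s)" using s(1) by (simp add: simple_function_def)
  have m: "s -` {y} \<in> sets borel" for y
    using simple_functionD(2)[OF s(1), of "{y}"] by simp
  have "L2_translation_continuous (\<lambda>x. \<Sum>y\<in>range s - {0}. y * indicator (s -` {y}) x)"
  proof (intro L2_translation_continuous_sum L2_translation_continuous_scale L2_translation_continuous_indicator m)
    fix y assume y: "y \<in> range s - {0}"
    \<comment> \<open>Markov's inequality: square integrability gives the level set of a nonzero
      value finite measure.\<close>
    have "ennreal ((norm y)\<^sup>2) * emeasure lborel (s -` {y}) = (\<integral>\<^sup>+x. ennreal ((norm y)\<^sup>2) * indicator (s -` {y}) x \<partial>lborel)"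
      by (rule nn_integral_cmult_indicator[symmetric]) (simp add: m)
    also have "\<dots> \<le> (\<integral>\<^sup>+x. ennreal ((norm (s x))\<^sup>2) \<partial>lborel)"
      by (intro nn_integral_mono) (auto simp: indicator_def)
    also have "\<dots> < \<infinity>" using ennreal_sqnorm[OF s(2)] by simp
    finally show "emeasure lborel (s -` {y}) < \<infinity>"
      using y by (auto simp: ennreal_mult_less_top)
  qed (use fin in auto)
  also have "(\<lambda>x. \<Sum>y\<in>range s - {0}. y * indicator (s -` {y}) x) = s"
  proof
    fix x
    have "(\<Sum>y\<in>range s - {0}. y * indicator (s -` {y}) x) = (\<Sum>y\<in>range s - {0}. if y = s x then y else 0)"
      by (intro sum.cong) (auto simp: indicator_def)
    then show "(\<Sum>y\<in>range s - {0}. y * indicator (s -` {y}) x) = s x"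
      using fin by (simp add: sum.delta)
  qed
  finally show ?thesis .
qed

lemma sqnorm_dominated_convergence:
  assumes f: "f \<in> Lp_space M 2" and s: "\<And>i. s i \<in> borel_measurable M"
    and lim: "AE x in M. (\<lambda>i. s i x) \<longlonglongrightarrow> f x" and b: "\<And>i x. x \<in> space M \<Longrightarrow> norm (s i x) \<le> 2 * norm (f x)"
  shows "(\<lambda>i. sqnorm M (\<lambda>x. s i x - f x)) \<longlonglongrightarrow> 0" "\<And>i. s i \<in> Lp_space M 2"
proof -
  note [measurable] = L2_measurable[OF f] s
  show "s i \<in> Lp_space M 2" for i
  proof (rule L2_bound[OF s])
    show "integrable M (\<lambda>x. 4 * (norm (f x))\<^sup>2)" using L2_integrable[OF f] by simp
    show "AE x in M. (norm (s i x))\<^sup>2 \<le> 4 * (norm (f x))\<^sup>2"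
      using power_mono[OF b norm_ge_zero, of _ i 2] by (intro AE_I2) (simp add: power_mult_distrib)
  qed
  have "(\<lambda>i. \<integral>x. (norm (s i x - f x))\<^sup>2 \<partial>M) \<longlonglongrightarrow> (\<integral>x. 0 \<partial>M)"
  \<comment> \<open>The 9 is \<open>(2 + 1)\<^sup>2\<close>; the factor 2 in the assumption is the
    one that the metric approximation by simple functions delivers.\<close>
  proof (rule integral_dominated_convergence[where w = "\<lambda>x. 9 * (norm (f x))\<^sup>2"])
    show "AE x in M. (\<lambda>i. (norm (s i x - f x))\<^sup>2) \<longlonglongrightarrow> 0"
      using lim
    proof eventually_elim
      case (elim x)
      then have "(\<lambda>i. (norm (s i x - f x))\<^sup>2) \<longlonglongrightarrow> (norm (f x - f x))\<^sup>2" by (intro tendsto_intros)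
      then show ?case by simp
    qed
    show "AE x in M. norm ((norm (s i x - f x))\<^sup>2) \<le> 9 * (norm (f x))\<^sup>2" for i
    proof (rule AE_I2)
      fix x assume "x \<in> space M"
      then have "norm (s i x - f x) \<le> 3 * norm (f x)" using b[of x i] norm_triangle_ineq4[of "s i x" "f x"] by simp
      from power_mono[OF this norm_ge_zero, of 2] show "norm ((norm (s i x - f x))\<^sup>2) \<le> 9 * (norm (f x))\<^sup>2"
        by (simp add: power_mult_distrib)
    qed
  qed (use L2_integrable[OF f] in auto)
  then show "(\<lambda>i. sqnorm M (\<lambda>x. s i x - f x)) \<longlonglongrightarrow> 0" by (simp add: sqnorm_def)
qed

theorem L2_translation_continuous:
  assumes f: "f \<in> Lp_space lborel 2"
  shows "L2_translation_continuous (f :: 'a::euclidean_space \<Rightarrow> complex)"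
proof (rule L2_translation_continuous_limit[OF f])
  fix \<epsilon> :: real assume "\<epsilon> > 0"
  obtain s where s: "\<And>i. simple_function lborel (s i)" "\<And>x. (\<lambda>i. s i x) \<longlonglongrightarrow> f x"
      "\<And>i x. dist (s i x) 0 \<le> 2 * dist (f x) 0"
    using borel_measurable_implies_sequence_metric[OF L2_measurable[OF f], of 0] by auto
  have "(\<lambda>i. sqnorm lborel (\<lambda>x. s i x - f x)) \<longlonglongrightarrow> 0" "\<And>i. s i \<in> Lp_space lborel 2"
    using s by (intro sqnorm_dominated_convergence[OF f] borel_measurable_simple_function; auto)+
  moreover from this(1) have "\<forall>\<^sub>F i in sequentially. sqnorm lborel (\<lambda>x. s i x - f x) < \<epsilon>"
    using \<open>\<epsilon> > 0\<close> by (intro order_tendstoD(2)) auto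
  then obtain i where "sqnorm lborel (\<lambda>x. s i x - f x) < \<epsilon>" by (auto simp: eventually_sequentially)
  ultimately show "\<exists>g. L2_translation_continuous g \<and> sqnorm lborel (\<lambda>x. g x - f x) \<le> \<epsilon>"
    using L2_translation_continuous_simple[OF s(1)[of i]] by (intro exI[of _ "s i"]) auto
qed

section \<open>The Fourier transform on the plane\<close>

lemma borel_measurable_cis [measurable]: "cis \<in> borel_measurable borel"
  by (intro borel_measurable_continuous_onI continuous_intros)

section \<open>Lebesgue measure on the plane in coordinates, and Gaussians\<close>

lemma vector_2_eq: "(vector [x, y] :: real ^ 2) = x *\<^sub>R axis 1 1 + y *\<^sub>R axis 2 1"
  by (simp add: vec_eq_iff forall_2 axis_def)

lemma borel_measurable_vec_nth_real [measurable]: "(\<lambda>x :: real ^ 'n. x $ i) \<in> borel_measurable borel"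
  by (intro borel_measurable_continuous_onI continuous_intros)

definition vec2 :: "real \<times> real \<Rightarrow> real ^ 2" where
  "vec2 = (\<lambda>(x, y). vector [x, y])"

lemma vec2_measurable [measurable]: "vec2 \<in> borel_measurable borel"
  unfolding vec2_def vector_2_eq case_prod_unfold
  by (intro borel_measurable_continuous_onI continuous_intros)

lemma vec2_nth [simp]: "vec2 z $ 1 = fst z" "vec2 z $ 2 = snd z"
  by (simp_all add: vec2_def case_prod_unfold)

lemma vec2_pair [simp]: "vec2 (x $ 1, x $ 2) = x"
  by (simp add: vec_eq_iff forall_2)

lemma inner_R2: "(x :: real ^ 2) \<bullet> y = x $ 1 * y $ 1 + x $ 2 * y $ 2"
  by (simp add: inner_vec_def sum_2)

lemma norm_sq_R2: "(norm (x :: real ^ 2))\<^sup>2 = (x $ 1)\<^sup>2 + (x $ 2)\<^sup>2"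
  unfolding power2_norm_eq_inner inner_R2 by (simp add: power2_eq_square)

text \<open>Both measures agree on boxes, and these determine Lebesgue measure.\<close>

lemma lborel_R2: "lborel = distr (lborel \<Otimes>\<^sub>M lborel) borel vec2"
proof (rule lborel_eqI)
  fix l u :: "real ^ 2" assume le: "\<And>b. b \<in> Basis \<Longrightarrow> l \<bullet> b \<le> u \<bullet> b"
  have B: "(Basis :: (real ^ 2) set) = {axis 1 1, axis 2 1}"
    by (auto simp: Basis_vec_def UNIV_2)
  have ne: "axis 1 1 \<noteq> (axis 2 1 :: real ^ 2)" by (simp add: axis_eq_axis)
  have le': "l $ 1 \<le> u $ 1" "l $ 2 \<le> u $ 2"
    using le[of "axis 1 1"] le[of "axis 2 1"] by (simp_all add: B inner_axis)
  have "vec2 -` box l u = {l $ 1<..<u $ 1} \<times> {l $ 2<..<u $ 2}"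
    by (auto simp: mem_box_cart forall_2)
  then have "emeasure (distr (lborel \<Otimes>\<^sub>M lborel) borel vec2) (box l u) =
      emeasure (lborel \<Otimes>\<^sub>M lborel) ({l $ 1<..<u $ 1} \<times> {l $ 2<..<u $ 2})"
    by (subst emeasure_distr) (simp_all add: lborel_prod)
  also have "\<dots> = ennreal (u $ 1 - l $ 1) * ennreal (u $ 2 - l $ 2)"
    using le' by (subst lborel.emeasure_pair_measure_Times) auto
  also have "\<dots> = ennreal (\<Prod>b\<in>Basis. (u - l) \<bullet> b)"
    using le' ne by (simp add: B inner_axis ennreal_mult)
  finally show "emeasure (distr (lborel \<Otimes>\<^sub>M lborel) borel vec2) (box l u) = ennreal (\<Prod>b\<in>Basis. (u - l) \<bullet> b)" .
qed simp

lemma nn_integral_R2: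
  assumes [measurable]: "f \<in> borel_measurable borel"
  shows "(\<integral>\<^sup>+x. f x \<partial>lborel) = (\<integral>\<^sup>+x. \<integral>\<^sup>+y. f (vec2 (x, y)) \<partial>lborel \<partial>lborel)"
    and "(\<integral>\<^sup>+x. f x \<partial>lborel) = (\<integral>\<^sup>+y. \<integral>\<^sup>+x. f (vec2 (x, y)) \<partial>lborel \<partial>lborel)"
proof -
  have m: "vec2 \<in> (lborel \<Otimes>\<^sub>M lborel) \<rightarrow>\<^sub>M borel" by (simp add: lborel_prod)
  then have m': "(\<lambda>z. f (vec2 z)) \<in> borel_measurable (lborel \<Otimes>\<^sub>M lborel)" by measurable
  have "(\<integral>\<^sup>+x. f x \<partial>lborel) = (\<integral>\<^sup>+z. f (vec2 z) \<partial>(lborel \<Otimes>\<^sub>M lborel))"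
    by (subst lborel_R2) (rule nn_integral_distr[OF m], simp)
  also have "\<dots> = (\<integral>\<^sup>+x. \<integral>\<^sup>+y. f (vec2 (x, y)) \<partial>lborel \<partial>lborel)"
    by (rule lborel.nn_integral_fst[symmetric]) (rule m')
  finally show *: "(\<integral>\<^sup>+x. f x \<partial>lborel) = (\<integral>\<^sup>+x. \<integral>\<^sup>+y. f (vec2 (x, y)) \<partial>lborel \<partial>lborel)" .
  then show "(\<integral>\<^sup>+x. f x \<partial>lborel) = (\<integral>\<^sup>+y. \<integral>\<^sup>+x. f (vec2 (x, y)) \<partial>lborel \<partial>lborel)"
    using lborel_pair.Fubini'[of "\<lambda>x y. f (vec2 (x, y))"] m' by (simp add: case_prod_beta')
qed

lemma
  fixes f g :: "real \<Rightarrow> complex"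
  assumes f: "integrable lborel f" and g: "integrable lborel g"
  shows integrable_tensor_R2: "integrable lborel (\<lambda>x :: real ^ 2. f (x $ 1) * g (x $ 2))"
    and integral_tensor_R2: "(\<integral>x. f (x $ 1) * g (x $ 2) \<partial>(lborel :: (real ^ 2) measure)) = (\<integral>t. f t \<partial>lborel) * (\<integral>t. g t \<partial>lborel)"
proof -
  have [measurable]: "f \<in> borel_measurable borel" "g \<in> borel_measurable borel" using f g by auto
  have m: "vec2 \<in> (lborel \<Otimes>\<^sub>M lborel) \<rightarrow>\<^sub>M borel" by (simp add: lborel_prod)
  have P: "integrable (lborel \<Otimes>\<^sub>M lborel) (\<lambda>(x, y). f x * g y)"
  proof (rule lborel_pair.Fubini_integrable)
    show "(\<lambda>(x, y). f x * g y) \<in> borel_measurable (lborel \<Otimes>\<^sub>M lborel)" by measurable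
    show "integrable lborel (\<lambda>x. \<integral>y. norm (case (x, y) of (x, y) \<Rightarrow> f x * g y) \<partial>lborel)"
      using f by (simp add: norm_mult)
    show "AE x in lborel. integrable lborel (\<lambda>y. case (x, y) of (x, y) \<Rightarrow> f x * g y)" using g by simp
  qed
  have mt: "(\<lambda>x :: real ^ 2. f (x $ 1) * g (x $ 2)) \<in> borel_measurable borel"
    by measurable
  have "integrable (distr (lborel \<Otimes>\<^sub>M lborel) borel vec2) (\<lambda>x :: real ^ 2. f (x $ 1) * g (x $ 2))"
    by (subst integrable_distr_eq[OF m mt]) (use P in \<open>simp add: case_prod_beta'\<close>)
  then show "integrable lborel (\<lambda>x :: real ^ 2. f (x $ 1) * g (x $ 2))"
    using lborel_R2 by simp
  have "(\<integral>x. f (x $ 1) * g (x $ 2) \<partial>(lborel :: (real ^ 2) measure)) = (\<integral>z. f (fst z) * g (snd z) \<partial>(lborel \<Otimes>\<^sub>M lborel))"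
    by (subst lborel_R2, subst integral_distr[OF m mt]) simp
  also have "\<dots> = (\<integral>x. \<integral>y. f x * g y \<partial>lborel \<partial>lborel)"
    using lborel_pair.integral_fst[OF P] by (simp add: case_prod_beta')
  also have "\<dots> = (\<integral>t. f t \<partial>lborel) * (\<integral>t. g t \<partial>lborel)" by simp
  finally show "(\<integral>x. f (x $ 1) * g (x $ 2) \<partial>(lborel :: (real ^ 2) measure)) = (\<integral>t. f t \<partial>lborel) * (\<integral>t. g t \<partial>lborel)" .
qed

text \<open>Up to the factor \<open>sqrt (2 * pi)\<close> this integral is the characteristic
  function of the standard normal distribution.\<close>

lemma
  shows integrable_gauss_1: "integrable lborel (\<lambda>t. of_real (exp (- t\<^sup>2 / 2)) * cis (s * t))"
    and integral_gauss_1: "(\<integral>t. of_real (exp (- t\<^sup>2 / 2)) * cis (s * t) \<partial>lborel) = of_real (sqrt (2 * pi) * exp (- s\<^sup>2 / 2))"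
proof -
  have eq: "of_real (exp (- t\<^sup>2 / 2)) * cis (s * t) = of_real (sqrt (2 * pi)) * (std_normal_density t *\<^sub>R cis (s * t))" for t
    by (simp add: std_normal_density_def scaleR_conv_of_real)
  have "integrable lborel std_normal_density" by simp
  then have "integrable lborel (\<lambda>t. std_normal_density t *\<^sub>R cis (s * t))"
    by (rule Bochner_Integration.integrable_bound) (auto simp: normal_density_nonneg)
  then show "integrable lborel (\<lambda>t. of_real (exp (- t\<^sup>2 / 2)) * cis (s * t))"
    unfolding eq by (rule integrable_mult_right)
  have "of_real (exp (- s\<^sup>2 / 2)) = char std_normal_distribution s"
    by (simp add: char_std_normal_distribution)
  also have "\<dots> = (\<integral>t. std_normal_density t *\<^sub>R cis (s * t) \<partial>lborel)"
    unfolding char_def cis_conv_exp[symmetric]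
    by (subst integral_density) (auto simp: normal_density_nonneg)
  finally show "(\<integral>t. of_real (exp (- t\<^sup>2 / 2)) * cis (s * t) \<partial>lborel) = of_real (sqrt (2 * pi) * exp (- s\<^sup>2 / 2))"
    unfolding eq integral_mult_right_zero by simp
qed

lemma
  fixes w :: "real ^ 2"
  shows integrable_gauss_R2: "integrable lborel (\<lambda>x. of_real (exp (- (norm x)\<^sup>2 / 2)) * cis (w \<bullet> x))"
    and integral_gauss_R2: "(\<integral>x. of_real (exp (- (norm x)\<^sup>2 / 2)) * cis (w \<bullet> x) \<partial>lborel) = of_real (2 * pi * exp (- (norm w)\<^sup>2 / 2))"
proof -
  have eq: "of_real (exp (- (norm x)\<^sup>2 / 2)) * cis (w \<bullet> x) =
      (of_real (exp (- (x $ 1)\<^sup>2 / 2)) * cis (w $ 1 * x $ 1)) * (of_real (exp (- (x $ 2)\<^sup>2 / 2)) * cis (w $ 2 * x $ 2))" for x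
    by (simp add: norm_sq_R2 inner_R2 exp_add[symmetric] cis_mult[symmetric] of_real_mult[symmetric] add_divide_distrib
        del: of_real_mult of_real_exp)
  show "integrable lborel (\<lambda>x. of_real (exp (- (norm x)\<^sup>2 / 2)) * cis (w \<bullet> x))"
    unfolding eq by (intro integrable_tensor_R2 integrable_gauss_1)
  have "exp (- (w $ 1)\<^sup>2 / 2) * exp (- (w $ 2)\<^sup>2 / 2) = exp (- (norm w)\<^sup>2 / 2)"
    by (simp add: norm_sq_R2 exp_add[symmetric] add_divide_distrib)
  then have "(sqrt (2 * pi) * exp (- (w $ 1)\<^sup>2 / 2)) * (sqrt (2 * pi) * exp (- (w $ 2)\<^sup>2 / 2)) = 2 * pi * exp (- (norm w)\<^sup>2 / 2)"
    by (simp add: algebra_simps)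
  then show "(\<integral>x. of_real (exp (- (norm x)\<^sup>2 / 2)) * cis (w \<bullet> x) \<partial>lborel) = of_real (2 * pi * exp (- (norm w)\<^sup>2 / 2))"
    unfolding eq integral_tensor_R2[OF integrable_gauss_1 integrable_gauss_1] integral_gauss_1
    by (simp only: of_real_mult[symmetric])
qed

text \<open>The convention has no \<open>2 * pi\<close> in the exponent and no normalization, so in
  the plane Plancherel's theorem carries the factor \<open>4 * pi\<^sup>2\<close>.\<close>

definition ft :: "('a::euclidean_space \<Rightarrow> complex) \<Rightarrow> 'a \<Rightarrow> complex" where
  "ft f \<xi> = (\<integral>x. f x * cis (- (x \<bullet> \<xi>)) \<partial>lborel)"

text \<open>For fixed dilation and shear the shearlet transform is a cross-correlation in the
  translation parameter. The conjugation here becomes the conjugate of the transform of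
  \<open>g\<close>.\<close>

definition cross_correlation :: "('a::euclidean_space \<Rightarrow> complex) \<Rightarrow> ('a \<Rightarrow> complex) \<Rightarrow> 'a \<Rightarrow> complex" where
  "cross_correlation f g t = (\<integral>x. f x * cnj (g (x - t)) \<partial>lborel)"

lemma integrable_mult_cis:
  assumes "integrable lborel (f :: 'a::euclidean_space \<Rightarrow> complex)"
  shows "integrable lborel (\<lambda>x. f x * cis (- (x \<bullet> \<xi>)))"
  using assms by (rule Bochner_Integration.integrable_bound) (use assms in \<open>auto simp: norm_mult\<close>)

lemma norm_ft_le: "norm (ft f \<xi>) \<le> (\<integral>x. norm (f x) \<partial>lborel)"
  unfolding ft_def using integral_norm_bound[of lborel "\<lambda>x. f x * cis (- (x \<bullet> \<xi>))"] by (simp add: norm_mult)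

lemma ft_measurable [measurable]:
  assumes [measurable]: "f \<in> borel_measurable (borel :: 'a::euclidean_space measure)"
  shows "ft f \<in> borel_measurable borel"
proof -
  have "(\<lambda>(\<xi>, x). f x * cis (- (x \<bullet> \<xi>))) \<in> borel_measurable (borel \<Otimes>\<^sub>M (lborel :: 'a measure))" by measurable
  then show ?thesis unfolding ft_def by (rule lborel.borel_measurable_lebesgue_integral)
qed

lemma cross_correlation_measurable:
  assumes [measurable]: "f \<in> borel_measurable (borel :: 'a::euclidean_space measure)" "g \<in> borel_measurable borel"
  shows "cross_correlation f g \<in> borel_measurable borel"
proof -
  have "(\<lambda>(t, x). f x * cnj (g (x - t))) \<in> borel_measurable (borel \<Otimes>\<^sub>M (lborel :: 'a measure))" by measurable
  then show ?thesis unfolding cross_correlation_def by (rule lborel.borel_measurable_lebesgue_integral)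
qed

lemma
  assumes f: "integrable lborel (f :: 'a::euclidean_space \<Rightarrow> complex)" and g: "integrable lborel g"
  shows integrable_cross_correlation: "integrable lborel (cross_correlation f g)"
    and ft_cross_correlation: "ft (cross_correlation f g) \<xi> = ft f \<xi> * cnj (ft g \<xi>)"
proof -
  have [measurable]: "f \<in> borel_measurable borel" "g \<in> borel_measurable borel" using f g by auto
  have refl: "integrable lborel (\<lambda>t. G (x - t))" "(\<integral>t. G (x - t) \<partial>lborel) = (\<integral>y. G y \<partial>lborel)"
    if "integrable lborel G" for G :: "'a \<Rightarrow> 'b::{banach, second_countable_topology}" and x
    using lborel_integrable_affine[of "-1" G x] lborel_integral_affine[of "-1" G x] that by simp_all
  have P: "integrable (lborel \<Otimes>\<^sub>M lborel) (\<lambda>(x, t). f x * cnj (g (x - t)))"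
  proof (rule lborel_pair.Fubini_integrable)
    show "(\<lambda>(x, t). f x * cnj (g (x - t))) \<in> borel_measurable (lborel \<Otimes>\<^sub>M lborel)" by measurable
    have "(\<integral>t. norm (g (x - t)) \<partial>lborel) = (\<integral>y. norm (g y) \<partial>lborel)" for x
      using refl(2)[of "\<lambda>y. norm (g y)" x] g by simp
    then show "integrable lborel (\<lambda>x. \<integral>t. norm (case (x, t) of (x, t) \<Rightarrow> f x * cnj (g (x - t))) \<partial>lborel)"
      using f by (simp add: norm_mult)
    show "AE x in lborel. integrable lborel (\<lambda>t. case (x, t) of (x, t) \<Rightarrow> f x * cnj (g (x - t)))"
      using refl(1)[OF g] by simp
  qed
  show "integrable lborel (cross_correlation f g)"
    using lborel_pair.integrable_snd[OF P] by (simp add: cross_correlation_def[abs_def])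
  have P': "integrable (lborel \<Otimes>\<^sub>M lborel) (\<lambda>(x, t). f x * cnj (g (x - t)) * cis (- (t \<bullet> \<xi>)))"
    by (rule Bochner_Integration.integrable_bound[OF P]) (auto simp: norm_mult)
  have "ft (cross_correlation f g) \<xi> = (\<integral>t. \<integral>x. f x * cnj (g (x - t)) * cis (- (t \<bullet> \<xi>)) \<partial>lborel \<partial>lborel)"
    by (simp add: ft_def cross_correlation_def)
  also have "\<dots> = (\<integral>x. \<integral>t. f x * cnj (g (x - t)) * cis (- (t \<bullet> \<xi>)) \<partial>lborel \<partial>lborel)"
    by (rule lborel_pair.Fubini_integral[OF P'])
  also have "\<dots> = (\<integral>x. (f x * cis (- (x \<bullet> \<xi>))) * cnj (ft g \<xi>) \<partial>lborel)"
  proof (rule Bochner_Integration.integral_cong[OF HOL.refl])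
    fix x
    \<comment> \<open>The character at \<open>t\<close> factors into that at \<open>x\<close> and
      the conjugate of that at \<open>x - t\<close>; reflection then turns the inner integral into
      the transform of \<open>g\<close>.\<close>
    have shift: "f x * cnj (g (x - t)) * cis (- (t \<bullet> \<xi>)) = (f x * cis (- (x \<bullet> \<xi>))) * cnj (g (x - t) * cis (- ((x - t) \<bullet> \<xi>)))" for t
      by (simp add: cis_cnj cis_mult inner_diff_left mult_ac)
    have "(\<integral>t. f x * cnj (g (x - t)) * cis (- (t \<bullet> \<xi>)) \<partial>lborel) =
        (f x * cis (- (x \<bullet> \<xi>))) * cnj (\<integral>t. g (x - t) * cis (- ((x - t) \<bullet> \<xi>)) \<partial>lborel)"
      unfolding shift integral_mult_right_zero Bochner_Integration.integral_cnj ..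
    also have "(\<integral>t. g (x - t) * cis (- ((x - t) \<bullet> \<xi>)) \<partial>lborel) = ft g \<xi>"
      unfolding ft_def using refl(2)[OF integrable_mult_cis[OF g]] .
    finally show "(\<integral>t. f x * cnj (g (x - t)) * cis (- (t \<bullet> \<xi>)) \<partial>lborel) = (f x * cis (- (x \<bullet> \<xi>))) * cnj (ft g \<xi>)" .
  qed
  also have "\<dots> = ft f \<xi> * cnj (ft g \<xi>)" by (simp add: ft_def)
  finally show "ft (cross_correlation f g) \<xi> = ft f \<xi> * cnj (ft g \<xi>)" .
qed

text \<open>Dilation of the unit Gaussian by \<open>e\<close>; the Jacobian in the plane is
  \<open>e\<^sup>2\<close>.\<close>

lemma ft_gauss_scaled:
  fixes t :: "real ^ 2"
  assumes e: "e > 0"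
  shows "integrable lborel (\<lambda>\<xi>. of_real (exp (- (e\<^sup>2 * (norm \<xi>)\<^sup>2) / 2)) * cis (- (t \<bullet> \<xi>)))"
    and "(\<integral>\<xi>. of_real (exp (- (e\<^sup>2 * (norm \<xi>)\<^sup>2) / 2)) * cis (- (t \<bullet> \<xi>)) \<partial>lborel) =
      of_real (2 * pi / e\<^sup>2 * exp (- ((norm t)\<^sup>2 / e\<^sup>2) / 2))"
proof -
  let ?w = "- (1 / e) *\<^sub>R t"
  let ?G = "\<lambda>x. of_real (exp (- (norm x)\<^sup>2 / 2)) * cis (?w \<bullet> x)"
  have eq: "of_real (exp (- (e\<^sup>2 * (norm \<xi>)\<^sup>2) / 2)) * cis (- (t \<bullet> \<xi>)) = ?G (0 + e *\<^sub>R \<xi>)" for \<xi>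
    using e by (simp add: power_mult_distrib)
  show "integrable lborel (\<lambda>\<xi>. of_real (exp (- (e\<^sup>2 * (norm \<xi>)\<^sup>2) / 2)) * cis (- (t \<bullet> \<xi>)))"
    unfolding eq using e by (intro lborel_integrable_affine integrable_gauss_R2) simp
  have "(\<integral>x. ?G x \<partial>lborel) = \<bar>e\<bar> ^ DIM(real ^ 2) *\<^sub>R (\<integral>\<xi>. ?G (0 + e *\<^sub>R \<xi>) \<partial>lborel)"
    using e by (intro lborel_integral_affine integrable_gauss_R2) simp
  moreover have "norm ?w ^ 2 = (norm t)\<^sup>2 / e\<^sup>2" using e by (simp add: power_divide)
  ultimately have "of_real (e\<^sup>2) * (\<integral>\<xi>. ?G (0 + e *\<^sub>R \<xi>) \<partial>lborel) = of_real (2 * pi * exp (- ((norm t)\<^sup>2 / e\<^sup>2) / 2))"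
    unfolding integral_gauss_R2 by (simp add: scaleR_conv_of_real)
  then have "(\<integral>\<xi>. ?G (0 + e *\<^sub>R \<xi>) \<partial>lborel) = of_real (2 * pi * exp (- ((norm t)\<^sup>2 / e\<^sup>2) / 2)) / of_real (e\<^sup>2)"
    using e by (simp add: field_simps)
  then show "(\<integral>\<xi>. of_real (exp (- (e\<^sup>2 * (norm \<xi>)\<^sup>2) / 2)) * cis (- (t \<bullet> \<xi>)) \<partial>lborel) =
      of_real (2 * pi / e\<^sup>2 * exp (- ((norm t)\<^sup>2 / e\<^sup>2) / 2))"
    unfolding eq by simp
qed

text \<open>Fubini moves the transform from \<open>c\<close> to the Gaussian, whose transform
  concentrates at scale \<open>e\<close>. Substituting \<open>t = e *\<^sub>R w\<close> then fixes
  the Gaussian and rescales the argument of \<open>c\<close>.\<close>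

lemma integral_ft_gauss:
  fixes c :: "real ^ 2 \<Rightarrow> complex"
  assumes c: "integrable lborel c" and e: "e > 0"
  shows "(\<integral>\<xi>. of_real (exp (- (e\<^sup>2 * (norm \<xi>)\<^sup>2) / 2)) * ft c \<xi> \<partial>lborel) =
    of_real (2 * pi) * (\<integral>w. of_real (exp (- (norm w)\<^sup>2 / 2)) * c (e *\<^sub>R w) \<partial>lborel)"
proof -
  let ?g = "\<lambda>\<xi> :: real ^ 2. exp (- (e\<^sup>2 * (norm \<xi>)\<^sup>2) / 2)"
  have [measurable]: "c \<in> borel_measurable borel" using c by auto
  have g: "integrable lborel (\<lambda>\<xi>. of_real (?g \<xi>) :: complex)"
    using ft_gauss_scaled(1)[OF e, of 0] by simp
  have P: "integrable (lborel \<Otimes>\<^sub>M lborel) (\<lambda>(\<xi>, t). of_real (?g \<xi>) * (c t * cis (- (t \<bullet> \<xi>))))"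
  proof (rule lborel_pair.Fubini_integrable)
    show "(\<lambda>(\<xi>, t). of_real (?g \<xi>) * (c t * cis (- (t \<bullet> \<xi>)))) \<in> borel_measurable (lborel \<Otimes>\<^sub>M lborel)"
      by measurable
    have "integrable lborel (\<lambda>\<xi>. norm (of_real (?g \<xi>) :: complex) * (\<integral>t. norm (c t) \<partial>lborel))"
      using g by (intro integrable_mult_left integrable_norm)
    then show "integrable lborel (\<lambda>\<xi>. \<integral>t. norm (case (\<xi>, t) of (\<xi>, t) \<Rightarrow> of_real (?g \<xi>) * (c t * cis (- (t \<bullet> \<xi>)))) \<partial>lborel)"
      by (simp add: norm_mult)
    show "AE \<xi> in lborel. integrable lborel (\<lambda>t. case (\<xi>, t) of (\<xi>, t) \<Rightarrow> of_real (?g \<xi>) * (c t * cis (- (t \<bullet> \<xi>))))"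
      using integrable_mult_cis[OF c] by simp
  qed
  have "(\<integral>\<xi>. of_real (?g \<xi>) * ft c \<xi> \<partial>lborel) = (\<integral>\<xi>. \<integral>t. of_real (?g \<xi>) * (c t * cis (- (t \<bullet> \<xi>))) \<partial>lborel \<partial>lborel)"
    by (simp add: ft_def)
  also have "\<dots> = (\<integral>t. \<integral>\<xi>. of_real (?g \<xi>) * (c t * cis (- (t \<bullet> \<xi>))) \<partial>lborel \<partial>lborel)"
    by (rule lborel_pair.Fubini_integral[OF P, symmetric])
  also have "\<dots> = (\<integral>t. c t * of_real (2 * pi / e\<^sup>2 * exp (- ((norm t)\<^sup>2 / e\<^sup>2) / 2)) \<partial>lborel)"
    unfolding ft_gauss_scaled(2)[OF e, symmetric]
    by (simp add: mult.left_commute[of "of_real _" "c _"])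
  also have "\<dots> = \<bar>e\<bar> ^ DIM(real ^ 2) *\<^sub>R (\<integral>w. c (0 + e *\<^sub>R w) * of_real (2 * pi / e\<^sup>2 * exp (- ((norm (0 + e *\<^sub>R w))\<^sup>2 / e\<^sup>2) / 2)) \<partial>lborel)"
  proof (rule lborel_integral_affine)
    show "integrable lborel (\<lambda>t. c t * of_real (2 * pi / e\<^sup>2 * exp (- ((norm t)\<^sup>2 / e\<^sup>2) / 2)))"
    proof (rule Bochner_Integration.integrable_bound[where f = "\<lambda>t. of_real (2 * pi / e\<^sup>2) * c t"])
      show "AE t in lborel. norm (c t * of_real (2 * pi / e\<^sup>2 * exp (- ((norm t)\<^sup>2 / e\<^sup>2) / 2))) \<le> norm (of_real (2 * pi / e\<^sup>2) * c t)"
      proof (rule AE_I2)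
        fix t :: "real ^ 2"
        have "norm (c t) * (2 * pi / e\<^sup>2) * exp (- ((norm t)\<^sup>2 / e\<^sup>2) / 2) \<le> norm (c t) * (2 * pi / e\<^sup>2) * 1"
          by (intro mult_left_mono) auto
        then show "norm (c t * of_real (2 * pi / e\<^sup>2 * exp (- ((norm t)\<^sup>2 / e\<^sup>2) / 2))) \<le> norm (of_real (2 * pi / e\<^sup>2) * c t)"
          by (simp add: norm_mult norm_divide norm_power mult_ac)
      qed
    qed (use c in auto)
  qed (use e in simp)
  also have "\<dots> = of_real (2 * pi) * (\<integral>w. of_real (exp (- (norm w)\<^sup>2 / 2)) * c (e *\<^sub>R w) \<partial>lborel)"
  proof -
    have scale: "c (0 + e *\<^sub>R w) * of_real (2 * pi / e\<^sup>2 * exp (- ((norm (0 + e *\<^sub>R w))\<^sup>2 / e\<^sup>2) / 2)) =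
      of_real (2 * pi / e\<^sup>2) * (of_real (exp (- (norm w)\<^sup>2 / 2)) * c (e *\<^sub>R w))" for w
      using e by (simp add: power_mult_distrib)
    show ?thesis unfolding scale integral_mult_right_zero using e by (simp add: scaleR_conv_of_real)
  qed
  finally show ?thesis .
qed

text \<open>The limit is the value at shift zero; continuity of translations and the Cauchy-Schwarz
  inequality control the difference.\<close>

lemma autocorrelation_tendsto:
  assumes f: "f \<in> Lp_space lborel 2" and z: "z \<longlonglongrightarrow> 0"
  shows "(\<lambda>k. cross_correlation f f (z k)) \<longlonglongrightarrow> of_real (sqnorm lborel f)"
proof -
  have 0: "(\<lambda>k. - z k) \<longlonglongrightarrow> 0" using tendsto_minus[OF z] by simp
  have sq: "of_real (sqnorm lborel f) = (\<integral>x. f x * cnj (f x) \<partial>lborel)"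
    by (simp add: sqnorm_def complex_norm_square[symmetric] of_real_power[symmetric] del: of_real_power)
  have tr: "(\<lambda>x. f (x - w)) \<in> Lp_space lborel 2" for w using L2_translate(1)[OF f, of "- w"] by simp
  have "(norm (cross_correlation f f (z k) - of_real (sqnorm lborel f)))\<^sup>2 \<le>
      sqnorm lborel f * sqnorm lborel (\<lambda>x. f (x + - z k) - f x)" for k
  proof -
    have "cross_correlation f f (z k) - of_real (sqnorm lborel f) = (\<integral>x. f x * cnj (f (x - z k) - f x) \<partial>lborel)"
      unfolding sq cross_correlation_def using L2_mult_integrable[OF f tr[of "z k"]] L2_mult_integrable[OF f f]
      by (simp add: right_diff_distrib)
    then show ?thesis using L2_Cauchy_Schwarz[OF f L2_diff[OF tr[of "z k"] f]] by simp
  qed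
  moreover have "(\<lambda>k. sqnorm lborel f * sqnorm lborel (\<lambda>x. f (x + - z k) - f x)) \<longlonglongrightarrow> 0"
    by (intro tendsto_mult_right_zero L2_translation_continuousD(2)[OF L2_translation_continuous[OF f] 0])
  ultimately show ?thesis by (rule tendsto_of_norm_sq_le)
qed

lemma norm_cross_correlation_le:
  assumes f: "f \<in> Lp_space lborel 2" and g: "g \<in> Lp_space lborel 2"
  shows "(norm (cross_correlation f g t))\<^sup>2 \<le> sqnorm lborel f * sqnorm lborel g"
  using L2_Cauchy_Schwarz[OF f L2_translate(1)[OF g, of "- t"]] L2_translate(2)[OF g, of "- t"]
  by (simp add: cross_correlation_def)

text \<open>Inserting the Gaussian \<open>exp (- e\<^sup>2 * \<bar>\<xi>\<bar>\<^sup>2 / 2)\<close> turns the left-hand side into an average of the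
  autocorrelation of \<open>f\<close> at scale \<open>e\<close>; let \<open>e\<close> tend to zero.\<close>

theorem Plancherel:
  fixes f :: "real ^ 2 \<Rightarrow> complex"
  assumes f1: "integrable lborel f" and f2: "f \<in> Lp_space lborel 2"
  shows "ft f \<in> Lp_space lborel 2" and "sqnorm lborel (ft f) = 4 * pi\<^sup>2 * sqnorm lborel f"
proof -
  have [measurable]: "f \<in> borel_measurable borel" using f1 by auto
  define c where "c = cross_correlation f f"
  have c1: "integrable lborel c" unfolding c_def by (rule integrable_cross_correlation[OF f1 f1])
  have [measurable]: "c \<in> borel_measurable borel" using c1 by auto
  \<comment> \<open>The transform of the autocorrelation is the squared modulus whose integral is
    sought.\<close>
  have ftc: "ft c \<xi> = of_real ((norm (ft f \<xi>))\<^sup>2)" for \<xi>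
    unfolding c_def ft_cross_correlation[OF f1 f1] by (simp add: complex_norm_square[symmetric])
  define e where "e n = inverse (real (Suc n))" for n
  have e: "e n > 0" for n by (simp add: e_def)
  have e0: "e \<longlonglongrightarrow> 0" unfolding e_def by (rule LIMSEQ_inverse_real_of_nat)
  define g where "g n \<xi> = exp (- ((e n)\<^sup>2 * (norm \<xi>)\<^sup>2) / 2)" for n and \<xi> :: "real ^ 2"
  have g_meas [measurable]: "g n \<in> borel_measurable borel" for n unfolding g_def by measurable
  have g_int: "integrable lborel (g n)" for n
    using integrable_norm[OF ft_gauss_scaled(1)[OF e[of n], of 0]] by (simp add: g_def[abs_def])
  define K where "K = (\<integral>x. norm (f x) \<partial>lborel)"
  have "integrable lborel (\<lambda>\<xi>. K\<^sup>2 * g n \<xi>)" for n using g_int by simp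
  then have I: "integrable lborel (\<lambda>\<xi>. g n \<xi> * (norm (ft f \<xi>))\<^sup>2)" for n
  proof (rule Bochner_Integration.integrable_bound)
    show "AE \<xi> in lborel. norm (g n \<xi> * (norm (ft f \<xi>))\<^sup>2) \<le> norm (K\<^sup>2 * g n \<xi>)"
    proof (rule AE_I2)
      fix \<xi>
      have "(norm (ft f \<xi>))\<^sup>2 \<le> K\<^sup>2" unfolding K_def by (intro power_mono norm_ft_le) auto
      then have "g n \<xi> * (norm (ft f \<xi>))\<^sup>2 \<le> g n \<xi> * K\<^sup>2" by (intro mult_left_mono) (auto simp: g_def)
      then show "norm (g n \<xi> * (norm (ft f \<xi>))\<^sup>2) \<le> norm (K\<^sup>2 * g n \<xi>)"
        by (simp add: g_def abs_mult mult.commute)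
    qed
  qed measurable
  have Ieq: "of_real (\<integral>\<xi>. g n \<xi> * (norm (ft f \<xi>))\<^sup>2 \<partial>lborel) =
      of_real (2 * pi) * (\<integral>w. of_real (exp (- (norm w)\<^sup>2 / 2)) * c (e n *\<^sub>R w) \<partial>lborel)" for n
    unfolding integral_ft_gauss[OF c1 e, symmetric] ftc g_def by (simp flip: integral_complex_of_real)
  have gauss0: "integrable lborel (\<lambda>w :: real ^ 2. of_real (exp (- (norm w)\<^sup>2 / 2)) :: complex)"
      "(\<integral>w. of_real (exp (- (norm w)\<^sup>2 / 2)) \<partial>(lborel :: (real ^ 2) measure)) = (of_real (2 * pi) :: complex)"
    using integrable_gauss_R2[of 0] integral_gauss_R2[of 0] by simp_all
  have "(\<lambda>n. \<integral>w. of_real (exp (- (norm w)\<^sup>2 / 2)) * c (e n *\<^sub>R w) \<partial>lborel) \<longlonglongrightarrow>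
      (\<integral>w. of_real (exp (- (norm w)\<^sup>2 / 2)) * of_real (sqnorm lborel f) \<partial>(lborel :: (real ^ 2) measure))"
  \<comment> \<open>The autocorrelation is nowhere larger in modulus than
    \<open>sqnorm lborel f\<close>, which provides a Gaussian majorant.\<close>
  proof (rule integral_dominated_convergence[where w = "\<lambda>w :: real ^ 2. exp (- (norm w)\<^sup>2 / 2) * sqnorm lborel f"])
    show "AE w in lborel. (\<lambda>n. of_real (exp (- (norm w)\<^sup>2 / 2)) * c (e n *\<^sub>R w)) \<longlonglongrightarrow>
        of_real (exp (- (norm w)\<^sup>2 / 2)) * of_real (sqnorm lborel f)"
    proof (rule AE_I2)
      fix w :: "real ^ 2"
      have "(\<lambda>n. e n *\<^sub>R w) \<longlonglongrightarrow> 0 *\<^sub>R w" by (intro tendsto_intros e0)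
      then have "(\<lambda>n. c (e n *\<^sub>R w)) \<longlonglongrightarrow> of_real (sqnorm lborel f)"
        unfolding c_def by (intro autocorrelation_tendsto[OF f2]) simp
      then show "(\<lambda>n. of_real (exp (- (norm w)\<^sup>2 / 2)) * c (e n *\<^sub>R w)) \<longlonglongrightarrow>
          of_real (exp (- (norm w)\<^sup>2 / 2)) * of_real (sqnorm lborel f)"
        by (intro tendsto_mult tendsto_const)
    qed
    have "norm (c t) \<le> sqnorm lborel f" for t
    proof (rule power2_le_imp_le)
      show "(norm (c t))\<^sup>2 \<le> (sqnorm lborel f)\<^sup>2"
        using norm_cross_correlation_le[OF f2 f2, of t] unfolding c_def by (simp add: power2_eq_square)
    qed simp
    then show "AE w in lborel. norm (of_real (exp (- (norm w)\<^sup>2 / 2)) * c (e n *\<^sub>R w)) \<le> exp (- (norm w)\<^sup>2 / 2) * sqnorm lborel f" for n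
      by (intro AE_I2) (auto simp: norm_mult intro!: mult_left_mono)
    show "integrable lborel (\<lambda>w :: real ^ 2. exp (- (norm w)\<^sup>2 / 2) * sqnorm lborel f)"
      using integrable_norm[OF gauss0(1)] by (intro integrable_mult_left) simp
  qed measurable
  then have "(\<lambda>n. of_real (2 * pi) * (\<integral>w. of_real (exp (- (norm w)\<^sup>2 / 2)) * c (e n *\<^sub>R w) \<partial>lborel)) \<longlonglongrightarrow>
      of_real (2 * pi) * (of_real (2 * pi) * of_real (sqnorm lborel f))"
    using gauss0(2) by (intro tendsto_mult tendsto_const) simp
  then have "(\<lambda>n. of_real (\<integral>\<xi>. g n \<xi> * (norm (ft f \<xi>))\<^sup>2 \<partial>lborel) :: complex) \<longlonglongrightarrow>
      of_real (4 * pi\<^sup>2 * sqnorm lborel f)"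
    unfolding Ieq by (simp add: power2_eq_square mult_ac)
  then have lim1: "(\<lambda>n. \<integral>\<xi>. g n \<xi> * (norm (ft f \<xi>))\<^sup>2 \<partial>lborel) \<longlonglongrightarrow> 4 * pi\<^sup>2 * sqnorm lborel f"
    by (simp only: tendsto_of_real_iff)
  \<comment> \<open>The same integrals a second time, now by monotone convergence, as the Gaussians
    increase to 1. Integrability of the squared modulus of \<open>ft f\<close> is a consequence of
    comparing the two limits.\<close>
  have lim2: "(\<lambda>n. \<integral>\<^sup>+\<xi>. ennreal (g n \<xi> * (norm (ft f \<xi>))\<^sup>2) \<partial>lborel) \<longlonglongrightarrow> (\<integral>\<^sup>+\<xi>. ennreal ((norm (ft f \<xi>))\<^sup>2) \<partial>lborel)"
  proof (rule nn_integral_LIMSEQ)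
    show "incseq (\<lambda>n \<xi>. ennreal (g n \<xi> * (norm (ft f \<xi>))\<^sup>2))"
      unfolding incseq_def le_fun_def
    proof (intro allI impI ennreal_leI mult_right_mono)
      fix m n :: nat and \<xi> :: "real ^ 2" assume "m \<le> n"
      then have "e n \<le> e m" unfolding e_def by (intro le_imp_inverse_le) auto
      then have "(e n)\<^sup>2 * (norm \<xi>)\<^sup>2 \<le> (e m)\<^sup>2 * (norm \<xi>)\<^sup>2"
        using e[of n] by (intro mult_right_mono power_mono) auto
      then show "g m \<xi> \<le> g n \<xi>" by (simp add: g_def)
    qed simp
    show "(\<lambda>n. ennreal (g n \<xi> * (norm (ft f \<xi>))\<^sup>2)) \<longlonglongrightarrow> ennreal ((norm (ft f \<xi>))\<^sup>2)" for \<xi>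
    proof (rule tendsto_ennrealI)
      have "(\<lambda>n. g n \<xi>) \<longlonglongrightarrow> exp (- (0\<^sup>2 * (norm \<xi>)\<^sup>2) / 2)" unfolding g_def by (intro tendsto_intros e0) simp
      then have "(\<lambda>n. g n \<xi> * (norm (ft f \<xi>))\<^sup>2) \<longlonglongrightarrow> exp (- (0\<^sup>2 * (norm \<xi>)\<^sup>2) / 2) * (norm (ft f \<xi>))\<^sup>2"
        by (intro tendsto_mult tendsto_const)
      then show "(\<lambda>n. g n \<xi> * (norm (ft f \<xi>))\<^sup>2) \<longlonglongrightarrow> (norm (ft f \<xi>))\<^sup>2" by simp
    qed
  qed measurable
  have "(\<integral>\<^sup>+\<xi>. ennreal (g n \<xi> * (norm (ft f \<xi>))\<^sup>2) \<partial>lborel) = ennreal (\<integral>\<xi>. g n \<xi> * (norm (ft f \<xi>))\<^sup>2 \<partial>lborel)" for n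
    using I by (intro nn_integral_eq_integral) (auto simp: g_def)
  then have "(\<integral>\<^sup>+\<xi>. ennreal ((norm (ft f \<xi>))\<^sup>2) \<partial>lborel) = ennreal (4 * pi\<^sup>2 * sqnorm lborel f)"
    using lim2 tendsto_ennrealI[OF lim1] by (intro LIMSEQ_unique[OF lim2]) simp
  moreover from this show "ft f \<in> Lp_space lborel 2" by (intro L2_I_nn) auto
  ultimately show "sqnorm lborel (ft f) = 4 * pi\<^sup>2 * sqnorm lborel f"
    using ennreal_sqnorm[of "ft f" lborel] by simp
qed

text \<open>Expanding the square of \<open>f + (F k - f)\<close> leaves a cross term that the
  Cauchy-Schwarz inequality sends to zero.\<close>

lemma sqnorm_tendsto_of_diff:
  assumes F: "\<And>k. F k \<in> Lp_space M 2" and f: "f \<in> Lp_space M 2"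
    and lim: "(\<lambda>k. sqnorm M (\<lambda>x. F k x - f x)) \<longlonglongrightarrow> 0"
  shows "(\<lambda>k. sqnorm M (F k)) \<longlonglongrightarrow> sqnorm M f"
proof -
  let ?D = "\<lambda>k x. F k x - f x"
  let ?I = "\<lambda>k. \<integral>x. ?D k x * cnj (f x) \<partial>M"
  have D: "?D k \<in> Lp_space M 2" for k by (intro L2_diff F f)
  have pt: "(norm (a + b :: complex))\<^sup>2 = (norm b)\<^sup>2 + 2 * Re (a * cnj b) + (norm a)\<^sup>2" for a b
    unfolding cmod_power2 by (simp add: power2_eq_square algebra_simps)
  have eq: "sqnorm M (F k) = sqnorm M f + 2 * Re (?I k) + sqnorm M (?D k)" for k
  proof -
    have "sqnorm M (F k) = (\<integral>x. (norm (f x))\<^sup>2 + 2 * Re (?D k x * cnj (f x)) + (norm (?D k x))\<^sup>2 \<partial>M)"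
      unfolding sqnorm_def pt[symmetric] by simp
    also have "\<dots> = sqnorm M f + 2 * (\<integral>x. Re (?D k x * cnj (f x)) \<partial>M) + sqnorm M (?D k)"
    proof -
      have "integrable M (\<lambda>x. 2 * Re (?D k x * cnj (f x)))"
        using L2_mult_integrable[OF D f, of k] by (intro integrable_mult_right integrable_Re)
      then show ?thesis
        unfolding sqnorm_def using L2_integrable[OF f] L2_integrable[OF D, of k]
        by (simp del: times_complex.sel minus_complex.sel)
    qed
    also have "(\<integral>x. Re (?D k x * cnj (f x)) \<partial>M) = Re (?I k)"
      by (rule integral_Re[OF L2_mult_integrable[OF D f]])
    finally show ?thesis .
  qed
  have "?I \<longlonglongrightarrow> 0"
    by (rule tendsto_of_norm_sq_le[OF _ tendsto_mult_left_zero[OF lim]])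
       (use L2_Cauchy_Schwarz[OF D f] in simp)
  then have "(\<lambda>k. sqnorm M f + 2 * Re (?I k) + sqnorm M (?D k)) \<longlonglongrightarrow> sqnorm M f + 2 * Re 0 + 0"
    by (intro tendsto_add tendsto_const tendsto_mult tendsto_Re lim)
  then show ?thesis unfolding eq by simp
qed

text \<open>Young's inequality for correlations: Cauchy-Schwarz with weight
  \<open>norm (\<phi> (x - t))\<close> for each \<open>t\<close>, followed by Tonelli's
  theorem.\<close>

lemma cross_correlation_L2:
  fixes h \<phi> :: "'a::euclidean_space \<Rightarrow> complex"
  assumes h: "h \<in> Lp_space lborel 2" and \<phi>: "integrable lborel \<phi>"
  shows "cross_correlation h \<phi> \<in> Lp_space lborel 2"
    and "sqnorm lborel (cross_correlation h \<phi>) \<le> (\<integral>x. norm (\<phi> x) \<partial>lborel)\<^sup>2 * sqnorm lborel h"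
proof -
  have [measurable]: "h \<in> borel_measurable borel" "\<phi> \<in> borel_measurable borel"
    using L2_measurable[OF h] \<phi> by auto
  define K where "K = (\<integral>x. norm (\<phi> x) \<partial>lborel)"
  have K: "0 \<le> K" by (simp add: K_def)
  have refl: "integrable lborel (\<lambda>x. norm (\<phi> (x - t)))" "(\<integral>x. norm (\<phi> (x - t)) \<partial>lborel) = K" for t
    using lborel_integrable_affine[of 1 "\<lambda>x. norm (\<phi> x)" "- t"] lborel_integral_affine[of 1 "\<lambda>x. norm (\<phi> x)" "- t"]
      integrable_norm[OF \<phi>] by (simp_all add: K_def)
  have pointwise: "ennreal ((norm (cross_correlation h \<phi> t))\<^sup>2) \<le>
      ennreal K * (\<integral>\<^sup>+x. ennreal ((norm (h x))\<^sup>2 * norm (\<phi> (x - t))) \<partial>lborel)" (is "_ \<le> _ * ?J t") for t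
  \<comment> \<open>An infinite \<open>?J t\<close> makes the bound trivial unless
    \<open>K = 0\<close>, where infinity times zero is zero. In that case \<open>\<phi>\<close>
    vanishes almost everywhere and so does the correlation.\<close>
  proof (cases "?J t = \<infinity> \<and> K \<noteq> 0")
    case True
    then show ?thesis using K by (simp add: ennreal_mult_eq_top_iff)
  next
    case False
    show ?thesis
    proof (cases "K = 0")
      case True
      then have "AE x in lborel. norm (\<phi> (x - t)) = 0"
        using integral_nonneg_eq_0_iff_AE[OF refl(1)[of t]] refl(2)[of t] by simp
      then have "cross_correlation h \<phi> t = (\<integral>x. 0 \<partial>(lborel :: 'a measure))"
        unfolding cross_correlation_def by (intro integral_cong_AE) (auto elim!: eventually_mono)
      then show ?thesis by simp
    next
      case K0: False
      let ?f = "\<lambda>x. h x * of_real (sqrt (norm (\<phi> (x - t))))"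
      let ?g = "\<lambda>x. of_real (sqrt (norm (\<phi> (x - t)))) :: complex"
      have nf: "(norm (?f x))\<^sup>2 = (norm (h x))\<^sup>2 * norm (\<phi> (x - t))" for x
        by (simp add: norm_mult power_mult_distrib)
      have "?J t < \<infinity>" using False K0 by (auto simp: less_top)
      then have f: "?f \<in> Lp_space lborel 2" unfolding nf[symmetric] by (intro L2_I_nn) auto
      have g: "?g \<in> Lp_space lborel 2" using refl(1)[of t] by (auto simp: Lp_space_2_iff)
      have "norm (cross_correlation h \<phi> t) \<le> (\<integral>x. norm (?f x * cnj (?g x)) \<partial>lborel)"
      proof -
        have "norm (cross_correlation h \<phi> t) \<le> (\<integral>x. norm (h x * cnj (\<phi> (x - t))) \<partial>lborel)"
          unfolding cross_correlation_def by (rule integral_norm_bound)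
        also have "\<dots> = (\<integral>x. norm (?f x * cnj (?g x)) \<partial>lborel)"
          by (simp add: norm_mult mult.assoc)
        finally show ?thesis .
      qed
      then have "(norm (cross_correlation h \<phi> t))\<^sup>2 \<le> (\<integral>x. norm (?f x * cnj (?g x)) \<partial>lborel)\<^sup>2"
        by (intro power_mono) auto
      also have "\<dots> \<le> sqnorm lborel ?f * sqnorm lborel ?g" by (rule L2_Cauchy_Schwarz_norm[OF f g])
      also have "sqnorm lborel ?g = K" unfolding refl(2)[of t, symmetric] by (simp add: sqnorm_def)
      finally have "ennreal ((norm (cross_correlation h \<phi> t))\<^sup>2) \<le> ennreal (K * sqnorm lborel ?f)"
        by (intro ennreal_leI) (simp add: mult.commute)
      also have "\<dots> = ennreal K * (\<integral>\<^sup>+x. ennreal ((norm (?f x))\<^sup>2) \<partial>lborel)"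
        unfolding ennreal_sqnorm[OF f] using K by (simp add: ennreal_mult)
      finally show ?thesis unfolding nf .
    qed
  qed
  have [measurable]: "cross_correlation h \<phi> \<in> borel_measurable borel"
    by (rule cross_correlation_measurable) measurable
  have "(\<integral>\<^sup>+t. ennreal ((norm (cross_correlation h \<phi> t))\<^sup>2) \<partial>lborel) \<le>
      (\<integral>\<^sup>+t. ennreal K * (\<integral>\<^sup>+x. ennreal ((norm (h x))\<^sup>2 * norm (\<phi> (x - t))) \<partial>lborel) \<partial>lborel)"
    by (intro nn_integral_mono pointwise)
  also have "\<dots> = ennreal K * (\<integral>\<^sup>+t. (\<integral>\<^sup>+x. ennreal ((norm (h x))\<^sup>2 * norm (\<phi> (x - t))) \<partial>lborel) \<partial>lborel)"
    by (rule nn_integral_cmult) measurable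
  also have "(\<integral>\<^sup>+t. (\<integral>\<^sup>+x. ennreal ((norm (h x))\<^sup>2 * norm (\<phi> (x - t))) \<partial>lborel) \<partial>lborel) =
      (\<integral>\<^sup>+x. (\<integral>\<^sup>+t. ennreal ((norm (h x))\<^sup>2 * norm (\<phi> (x - t))) \<partial>lborel) \<partial>lborel)"
    by (rule lborel_pair.Fubini') measurable
  also have "\<dots> = (\<integral>\<^sup>+x. ennreal ((norm (h x))\<^sup>2) * ennreal K \<partial>lborel)"
  proof (rule nn_integral_cong)
    fix x
    have "(\<integral>\<^sup>+t. ennreal (norm (\<phi> (x - t))) \<partial>lborel) = (\<integral>\<^sup>+y. ennreal (norm (\<phi> y)) \<partial>lborel)"
      using lborel_nn_integral_affine[of "-1" "\<lambda>y. ennreal (norm (\<phi> y))" x] by simp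
    also have "\<dots> = ennreal K" unfolding K_def using \<phi> by (intro nn_integral_eq_integral) auto
    finally show "(\<integral>\<^sup>+t. ennreal ((norm (h x))\<^sup>2 * norm (\<phi> (x - t))) \<partial>lborel) = ennreal ((norm (h x))\<^sup>2) * ennreal K"
      by (simp add: ennreal_mult nn_integral_cmult)
  qed
  also have "\<dots> = ennreal (sqnorm lborel h) * ennreal K"
    by (subst nn_integral_multc) (simp_all add: ennreal_sqnorm[OF h])
  finally have bound: "(\<integral>\<^sup>+t. ennreal ((norm (cross_correlation h \<phi> t))\<^sup>2) \<partial>lborel) \<le> ennreal (K\<^sup>2 * sqnorm lborel h)"
    using K by (simp add: ennreal_mult[symmetric] power2_eq_square mult_ac)
  then show "cross_correlation h \<phi> \<in> Lp_space lborel 2"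
    by (intro L2_I_nn) (auto intro: order_le_less_trans)
  show "sqnorm lborel (cross_correlation h \<phi>) \<le> (\<integral>x. norm (\<phi> x) \<partial>lborel)\<^sup>2 * sqnorm lborel h"
    using bound by (intro sqnorm_leI) (auto simp: K_def)
qed

lemma L2_bounded_mult:
  assumes f: "f \<in> Lp_space M 2" and g: "g \<in> borel_measurable M" "\<And>x. norm (g x) \<le> K"
  shows "(\<lambda>x. f x * g x) \<in> Lp_space M 2" and "sqnorm M (\<lambda>x. f x * g x) \<le> K\<^sup>2 * sqnorm M f"
proof -
  note [measurable] = L2_measurable[OF f] g(1)
  have le: "(norm (f x * g x))\<^sup>2 \<le> K\<^sup>2 * (norm (f x))\<^sup>2" for x
  proof -
    have "(norm (g x))\<^sup>2 \<le> K\<^sup>2" using g(2) by (intro power_mono) auto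
    from mult_right_mono[OF this zero_le_power2[of "norm (f x)"]] show ?thesis
      by (simp add: norm_mult power_mult_distrib mult.commute)
  qed
  have I: "integrable M (\<lambda>x. K\<^sup>2 * (norm (f x))\<^sup>2)" using L2_integrable[OF f] by simp
  show fg: "(\<lambda>x. f x * g x) \<in> Lp_space M 2"
    by (rule L2_bound[OF _ I]) (use le in auto)
  have "sqnorm M (\<lambda>x. f x * g x) \<le> (\<integral>x. K\<^sup>2 * (norm (f x))\<^sup>2 \<partial>M)"
    unfolding sqnorm_def using L2_integrable[OF fg] I le by (intro integral_mono)
  then show "sqnorm M (\<lambda>x. f x * g x) \<le> K\<^sup>2 * sqnorm M f" by (simp add: sqnorm_def)
qed

lemma L2_bounded_support_integrable:
  assumes f: "f \<in> Lp_space lborel 2" and S: "\<And>x. x \<notin> cball 0 r \<Longrightarrow> f x = 0"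
  shows "integrable lborel (f :: 'a::euclidean_space \<Rightarrow> complex)"
proof (rule Bochner_Integration.integrable_bound)
  show "integrable lborel (\<lambda>x. (norm (f x))\<^sup>2 + indicator (cball 0 r) x)"
    using L2_integrable[OF f] emeasure_lborel_cball_finite[of "0::'a" r] by (intro Bochner_Integration.integrable_add) auto
  show "AE x in lborel. norm (f x) \<le> norm ((norm (f x))\<^sup>2 + indicator (cball 0 r) x :: real)"
  proof (rule AE_I2)
    fix x
    show "norm (f x) \<le> norm ((norm (f x))\<^sup>2 + indicator (cball 0 r) x :: real)"
    proof (cases "x \<in> cball 0 r")
      case True
      have "norm (f x) \<le> (norm (f x))\<^sup>2 + 1"
        using sum_squares_bound[of "norm (f x)" 1] norm_ge_zero[of "f x"] unfolding one_power2 by linarith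
      then show ?thesis using True by simp
    qed (simp add: S)
  qed
qed (use L2_measurable[OF f] in auto)

text \<open>For \<open>h\<close> that is merely square integrable the defining integral of
  \<open>ft h\<close> may fail to exist; \<open>w\<close> stands in for it as the limit of
  transforms of truncations. The second property is the product formula for the transform of a
  correlation, in integrated form.\<close>

theorem Plancherel_L2:
  fixes h :: "real ^ 2 \<Rightarrow> complex"
  assumes h: "h \<in> Lp_space lborel 2"
  obtains w where "w \<in> Lp_space lborel 2" "sqnorm lborel w = 4 * pi\<^sup>2 * sqnorm lborel h"
    "\<And>\<phi>. integrable lborel \<phi> \<Longrightarrow> \<phi> \<in> Lp_space lborel 2 \<Longrightarrow>
       4 * pi\<^sup>2 * sqnorm lborel (cross_correlation h \<phi>) = sqnorm lborel (\<lambda>\<xi>. w \<xi> * cnj (ft \<phi> \<xi>))"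
proof -
  have [measurable]: "h \<in> borel_measurable borel" using L2_measurable[OF h] by simp
  \<comment> \<open>Cutting off to balls makes \<open>h\<close> integrable, so that
    \<open>ft\<close> of each truncation is a genuine integral.\<close>
  define H where "H n x = indicator (cball 0 (real n)) x * h x" for n x
  have H_meas [measurable]: "H n \<in> borel_measurable borel" for n
    unfolding H_def[abs_def] by (intro borel_measurable_times borel_measurable_indicator) auto
  have H_lim: "AE x in lborel. (\<lambda>n. H n x) \<longlonglongrightarrow> h x"
  proof (rule AE_I2)
    fix x
    have "\<forall>\<^sub>F n in sequentially. h x = H n x"
      unfolding eventually_sequentially
    proof (intro exI[of _ "nat \<lceil>norm x\<rceil>"] allI impI)
      fix n assume "nat \<lceil>norm x\<rceil> \<le> n"
      then have "norm x \<le> real n" by linarith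
      then show "h x = H n x" by (simp add: H_def)
    qed
    then show "(\<lambda>n. H n x) \<longlonglongrightarrow> h x" by (rule Lim_transform_eventually[OF tendsto_const])
  qed
  have dc: "norm (H n x) \<le> 2 * norm (h x)" for n x by (simp add: H_def indicator_def)
  have Hh: "(\<lambda>n. sqnorm lborel (\<lambda>x. H n x - h x)) \<longlonglongrightarrow> 0" and H2: "H n \<in> Lp_space lborel 2" for n
    using sqnorm_dominated_convergence[OF h _ H_lim dc] H_meas by simp_all
  have H1: "integrable lborel (H n)" for n
    by (rule L2_bounded_support_integrable[OF H2, of "real n"]) (simp add: H_def)
  have ft_diff: "ft (\<lambda>x. H m x - H n x) = (\<lambda>\<xi>. ft (H m) \<xi> - ft (H n) \<xi>)" for m n
    unfolding ft_def using integrable_mult_cis[OF H1] by (simp add: left_diff_distrib)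
  have ftH: "ft (H n) \<in> Lp_space lborel 2" "sqnorm lborel (ft (H n)) = 4 * pi\<^sup>2 * sqnorm lborel (H n)" for n
    by (rule Plancherel[OF H1 H2])+
  have "\<exists>n0. \<forall>m\<ge>n0. \<forall>n\<ge>n0. sqnorm lborel (\<lambda>\<xi>. ft (H m) \<xi> - ft (H n) \<xi>) \<le> \<epsilon>" if "\<epsilon> > 0" for \<epsilon>
  proof -
    \<comment> \<open>Plancherel's factor \<open>4 * pi\<^sup>2\<close> times the triangle estimate
      \<open>4 * \<eta>\<close> gives \<open>\<epsilon>\<close>.\<close>
    define \<eta> where "\<eta> = \<epsilon> / (16 * pi\<^sup>2)"
    have "\<eta> > 0" using that by (simp add: \<eta>_def)
    then have "\<forall>\<^sub>F n in sequentially. sqnorm lborel (\<lambda>x. H n x - h x) < \<eta>"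
      using Hh by (intro order_tendstoD(2)) auto
    then obtain n0 where n0: "\<And>n. n \<ge> n0 \<Longrightarrow> sqnorm lborel (\<lambda>x. H n x - h x) < \<eta>"
      by (auto simp: eventually_sequentially)
    have "sqnorm lborel (\<lambda>\<xi>. ft (H m) \<xi> - ft (H n) \<xi>) \<le> \<epsilon>" if "m \<ge> n0" "n \<ge> n0" for m n
    proof -
      have "sqnorm lborel (\<lambda>\<xi>. ft (H m) \<xi> - ft (H n) \<xi>) = 4 * pi\<^sup>2 * sqnorm lborel (\<lambda>x. H m x - H n x)"
        unfolding ft_diff[symmetric] by (intro Plancherel L2_diff H2 Bochner_Integration.integrable_diff H1)
      also have "sqnorm lborel (\<lambda>x. H m x - H n x) \<le> 2 * sqnorm lborel (\<lambda>x. H m x - h x) + 2 * sqnorm lborel (\<lambda>x. H n x - h x)"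
        using sqnorm_add_le[OF L2_diff[OF H2[of m] h] L2_scale[OF L2_diff[OF H2[of n] h], of "-1"]]
        by (simp add: sqnorm_def norm_minus_commute)
      also have "\<dots> \<le> 2 * \<eta> + 2 * \<eta>" using n0[OF that(1)] n0[OF that(2)] by simp
      finally show ?thesis by (simp add: \<eta>_def field_simps)
    qed
    then show ?thesis by blast
  qed
  then obtain w where w: "w \<in> Lp_space lborel 2" "(\<lambda>n. sqnorm lborel (\<lambda>\<xi>. ft (H n) \<xi> - w \<xi>)) \<longlonglongrightarrow> 0"
    using L2_complete[of "\<lambda>n. ft (H n)" lborel] ftH(1) by blast
  show thesis
  proof (rule that[OF w(1)])
    have "(\<lambda>n. sqnorm lborel (ft (H n))) \<longlonglongrightarrow> sqnorm lborel w"
      by (rule sqnorm_tendsto_of_diff[OF ftH(1) w])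
    moreover have "(\<lambda>n. sqnorm lborel (ft (H n))) \<longlonglongrightarrow> 4 * pi\<^sup>2 * sqnorm lborel h"
      unfolding ftH(2) by (intro tendsto_mult tendsto_const sqnorm_tendsto_of_diff[OF H2 h Hh])
    ultimately show "sqnorm lborel w = 4 * pi\<^sup>2 * sqnorm lborel h" by (rule LIMSEQ_unique)
    fix \<phi> :: "real ^ 2 \<Rightarrow> complex" assume \<phi>: "integrable lborel \<phi>" "\<phi> \<in> Lp_space lborel 2"
    have [measurable]: "\<phi> \<in> borel_measurable borel" using \<phi> by auto
    define K where "K = (\<integral>x. norm (\<phi> x) \<partial>lborel)"
    have corr_diff: "cross_correlation (\<lambda>x. H n x - h x) \<phi> t = cross_correlation (H n) \<phi> t - cross_correlation h \<phi> t" for n t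
    proof -
      have tr: "(\<lambda>x. \<phi> (x - t)) \<in> Lp_space lborel 2" using L2_translate(1)[OF \<phi>(2), of "- t"] by simp
      show ?thesis unfolding cross_correlation_def
        using L2_mult_integrable[OF H2 tr] L2_mult_integrable[OF h tr] by (simp add: left_diff_distrib)
    qed
    have "(\<lambda>n. sqnorm lborel (\<lambda>t. cross_correlation (H n) \<phi> t - cross_correlation h \<phi> t)) \<longlonglongrightarrow> 0"
    proof (rule tendsto_0_squeeze)
      show "sqnorm lborel (\<lambda>t. cross_correlation (H n) \<phi> t - cross_correlation h \<phi> t) \<le> K\<^sup>2 * sqnorm lborel (\<lambda>x. H n x - h x)" for n
        unfolding K_def corr_diff[symmetric] by (intro cross_correlation_L2 L2_diff H2 h \<phi>)
      show "(\<lambda>n. K\<^sup>2 * sqnorm lborel (\<lambda>x. H n x - h x)) \<longlonglongrightarrow> 0" using Hh by (rule tendsto_mult_right_zero)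
    qed simp
    then have "(\<lambda>n. sqnorm lborel (cross_correlation (H n) \<phi>)) \<longlonglongrightarrow> sqnorm lborel (cross_correlation h \<phi>)"
      by (intro sqnorm_tendsto_of_diff cross_correlation_L2 H2 h \<phi>)
    then have "(\<lambda>n. 4 * pi\<^sup>2 * sqnorm lborel (cross_correlation (H n) \<phi>)) \<longlonglongrightarrow> 4 * pi\<^sup>2 * sqnorm lborel (cross_correlation h \<phi>)"
      by (intro tendsto_mult tendsto_const)
    moreover have "4 * pi\<^sup>2 * sqnorm lborel (cross_correlation (H n) \<phi>) = sqnorm lborel (\<lambda>\<xi>. ft (H n) \<xi> * cnj (ft \<phi> \<xi>))" for n
    proof -
      have "ft (cross_correlation (H n) \<phi>) = (\<lambda>\<xi>. ft (H n) \<xi> * cnj (ft \<phi> \<xi>))"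
        by (intro ext ft_cross_correlation H1 \<phi>)
      then show ?thesis
        using Plancherel(2)[OF integrable_cross_correlation[OF H1 \<phi>(1)] cross_correlation_L2(1)[OF H2 \<phi>(1)], of n] by simp
    qed
    moreover have "(\<lambda>n. sqnorm lborel (\<lambda>\<xi>. ft (H n) \<xi> * cnj (ft \<phi> \<xi>))) \<longlonglongrightarrow> sqnorm lborel (\<lambda>\<xi>. w \<xi> * cnj (ft \<phi> \<xi>))"
    proof (rule sqnorm_tendsto_of_diff)
      \<comment> \<open>The transform of an integrable function is bounded, so multiplication by it
        is continuous on \<open>L\<^sup>2\<close>.\<close>
      have g: "(\<lambda>\<xi>. cnj (ft \<phi> \<xi>)) \<in> borel_measurable lborel" "norm (cnj (ft \<phi> \<xi>)) \<le> K" for \<xi>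
        using norm_ft_le[of \<phi> \<xi>] by (simp_all add: K_def)
      show "(\<lambda>\<xi>. ft (H n) \<xi> * cnj (ft \<phi> \<xi>)) \<in> Lp_space lborel 2" for n by (rule L2_bounded_mult(1)[OF ftH(1) g])
      show "(\<lambda>\<xi>. w \<xi> * cnj (ft \<phi> \<xi>)) \<in> Lp_space lborel 2" by (rule L2_bounded_mult(1)[OF w(1) g])
      show "(\<lambda>n. sqnorm lborel (\<lambda>\<xi>. ft (H n) \<xi> * cnj (ft \<phi> \<xi>) - w \<xi> * cnj (ft \<phi> \<xi>))) \<longlonglongrightarrow> 0"
      proof (rule tendsto_0_squeeze)
        show "sqnorm lborel (\<lambda>\<xi>. ft (H n) \<xi> * cnj (ft \<phi> \<xi>) - w \<xi> * cnj (ft \<phi> \<xi>)) \<le> K\<^sup>2 * sqnorm lborel (\<lambda>\<xi>. ft (H n) \<xi> - w \<xi>)" for n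
          using L2_bounded_mult(2)[OF L2_diff[OF ftH(1) w(1)] g, of n] by (simp add: left_diff_distrib)
        show "(\<lambda>n. K\<^sup>2 * sqnorm lborel (\<lambda>\<xi>. ft (H n) \<xi> - w \<xi>)) \<longlonglongrightarrow> 0" using w(2) by (rule tendsto_mult_right_zero)
      qed simp
    qed
    ultimately show "4 * pi\<^sup>2 * sqnorm lborel (cross_correlation h \<phi>) = sqnorm lborel (\<lambda>\<xi>. w \<xi> * cnj (ft \<phi> \<xi>))"
      using LIMSEQ_unique by simp
  qed
qed

section \<open>The shearlet group\<close>

text \<open>The second diagonal entry of \<open>dilation_mat a\<close>. The sign makes this square
  root multiplicative in \<open>a\<close>.\<close>

definition kappa :: "real \<Rightarrow> real" where
  "kappa a = sgn a * sqrt \<bar>a\<bar>"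

definition jac :: "real \<Rightarrow> real" where
  "jac a = \<bar>a\<bar> * sqrt \<bar>a\<bar>"

text \<open>Dilation followed by shear, in coordinates, so that identities in the group become
  rational arithmetic.\<close>

definition lin :: "real \<Rightarrow> real \<Rightarrow> real ^ 2 \<Rightarrow> real ^ 2" where
  "lin a s x = vec2 (a * x $ 1 + s * kappa a * x $ 2, kappa a * x $ 2)"

definition lin_inv :: "real \<Rightarrow> real \<Rightarrow> real ^ 2 \<Rightarrow> real ^ 2" where
  "lin_inv a s y = vec2 ((y $ 1 - s * y $ 2) / a, y $ 2 / kappa a)"

lemma kappa_nonzero [simp]: "kappa a = 0 \<longleftrightarrow> a = 0"
  by (auto simp: kappa_def sgn_if)

lemma abs_kappa: "\<bar>kappa a\<bar> = sqrt \<bar>a\<bar>"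
  by (simp add: kappa_def sgn_if abs_mult)

lemma kappa_mult: "kappa (a * b) = kappa a * kappa b"
  by (simp add: kappa_def sgn_mult abs_mult real_sqrt_mult)

lemma kappa_mult_sqrt: "kappa a * sqrt \<bar>a\<bar> = a"
  by (cases "a \<ge> 0") (auto simp: kappa_def sgn_if)

lemma jac_nonneg [simp]: "0 \<le> jac a"
  by (simp add: jac_def)

lemma jac_pos: "a \<noteq> 0 \<Longrightarrow> 0 < jac a"
  by (simp add: jac_def)

lemma jac_mult: "jac (a * b) = jac a * jac b"
  by (simp add: jac_def abs_mult real_sqrt_mult)

lemma kappa_measurable [measurable]: "kappa \<in> borel_measurable borel"
  unfolding kappa_def[abs_def] sgn_if by measurable

lemma jac_measurable [measurable]: "jac \<in> borel_measurable borel"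
  unfolding jac_def[abs_def] by measurable

lemma vec2_eq_iff: "x = y \<longleftrightarrow> x $ 1 = y $ 1 \<and> x $ 2 = (y :: real ^ 2) $ 2"
  by (simp add: vec_eq_iff forall_2)

lemma dilation_mat_mult: "dilation_mat a *v x = vec2 (a * x $ 1, kappa a * x $ 2)"
  by (simp add: vec2_eq_iff dilation_mat_def matrix_vector_mult_def sum_2 kappa_def)

lemma shear_mat_mult: "shear_mat s *v x = vec2 (x $ 1 + s * x $ 2, x $ 2)"
  by (simp add: vec2_eq_iff shear_mat_def matrix_vector_mult_def sum_2)

lemma det_dilation_mat: "det (dilation_mat a) = a * kappa a"
  by (simp add: det_2 dilation_mat_def kappa_def)

lemma abs_det_dilation_mat: "\<bar>det (dilation_mat a)\<bar> = jac a"
  by (simp add: det_dilation_mat abs_mult abs_kappa jac_def)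

lemma matrix_inv_mult_eq:
  fixes A :: "real ^ 'n ^ 'n"
  assumes "invertible A" "A *v x = y"
  shows "matrix_inv A *v y = x"
proof -
  have "matrix_inv A ** A = mat 1"
    using assms(1) unfolding invertible_def matrix_inv_def by (rule someI2_ex) simp
  then show ?thesis
    unfolding assms(2)[symmetric] by (simp add: matrix_vector_mul_assoc)
qed

lemma lin_inv_eq:
  assumes "a \<noteq> 0"
  shows "matrix_inv (dilation_mat a) *v (matrix_inv (shear_mat s) *v y) = lin_inv a s y"
proof -
  have S: "invertible (shear_mat s)"
    by (simp add: invertible_det_nz det_2 shear_mat_def)
  have A: "invertible (dilation_mat a)"
    using assms by (simp add: invertible_det_nz det_dilation_mat)
  have "matrix_inv (shear_mat s) *v y = vec2 (y $ 1 - s * y $ 2, y $ 2)"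
    by (rule matrix_inv_mult_eq[OF S]) (simp add: shear_mat_mult vec2_eq_iff)
  moreover have "matrix_inv (dilation_mat a) *v vec2 (y $ 1 - s * y $ 2, y $ 2) = lin_inv a s y"
    using assms by (intro matrix_inv_mult_eq[OF A]) (simp add: dilation_mat_mult vec2_eq_iff lin_inv_def)
  ultimately show ?thesis by simp
qed

lemma lin_eq: "shear_mat s *v (dilation_mat a *v x) = lin a s x"
  by (simp add: shear_mat_mult dilation_mat_mult lin_def vec2_eq_iff)

lemma lin_lin_inv: "a \<noteq> 0 \<Longrightarrow> lin a s (lin_inv a s x) = x"
  by (simp add: lin_def lin_inv_def vec2_eq_iff)

lemma shear_rep_eq:
  "a \<noteq> 0 \<Longrightarrow> shear_rep (a, s, t) f x = of_real (jac a powr (- 1 / 2)) * f (lin_inv a s (x - t))"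
  by (simp add: lin_inv_eq abs_det_dilation_mat)

lemma jac_powr_sq: "a \<noteq> 0 \<Longrightarrow> (jac a powr (- 1 / 2))\<^sup>2 = 1 / jac a"
  using jac_pos[of a] by (simp add: powr_minus_divide powr_half_sqrt power_one_over power_divide)

lemma vec2_pair_measurable [measurable (raw)]:
  "f \<in> borel_measurable M \<Longrightarrow> g \<in> borel_measurable M \<Longrightarrow> (\<lambda>x. vec2 (f x, g x)) \<in> borel_measurable M"
  by (rule measurable_compose[OF _ vec2_measurable]) measurable

lemma lin_inv_measurable [measurable]: "lin_inv a s \<in> borel_measurable borel"
  unfolding lin_inv_def[abs_def] by measurable

lemma lin_measurable [measurable]: "lin a s \<in> borel_measurable borel"
  unfolding lin_def[abs_def] by measurable

lemma nn_integral_real_affine':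
  fixes f :: "real \<Rightarrow> ennreal"
  assumes "f \<in> borel_measurable borel" "c \<noteq> 0"
  shows "(\<integral>\<^sup>+x. f (t + c * x) \<partial>lborel) = ennreal (1 / \<bar>c\<bar>) * (\<integral>\<^sup>+x. f x \<partial>lborel)"
proof -
  have "ennreal (1 / \<bar>c\<bar>) * (ennreal \<bar>c\<bar> * I) = I" for I
    using assms by (simp add: mult.assoc[symmetric] ennreal_mult[symmetric])
  then show ?thesis
    using nn_integral_real_affine[OF assms, of t] by simp
qed

text \<open>The map is triangular: for fixed second coordinate the shear merely translates the
  first. The two one-dimensional substitutions contribute \<open>\<bar>a\<bar>\<close> and
  \<open>sqrt \<bar>a\<bar>\<close>.\<close>

lemma nn_integral_lin_inv:
  assumes a: "a \<noteq> 0" and [measurable]: "f \<in> borel_measurable borel"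
  shows "(\<integral>\<^sup>+y. f (lin_inv a s (y - t)) \<partial>lborel) = ennreal (jac a) * (\<integral>\<^sup>+x. f x \<partial>lborel)"
proof -
  have "(\<integral>\<^sup>+y. f (lin_inv a s (y - t)) \<partial>lborel) = (\<integral>\<^sup>+y. f (lin_inv a s y) \<partial>lborel)"
    using lborel_nn_integral_affine[of 1 "\<lambda>y. f (lin_inv a s y)" "- t"] by simp
  also have "\<dots> = (\<integral>\<^sup>+v. \<integral>\<^sup>+u. f (lin_inv a s (vec2 (u, v))) \<partial>lborel \<partial>lborel)"
    by (rule nn_integral_R2(2)) measurable
  also have "\<dots> = (\<integral>\<^sup>+v. ennreal \<bar>a\<bar> * (\<integral>\<^sup>+x. f (vec2 (x, v / kappa a)) \<partial>lborel) \<partial>lborel)"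
  proof (rule nn_integral_cong)
    fix v
    have "(\<integral>\<^sup>+u. f (lin_inv a s (vec2 (u, v))) \<partial>lborel) =
        (\<integral>\<^sup>+u. f (vec2 (- s * v / a + 1 / a * u, v / kappa a)) \<partial>lborel)"
      by (simp add: lin_inv_def diff_divide_distrib)
    also have "\<dots> = ennreal \<bar>a\<bar> * (\<integral>\<^sup>+x. f (vec2 (x, v / kappa a)) \<partial>lborel)"
      using a by (subst nn_integral_real_affine'[where f = "\<lambda>x. f (vec2 (x, v / kappa a))"]) auto
    finally show "(\<integral>\<^sup>+u. f (lin_inv a s (vec2 (u, v))) \<partial>lborel) =
      ennreal \<bar>a\<bar> * (\<integral>\<^sup>+x. f (vec2 (x, v / kappa a)) \<partial>lborel)" .
  qed
  also have "\<dots> = (\<integral>\<^sup>+v. ennreal \<bar>a\<bar> * (\<integral>\<^sup>+x. f (vec2 (x, 0 + 1 / kappa a * v)) \<partial>lborel) \<partial>lborel)" by simp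
  also have "\<dots> = ennreal (1 / \<bar>1 / kappa a\<bar>) * (\<integral>\<^sup>+v. ennreal \<bar>a\<bar> * (\<integral>\<^sup>+x. f (vec2 (x, v)) \<partial>lborel) \<partial>lborel)"
    using a by (intro nn_integral_real_affine'[where f = "\<lambda>v. ennreal \<bar>a\<bar> * (\<integral>\<^sup>+x. f (vec2 (x, v)) \<partial>lborel)"]) auto
  also have "\<dots> = ennreal (jac a) * (\<integral>\<^sup>+v. (\<integral>\<^sup>+x. f (vec2 (x, v)) \<partial>lborel) \<partial>lborel)"
    by (subst nn_integral_cmult)
       (auto simp: mult.assoc[symmetric] ennreal_mult[symmetric] abs_kappa jac_def mult.commute)
  also have "(\<integral>\<^sup>+v. (\<integral>\<^sup>+x. f (vec2 (x, v)) \<partial>lborel) \<partial>lborel) = (\<integral>\<^sup>+x. f x \<partial>lborel)"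
    by (rule nn_integral_R2(2)[symmetric]) measurable
  finally show ?thesis .
qed

lemma distr_lin_inv:
  assumes a: "a \<noteq> 0"
  shows "distr lborel borel (\<lambda>y. lin_inv a s (y - t)) = density lborel (\<lambda>_. ennreal (jac a))"
proof (rule measure_eqI)
  fix A assume "A \<in> sets (distr lborel borel (\<lambda>y. lin_inv a s (y - t)))"
  then have A [measurable]: "A \<in> sets borel" by simp
  have "emeasure (distr lborel borel (\<lambda>y. lin_inv a s (y - t))) A =
      (\<integral>\<^sup>+x. indicator A x \<partial>distr lborel borel (\<lambda>y. lin_inv a s (y - t)))"
    by simp
  also have "\<dots> = (\<integral>\<^sup>+y. indicator A (lin_inv a s (y - t)) \<partial>lborel)"
    by (rule nn_integral_distr) measurable
  also have "\<dots> = ennreal (jac a) * (\<integral>\<^sup>+x. indicator A x \<partial>lborel)"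
    by (rule nn_integral_lin_inv[OF a]) measurable
  also have "\<dots> = emeasure (density lborel (\<lambda>_. ennreal (jac a))) A"
    by (simp add: emeasure_density_const)
  finally show "emeasure (distr lborel borel (\<lambda>y. lin_inv a s (y - t))) A =
      emeasure (density lborel (\<lambda>_. ennreal (jac a))) A" .
qed simp

lemma
  fixes f :: "real ^ 2 \<Rightarrow> 'b::{banach, second_countable_topology}"
  assumes a: "a \<noteq> 0" and f: "integrable lborel f"
  shows integrable_lin_inv: "integrable lborel (\<lambda>y. f (lin_inv a s (y - t)))"
    and integral_lin_inv: "(\<integral>y. f (lin_inv a s (y - t)) \<partial>lborel) = jac a *\<^sub>R (\<integral>x. f x \<partial>lborel)"
proof -
  have [measurable]: "f \<in> borel_measurable borel" using f by auto
  have m: "(\<lambda>y. lin_inv a s (y - t)) \<in> lborel \<rightarrow>\<^sub>M borel" by measurable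
  have "integrable (density lborel (\<lambda>_. ennreal (jac a))) f"
    using f by (subst integrable_density) auto
  then have "integrable (distr lborel borel (\<lambda>y. lin_inv a s (y - t))) f"
    by (simp only: distr_lin_inv[OF a])
  then show "integrable lborel (\<lambda>y. f (lin_inv a s (y - t)))"
    by (subst (asm) integrable_distr_eq[OF m]) auto
  have "(\<integral>y. f (lin_inv a s (y - t)) \<partial>lborel) = (\<integral>x. f x \<partial>distr lborel borel (\<lambda>y. lin_inv a s (y - t)))"
    by (rule integral_distr[OF m, symmetric]) measurable
  also have "\<dots> = jac a *\<^sub>R (\<integral>x. f x \<partial>lborel)"
    unfolding distr_lin_inv[OF a] by (subst integral_density) auto
  finally show "(\<integral>y. f (lin_inv a s (y - t)) \<partial>lborel) = jac a *\<^sub>R (\<integral>x. f x \<partial>lborel)" .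
qed

section \<open>The unitary representation on \<open>L\<^sup>2\<close>\<close>

lemma mem_shearlet_group [simp]: "(a, s, t) \<in> shearlet_group \<longleftrightarrow> a \<noteq> 0"
  by (simp add: shearlet_group_def)

text \<open>The square of the factor \<open>jac a powr (- 1 / 2)\<close> cancels the
  Jacobian.\<close>

lemma shear_rep_L2:
  assumes g: "g \<in> shearlet_group" and f: "f \<in> Lp_space lborel 2"
  shows "shear_rep g f \<in> Lp_space lborel 2" "sqnorm lborel (shear_rep g f) = sqnorm lborel f"
proof -
  obtain a s t where g_eq: "g = (a, s, t)" and a: "a \<noteq> 0" using g by (cases g) auto
  have [measurable]: "f \<in> borel_measurable borel" using L2_measurable[OF f] by simp
  have eq: "shear_rep g f = (\<lambda>x. of_real (jac a powr (- 1 / 2)) * f (lin_inv a s (x - t)))"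
    unfolding g_eq by (rule ext) (rule shear_rep_eq[OF a])
  have fl: "(\<lambda>x. f (lin_inv a s (x - t))) \<in> Lp_space lborel 2"
    using integrable_lin_inv[OF a L2_integrable[OF f]] by (simp add: Lp_space_2_iff)
  then show "shear_rep g f \<in> Lp_space lborel 2" unfolding eq by (rule L2_scale)
  have "sqnorm lborel (shear_rep g f) = (jac a powr (- 1 / 2))\<^sup>2 * (\<integral>x. (norm (f (lin_inv a s (x - t))))\<^sup>2 \<partial>lborel)"
    unfolding eq sqnorm_def by (simp add: norm_mult power_mult_distrib)
  also have "\<dots> = sqnorm lborel f"
    using jac_pos[OF a] unfolding integral_lin_inv[OF a L2_integrable[OF f]] jac_powr_sq[OF a]
    by (simp add: sqnorm_def)
  finally show "sqnorm lborel (shear_rep g f) = sqnorm lborel f" .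
qed

lemma L2_inner_shear_rep:
  assumes g: "g \<in> shearlet_group" and f: "f \<in> Lp_space lborel 2" and h: "h \<in> Lp_space lborel 2"
  shows "L2_inner (shear_rep g f) (shear_rep g h) = L2_inner f h"
proof -
  obtain a s t where g_eq: "g = (a, s, t)" and a: "a \<noteq> 0" using g by (cases g) auto
  let ?r = "of_real (jac a powr (- 1 / 2)) :: complex"
  have rr: "?r * ?r * of_real (jac a) = 1"
    using jac_powr_sq[OF a] jac_pos[OF a]
    by (simp add: power2_eq_square of_real_mult[symmetric] del: of_real_mult)
  have "L2_inner (shear_rep g f) (shear_rep g h) =
      (\<integral>x. (?r * ?r) * (f (lin_inv a s (x - t)) * cnj (h (lin_inv a s (x - t)))) \<partial>lborel)"
    unfolding g_eq L2_inner_def shear_rep_eq[OF a] by (simp add: mult_ac)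
  also have "\<dots> = (?r * ?r) * (jac a *\<^sub>R L2_inner f h)"
    unfolding integral_mult_right_zero integral_lin_inv[OF a L2_mult_integrable[OF f h]] L2_inner_def ..
  also have "\<dots> = L2_inner f h" using rr by (simp add: scaleR_conv_of_real mult.assoc[symmetric])
  finally show ?thesis .
qed

lemma shear_mult_in_group: "g \<in> shearlet_group \<Longrightarrow> h \<in> shearlet_group \<Longrightarrow> shear_mult g h \<in> shearlet_group"
  by (cases g; cases h) auto

lemma shear_rep_mult:
  assumes "g \<in> shearlet_group" "h \<in> shearlet_group"
  shows "shear_rep g (shear_rep h f) = shear_rep (shear_mult g h) f"
proof
  fix x
  obtain a s t where g: "g = (a, s, t)" and a: "a \<noteq> 0" using assms(1) by (cases g) auto
  obtain b r w where h: "h = (b, r, w)" and b: "b \<noteq> 0" using assms(2) by (cases h) auto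
  \<comment> \<open>Moving a dilation past a shear multiplies the shear parameter by the ratio of
    the two diagonal entries; this is the square root in the group law.\<close>
  have k: "a / kappa a = sqrt \<bar>a\<bar>" using kappa_mult_sqrt[of a] a by (simp add: field_simps)
  have "lin_inv b r (lin_inv a s (x - t) - w) = lin_inv (a * b) (s + r * sqrt \<bar>a\<bar>) (x - (t + lin a s w))"
    using a b by (simp add: lin_inv_def lin_def vec2_eq_iff kappa_mult k[symmetric] field_simps)
  moreover have "jac a powr (- 1 / 2) * jac b powr (- 1 / 2) = jac (a * b) powr (- 1 / 2)"
    by (simp add: jac_mult powr_mult)
  ultimately show "shear_rep g (shear_rep h f) x = shear_rep (shear_mult g h) f x"
    using a b unfolding g h shear_mult.simps lin_eq
    by (simp add: shear_rep_eq mult.assoc[symmetric] of_real_mult[symmetric] del: shear_rep.simps of_real_mult)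
qed

section \<open>Haar measure as an iterated integral\<close>

lemma space_shear_haar [simp]: "space shear_haar = shearlet_group"
  and sets_shear_haar: "sets shear_haar = sets (restrict_space borel shearlet_group)"
  by (simp_all add: shear_haar_def space_restrict_space sets_restrict_space)

lemma shearlet_group_borel [measurable]: "shearlet_group \<in> sets borel"
proof -
  have "shearlet_group = {g. fst g \<noteq> 0}" by (auto simp: shearlet_group_def)
  moreover have "open {g :: shear_par. fst g \<noteq> 0}" by (intro open_Collect_neq continuous_intros)
  ultimately show ?thesis by simp
qed

lemma measurable_shear_haar_iff:
  "f \<in> borel_measurable shear_haar \<longleftrightarrow> f \<in> borel_measurable (restrict_space borel shearlet_group)"
  by (intro arg_cong2[where f = "(\<in>)"] measurable_cong_sets refl) (simp add: sets_shear_haar)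

text \<open>The excluded hyperplane \<open>a = 0\<close> needs no indicator since \<open>1 / 0 = 0\<close>.\<close>

lemma nn_integral_shear_haar:
  assumes f [measurable]: "f \<in> borel_measurable borel"
  shows "(\<integral>\<^sup>+g. f g \<partial>shear_haar) =
    (\<integral>\<^sup>+a. \<integral>\<^sup>+s. \<integral>\<^sup>+t. ennreal (1 / \<bar>a\<bar> ^ 3) * f (a, s, t) \<partial>lborel \<partial>lborel \<partial>lborel)"
proof -
  have m: "(\<lambda>g :: shear_par. ennreal (1 / \<bar>fst g\<bar> ^ 3)) \<in> borel_measurable borel"
  proof -
    have "(fst :: shear_par \<Rightarrow> real) \<in> borel_measurable borel"
      by (intro borel_measurable_continuous_onI continuous_intros)
    moreover have "(\<lambda>x :: real. ennreal (1 / \<bar>x\<bar> ^ 3)) \<in> borel_measurable borel" by measurable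
    ultimately show ?thesis by (rule measurable_compose)
  qed
  have "(\<integral>\<^sup>+g. f g \<partial>shear_haar) = (\<integral>\<^sup>+g. ennreal (1 / \<bar>fst g\<bar> ^ 3) * f g \<partial>restrict_space lborel shearlet_group)"
    unfolding shear_haar_def using f m
    by (intro nn_integral_density measurable_restrict_space1) auto
  also have "\<dots> = (\<integral>\<^sup>+g. ennreal (1 / \<bar>fst g\<bar> ^ 3) * f g * indicator shearlet_group g \<partial>lborel)"
    by (rule nn_integral_restrict_space) simp
  also have "\<dots> = (\<integral>\<^sup>+g. ennreal (1 / \<bar>fst g\<bar> ^ 3) * f g \<partial>lborel)"
    by (intro nn_integral_cong) (auto simp: shearlet_group_def indicator_def)
  also have "\<dots> = (\<integral>\<^sup>+g. ennreal (1 / \<bar>fst g\<bar> ^ 3) * f g \<partial>(lborel \<Otimes>\<^sub>M lborel))"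
    by (simp add: lborel_prod)
  also have "\<dots> = (\<integral>\<^sup>+a. \<integral>\<^sup>+z. ennreal (1 / \<bar>fst (a, z)\<bar> ^ 3) * f (a, z) \<partial>lborel \<partial>lborel)"
    by (rule lborel.nn_integral_fst[symmetric]) (use f m in \<open>simp add: lborel_prod\<close>)
  also have "\<dots> = (\<integral>\<^sup>+a. \<integral>\<^sup>+z. ennreal (1 / \<bar>a\<bar> ^ 3) * f (a, z) \<partial>(lborel \<Otimes>\<^sub>M lborel) \<partial>lborel)"
    by (simp add: lborel_prod)
  also have "\<dots> = (\<integral>\<^sup>+a. \<integral>\<^sup>+s. \<integral>\<^sup>+t. ennreal (1 / \<bar>a\<bar> ^ 3) * f (a, s, t) \<partial>lborel \<partial>lborel \<partial>lborel)"
  proof (rule nn_integral_cong)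
    fix a :: real
    have "(\<lambda>z. ennreal (1 / \<bar>a\<bar> ^ 3) * f (a, z)) \<in> borel_measurable (lborel \<Otimes>\<^sub>M lborel)"
      unfolding lborel_prod by measurable
    from lborel.nn_integral_fst[OF this] show "(\<integral>\<^sup>+z. ennreal (1 / \<bar>a\<bar> ^ 3) * f (a, z) \<partial>(lborel \<Otimes>\<^sub>M lborel)) =
      (\<integral>\<^sup>+s. \<integral>\<^sup>+t. ennreal (1 / \<bar>a\<bar> ^ 3) * f (a, s, t) \<partial>lborel \<partial>lborel)" by simp
  qed
  finally show ?thesis .
qed

section \<open>The isometry of the shearlet transform\<close>

lemma shear_mult_measurable [measurable]:
  "shear_mult h \<in> borel \<rightarrow>\<^sub>M borel"
proof -
  obtain b r w where h: "h = (b, r, w)" by (cases h)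
  have "(\<lambda>(a, s, t). (b * a, r + s * sqrt \<bar>b\<bar>, w + lin b r t)) \<in>
      (borel \<Otimes>\<^sub>M borel \<Otimes>\<^sub>M borel) \<rightarrow>\<^sub>M (borel \<Otimes>\<^sub>M borel \<Otimes>\<^sub>M borel)"
    by measurable
  moreover have "shear_mult h = (\<lambda>(a, s, t). (b * a, r + s * sqrt \<bar>b\<bar>, w + lin b r t))"
    by (auto simp: h lin_eq fun_eq_iff)
  ultimately show ?thesis by (simp add: borel_prod)
qed

text \<open>Left invariance. Substituting in \<open>t\<close>, \<open>s\<close> and \<open>a\<close>
  costs powers of \<open>\<bar>b\<bar>\<close> with exponents 3/2, 1/2 and 1, which the cubic
  density compensates; \<open>c\<close> collects the first two.\<close>

lemma nn_integral_shear_haar_left: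
  assumes h: "h \<in> shearlet_group" and f: "f \<in> borel_measurable borel"
  shows "(\<integral>\<^sup>+g. f (shear_mult h g) \<partial>shear_haar) = (\<integral>\<^sup>+g. f g \<partial>shear_haar)"
proof -
  obtain b r w where h_eq: "h = (b, r, w)" and b: "b \<noteq> 0" using h by (cases h) auto
  have f3 [measurable]: "f \<in> borel_measurable (borel \<Otimes>\<^sub>M borel \<Otimes>\<^sub>M borel)" using f by (simp add: borel_prod)
  define I where "I a = (\<integral>\<^sup>+s. \<integral>\<^sup>+t. f (a, s, t) \<partial>lborel \<partial>lborel)" for a
  have [measurable]: "I \<in> borel_measurable borel" unfolding I_def by measurable
  have inner_t: "(\<integral>\<^sup>+t. f (a, s, w + lin b r t) \<partial>lborel) = ennreal (1 / jac b) * (\<integral>\<^sup>+t. f (a, s, t) \<partial>lborel)" for a s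
  proof -
    have "(\<integral>\<^sup>+y. f (a, s, w + lin b r (lin_inv b r (y - w))) \<partial>lborel) =
        ennreal (jac b) * (\<integral>\<^sup>+t. f (a, s, w + lin b r t) \<partial>lborel)"
      by (rule nn_integral_lin_inv[OF b]) measurable
    then have "(\<integral>\<^sup>+y. f (a, s, y) \<partial>lborel) = ennreal (jac b) * (\<integral>\<^sup>+t. f (a, s, w + lin b r t) \<partial>lborel)"
      by (simp add: lin_lin_inv[OF b])
    then show ?thesis
      using jac_pos[OF b] by (simp add: mult.assoc[symmetric] ennreal_mult[symmetric])
  qed
  define c where "c = 1 / (jac b * sqrt \<bar>b\<bar>)"
  have inner: "(\<integral>\<^sup>+s. \<integral>\<^sup>+t. f (a, r + s * sqrt \<bar>b\<bar>, w + lin b r t) \<partial>lborel \<partial>lborel) = ennreal c * I a" for a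
  proof -
    have "(\<integral>\<^sup>+s. \<integral>\<^sup>+t. f (a, r + s * sqrt \<bar>b\<bar>, w + lin b r t) \<partial>lborel \<partial>lborel) =
        ennreal (1 / jac b) * (\<integral>\<^sup>+s. \<integral>\<^sup>+t. f (a, r + sqrt \<bar>b\<bar> * s, t) \<partial>lborel \<partial>lborel)"
      unfolding inner_t by (subst nn_integral_cmult) (simp_all add: mult.commute)
    also have "(\<integral>\<^sup>+s. \<integral>\<^sup>+t. f (a, r + sqrt \<bar>b\<bar> * s, t) \<partial>lborel \<partial>lborel) = ennreal (1 / \<bar>sqrt \<bar>b\<bar>\<bar>) * I a"
      unfolding I_def using b
      by (intro nn_integral_real_affine'[where f = "\<lambda>s. \<integral>\<^sup>+t. f (a, s, t) \<partial>lborel"]) auto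
    finally show ?thesis
      by (simp add: c_def mult.assoc[symmetric] ennreal_mult[symmetric])
  qed
  have "(\<integral>\<^sup>+g. f (shear_mult h g) \<partial>shear_haar) =
      (\<integral>\<^sup>+a. \<integral>\<^sup>+s. \<integral>\<^sup>+t. ennreal (1 / \<bar>a\<bar> ^ 3) * f (b * a, r + s * sqrt \<bar>b\<bar>, w + lin b r t) \<partial>lborel \<partial>lborel \<partial>lborel)"
    using measurable_compose[OF shear_mult_measurable f, of h]
    by (subst nn_integral_shear_haar) (simp_all add: h_eq lin_eq)
  also have "\<dots> = (\<integral>\<^sup>+a. ennreal (1 / \<bar>a\<bar> ^ 3) * (ennreal c * I (b * a)) \<partial>lborel)"
    unfolding inner[symmetric] by (simp add: nn_integral_cmult)
  \<comment> \<open>Everything is written as a function of \<open>b * a\<close> to prepare the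
    one-dimensional substitution.\<close>
  also have "\<dots> = (\<integral>\<^sup>+a. ennreal (\<bar>b\<bar> ^ 3 / \<bar>0 + b * a\<bar> ^ 3) * (ennreal c * I (0 + b * a)) \<partial>lborel)"
    using b by (simp add: abs_mult power_mult_distrib)
  also have "\<dots> = ennreal (1 / \<bar>b\<bar>) * (\<integral>\<^sup>+a. ennreal (\<bar>b\<bar> ^ 3 / \<bar>a\<bar> ^ 3) * (ennreal c * I a) \<partial>lborel)"
    using b by (intro nn_integral_real_affine'[where f = "\<lambda>a. ennreal (\<bar>b\<bar> ^ 3 / \<bar>a\<bar> ^ 3) * (ennreal c * I a)"]) auto
  also have "\<dots> = (\<integral>\<^sup>+a. ennreal (1 / \<bar>b\<bar>) * (ennreal (\<bar>b\<bar> ^ 3 / \<bar>a\<bar> ^ 3) * (ennreal c * I a)) \<partial>lborel)"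
    by (rule nn_integral_cmult[symmetric]) measurable
  also have "\<dots> = (\<integral>\<^sup>+a. ennreal (1 / \<bar>a\<bar> ^ 3) * I a \<partial>lborel)"
  proof (rule nn_integral_cong)
    fix a :: real
    have cb: "1 / \<bar>b\<bar> * (\<bar>b\<bar> ^ 3 / \<bar>a\<bar> ^ 3) * c = 1 / \<bar>a\<bar> ^ 3"
      using b by (simp add: c_def jac_def power3_eq_cube field_simps)
    have "0 \<le> c" by (simp add: c_def)
    have "ennreal x * (ennreal y * (ennreal z * J)) = ennreal (x * y * z) * J" if "0 \<le> x" "0 \<le> y" "0 \<le> z" for x y z J
      using that by (simp add: ennreal_mult mult.assoc)
    from this[of "1 / \<bar>b\<bar>" "\<bar>b\<bar> ^ 3 / \<bar>a\<bar> ^ 3" c "I a"] \<open>0 \<le> c\<close>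
    show "ennreal (1 / \<bar>b\<bar>) * (ennreal (\<bar>b\<bar> ^ 3 / \<bar>a\<bar> ^ 3) * (ennreal c * I a)) = ennreal (1 / \<bar>a\<bar> ^ 3) * I a"
      unfolding cb by simp
  qed
  also have "\<dots> = (\<integral>\<^sup>+g. f g \<partial>shear_haar)"
    unfolding I_def using f by (subst nn_integral_shear_haar) (simp_all add: nn_integral_cmult)
  finally show ?thesis .
qed

text \<open>The untranslated shearlet by an explicit formula. It agrees with the representation for
  \<open>a \<noteq> 0\<close> and, since division by zero gives zero, is also a measurable
  expression across \<open>a = 0\<close>.\<close>

definition atom :: "(real ^ 2 \<Rightarrow> complex) \<Rightarrow> real \<Rightarrow> real \<Rightarrow> real ^ 2 \<Rightarrow> complex" where
  "atom \<psi> a s x = of_real (jac a powr (- 1 / 2)) * \<psi> (lin_inv a s x)"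

lemma shear_rep_atom: "a \<noteq> 0 \<Longrightarrow> shear_rep (a, s, t) \<psi> x = atom \<psi> a s (x - t)"
  by (simp add: shear_rep_eq atom_def del: shear_rep.simps)

lemma shear_transform_eq:
  "a \<noteq> 0 \<Longrightarrow> shear_transform \<psi> f (a, s, t) = cross_correlation f (atom \<psi> a s) t"
  by (simp add: shear_transform_def L2_inner_def cross_correlation_def shear_rep_atom del: shear_rep.simps)

lemma cross_correlation_atom_measurable:
  assumes [measurable]: "\<psi> \<in> borel_measurable borel" "f \<in> borel_measurable borel"
  shows "(\<lambda>(a, s, t). cross_correlation f (atom \<psi> a s) t) \<in> borel_measurable (borel \<Otimes>\<^sub>M borel \<Otimes>\<^sub>M borel)"
proof -
  have "(\<lambda>(g, x). f x * cnj (of_real (jac (fst g) powr (- 1 / 2)) * \<psi> (lin_inv (fst g) (fst (snd g)) (x - snd (snd g)))))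
      \<in> borel_measurable ((borel \<Otimes>\<^sub>M borel \<Otimes>\<^sub>M borel) \<Otimes>\<^sub>M (lborel :: (real ^ 2) measure))"
    unfolding lin_inv_def case_prod_unfold by measurable
  from lborel.borel_measurable_lebesgue_integral[OF this] show ?thesis
    by (simp add: cross_correlation_def atom_def case_prod_unfold)
qed

lemma shear_transform_measurable:
  assumes "\<psi> \<in> Lp_space lborel 2" "f \<in> Lp_space lborel 2"
  shows "shear_transform \<psi> f \<in> borel_measurable shear_haar"
proof -
  let ?v = "\<lambda>(a, s, t). cross_correlation f (atom \<psi> a s) t"
  have "?v \<in> borel_measurable borel"
    using cross_correlation_atom_measurable[of \<psi> f] L2_measurable[OF assms(1)] L2_measurable[OF assms(2)]
    by (simp add: borel_prod)
  then have "?v \<in> borel_measurable (restrict_space borel shearlet_group)" by (rule measurable_restrict_space1)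
  then have "shear_transform \<psi> f \<in> borel_measurable (restrict_space borel shearlet_group)"
    by (rule measurable_cong[THEN iffD1, rotated])
       (auto simp: space_restrict_space shear_transform_eq split: prod.splits)
  then show ?thesis by (simp add: measurable_shear_haar_iff)
qed

text \<open>The frequency is moved by the transpose of \<open>lin a s\<close>. The normalization
  \<open>jac a powr (- 1 / 2)\<close> times the Jacobian leaves \<open>sqrt (jac a)\<close>.\<close>

lemma
  assumes a: "a \<noteq> 0" and \<psi>: "integrable lborel \<psi>"
  shows atom_integrable: "integrable lborel (atom \<psi> a s)"
    and ft_atom: "ft (atom \<psi> a s) \<xi> = of_real (sqrt (jac a)) * ft \<psi> (vec2 (a * \<xi> $ 1, kappa a * (s * \<xi> $ 1 + \<xi> $ 2)))"
proof -
  show "integrable lborel (atom \<psi> a s)"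
    unfolding atom_def[abs_def] using integrable_lin_inv[OF a \<psi>, of s 0] by simp
  let ?\<eta> = "vec2 (a * \<xi> $ 1, kappa a * (s * \<xi> $ 1 + \<xi> $ 2))"
  let ?G = "\<lambda>y. \<psi> y * cis (- (y \<bullet> ?\<eta>))"
  have in_eq: "x \<bullet> \<xi> = lin_inv a s x \<bullet> ?\<eta>" for x
    using a by (simp add: inner_R2 lin_inv_def) (simp add: field_simps)
  have "ft (atom \<psi> a s) \<xi> = (\<integral>x. of_real (jac a powr (- 1 / 2)) * ?G (lin_inv a s (x - 0)) \<partial>lborel)"
    unfolding ft_def atom_def in_eq by (simp add: mult.assoc)
  also have "\<dots> = of_real (jac a powr (- 1 / 2)) * (jac a *\<^sub>R ft \<psi> ?\<eta>)"
    unfolding integral_mult_right_zero integral_lin_inv[OF a integrable_mult_cis[OF \<psi>]] ft_def ..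
  also have "\<dots> = of_real (jac a powr (- 1 / 2) * jac a) * ft \<psi> ?\<eta>" by (simp add: scaleR_conv_of_real)
  also have "jac a powr (- 1 / 2) * jac a = sqrt (jac a)"
    using jac_pos[OF a] by (simp add: powr_minus_divide powr_half_sqrt real_div_sqrt)
  finally show "ft (atom \<psi> a s) \<xi> = of_real (sqrt (jac a)) * ft \<psi> ?\<eta>" .
qed

lemma atom_L2:
  assumes a: "a \<noteq> 0" and \<psi>: "\<psi> \<in> Lp_space lborel 2"
  shows "atom \<psi> a s \<in> Lp_space lborel 2"
proof -
  have "atom \<psi> a s = shear_rep (a, s, 0) \<psi>"
    using a by (intro ext) (simp add: shear_rep_atom del: shear_rep.simps)
  then show ?thesis using shear_rep_L2(1)[of "(a, s, 0)" \<psi>] a \<psi> by simp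
qed

text \<open>The admissibility constant of \<open>\<psi>\<close>, possibly infinite.\<close>

definition calderon :: "(real ^ 2 \<Rightarrow> complex) \<Rightarrow> ennreal" where
  "calderon \<psi> = (\<integral>\<^sup>+u. \<integral>\<^sup>+v. ennreal (1 / u\<^sup>2) * ennreal ((norm (ft \<psi> (vec2 (u, v))))\<^sup>2) \<partial>lborel \<partial>lborel)"

lemma AE_lborel_nonzero: "AE x in lborel. x \<noteq> (0::real)"
  by (intro AE_lborel_singleton)

lemma AE_lborel_R2_nonzero: "AE x in lborel. (x :: real ^ 2) $ 1 \<noteq> 0"
proof (rule AE_I)
  let ?N = "{x :: real ^ 2. x $ 1 = 0}"
  have m [measurable]: "?N \<in> sets borel" by measurable
  have "emeasure lborel ?N = (\<integral>\<^sup>+x. indicator ?N x \<partial>lborel)" by simp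
  also have "\<dots> = (\<integral>\<^sup>+u. \<integral>\<^sup>+v. indicator ?N (vec2 (u, v)) \<partial>lborel \<partial>lborel)"
    by (rule nn_integral_R2(1)) measurable
  also have "\<dots> = (\<integral>\<^sup>+u. \<integral>\<^sup>+v. 0 \<partial>(lborel :: real measure) \<partial>(lborel :: real measure))"
  proof (rule nn_integral_cong_AE)
    show "AE u in lborel. (\<integral>\<^sup>+v. indicator ?N (vec2 (u, v)) \<partial>lborel) = (\<integral>\<^sup>+v. 0 \<partial>(lborel :: real measure))"
      using AE_lborel_nonzero by eventually_elim simp
  qed
  finally show "emeasure lborel ?N = 0" by simp
qed auto

text \<open>Substituting \<open>u = a * x\<close> and \<open>v = kappa a * (s * x + y)\<close>
  removes all dependence on the frequency \<open>(x, y)\<close>. This is why the transform is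
  isometric up to a constant.\<close>

lemma calderon_eq:
  assumes \<psi>: "integrable lborel \<psi>" and x: "x \<noteq> 0"
  shows "(\<integral>\<^sup>+a. \<integral>\<^sup>+s. ennreal (1 / \<bar>a\<bar> ^ 3) *
      ennreal (jac a * (norm (ft \<psi> (vec2 (a * x, kappa a * (s * x + y)))))\<^sup>2) \<partial>lborel \<partial>lborel) = calderon \<psi>"
proof -
  have [measurable]: "ft \<psi> \<in> borel_measurable borel" using \<psi> by (intro ft_measurable) auto
  define P where "P u v = ennreal ((norm (ft \<psi> (vec2 (u, v))))\<^sup>2)" for u v
  have [measurable]: "(\<lambda>(u, v). P u v) \<in> borel_measurable (borel \<Otimes>\<^sub>M borel)" unfolding P_def by measurable
  define I where "I u = (\<integral>\<^sup>+v. P u v \<partial>lborel)" for u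
  have [measurable]: "I \<in> borel_measurable borel" unfolding I_def by measurable
  have "(\<integral>\<^sup>+s. ennreal (1 / \<bar>a\<bar> ^ 3) * ennreal (jac a * (norm (ft \<psi> (vec2 (a * x, kappa a * (s * x + y)))))\<^sup>2) \<partial>lborel) =
      ennreal (\<bar>x\<bar> / (0 + x * a)\<^sup>2) * I (0 + x * a)" for a
  \<comment> \<open>At \<open>a = 0\<close> both sides vanish, since division by zero gives
    zero.\<close>
  proof (cases "a = 0")
    case False
    have "(\<integral>\<^sup>+s. ennreal (1 / \<bar>a\<bar> ^ 3) * ennreal (jac a * (norm (ft \<psi> (vec2 (a * x, kappa a * (s * x + y)))))\<^sup>2) \<partial>lborel) =
        (\<integral>\<^sup>+s. ennreal (jac a / \<bar>a\<bar> ^ 3) * P (x * a) (kappa a * y + kappa a * x * s) \<partial>lborel)"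
    proof (rule nn_integral_cong)
      fix s
      have arg: "kappa a * (s * x + y) = kappa a * y + kappa a * x * s" by (simp add: algebra_simps)
      have "ennreal (1 / \<bar>a\<bar> ^ 3) * ennreal (jac a * n) = ennreal (jac a / \<bar>a\<bar> ^ 3) * ennreal n" if "0 \<le> n" for n
        using that by (simp add: ennreal_mult[symmetric])
      then show "ennreal (1 / \<bar>a\<bar> ^ 3) * ennreal (jac a * (norm (ft \<psi> (vec2 (a * x, kappa a * (s * x + y)))))\<^sup>2) =
          ennreal (jac a / \<bar>a\<bar> ^ 3) * P (x * a) (kappa a * y + kappa a * x * s)"
        unfolding P_def arg mult.commute[of a x] by simp
    qed
    also have "\<dots> = ennreal (jac a / \<bar>a\<bar> ^ 3) * (\<integral>\<^sup>+s. P (x * a) (kappa a * y + kappa a * x * s) \<partial>lborel)"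
      by (rule nn_integral_cmult) measurable
    also have "(\<integral>\<^sup>+s. P (x * a) (kappa a * y + kappa a * x * s) \<partial>lborel) = ennreal (1 / \<bar>kappa a * x\<bar>) * I (x * a)"
      unfolding I_def using False x by (intro nn_integral_real_affine') auto
    also have "ennreal (jac a / \<bar>a\<bar> ^ 3) * (ennreal (1 / \<bar>kappa a * x\<bar>) * I (x * a)) =
        ennreal (jac a / \<bar>a\<bar> ^ 3 * (1 / \<bar>kappa a * x\<bar>)) * I (x * a)"
      by (simp add: mult.assoc[symmetric] ennreal_mult[symmetric])
    also have "jac a / \<bar>a\<bar> ^ 3 * (1 / \<bar>kappa a * x\<bar>) = \<bar>x\<bar> / (x * a)\<^sup>2"
    proof -
      have "\<bar>x\<bar> * \<bar>x\<bar> = x * x" "\<bar>a\<bar> * \<bar>a\<bar> = a * a" by simp_all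
      then show ?thesis
        using False x by (simp add: abs_mult abs_kappa jac_def power3_eq_cube power2_eq_square field_simps)
    qed
    finally show ?thesis by simp
  qed simp
  then have "(\<integral>\<^sup>+a. \<integral>\<^sup>+s. ennreal (1 / \<bar>a\<bar> ^ 3) * ennreal (jac a * (norm (ft \<psi> (vec2 (a * x, kappa a * (s * x + y)))))\<^sup>2) \<partial>lborel \<partial>lborel) =
      (\<integral>\<^sup>+a. ennreal (\<bar>x\<bar> / (0 + x * a)\<^sup>2) * I (0 + x * a) \<partial>lborel)" by simp
  also have "\<dots> = ennreal (1 / \<bar>x\<bar>) * (\<integral>\<^sup>+u. ennreal (\<bar>x\<bar> / u\<^sup>2) * I u \<partial>lborel)"
    using x by (intro nn_integral_real_affine'[where f = "\<lambda>u. ennreal (\<bar>x\<bar> / u\<^sup>2) * I u"]) auto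
  also have "\<dots> = (\<integral>\<^sup>+u. ennreal (1 / \<bar>x\<bar>) * (ennreal (\<bar>x\<bar> / u\<^sup>2) * I u) \<partial>lborel)"
    by (rule nn_integral_cmult[symmetric]) measurable
  also have "\<dots> = (\<integral>\<^sup>+u. ennreal (1 / u\<^sup>2) * I u \<partial>lborel)"
    using x by (simp add: mult.assoc[symmetric] ennreal_mult[symmetric])
  also have "\<dots> = calderon \<psi>"
    unfolding calderon_def I_def P_def by (simp add: nn_integral_cmult)
  finally show ?thesis .
qed

text \<open>If it were zero, \<open>ft \<psi>\<close> would vanish almost everywhere, and so would
  \<open>\<psi>\<close> by Plancherel's theorem.\<close>

lemma calderon_nonzero:
  assumes \<psi>1: "integrable lborel \<psi>" and \<psi>2: "\<psi> \<in> Lp_space lborel 2" and nz: "\<not> (AE x in lborel. \<psi> x = 0)"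
  shows "calderon \<psi> \<noteq> 0"
proof
  assume zero: "calderon \<psi> = 0"
  have [measurable]: "ft \<psi> \<in> borel_measurable borel" using \<psi>1 by (intro ft_measurable) auto
  define I where "I u = (\<integral>\<^sup>+v. ennreal ((norm (ft \<psi> (vec2 (u, v))))\<^sup>2) \<partial>lborel)" for u
  have [measurable]: "I \<in> borel_measurable borel" unfolding I_def by measurable
  have "(\<integral>\<^sup>+u. ennreal (1 / u\<^sup>2) * I u \<partial>lborel) = 0"
    using zero unfolding calderon_def I_def by (simp add: nn_integral_cmult)
  then have "AE u in lborel. ennreal (1 / u\<^sup>2) * I u = 0"
    by (subst (asm) nn_integral_0_iff_AE) auto
  then have "AE u in lborel. I u = 0"
    using AE_lborel_nonzero by eventually_elim (auto simp: ennreal_eq_0_iff divide_le_0_iff)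
  then have "(\<integral>\<^sup>+u. I u \<partial>lborel) = 0" by (subst nn_integral_0_iff_AE) auto
  then have "(\<integral>\<^sup>+x. ennreal ((norm (ft \<psi> x))\<^sup>2) \<partial>lborel) = 0"
    unfolding I_def by (subst nn_integral_R2(1)) auto
  then have "sqnorm lborel (ft \<psi>) = 0" using ennreal_sqnorm[OF Plancherel(1)[OF \<psi>1 \<psi>2]] by simp
  then have "sqnorm lborel \<psi> = 0" unfolding Plancherel(2)[OF \<psi>1 \<psi>2] by simp
  then show False using sqnorm_eq_0_AE[OF \<psi>2] nz by simp
qed

text \<open>For fixed \<open>a\<close> and \<open>s\<close> Plancherel's theorem in \<open>t\<close>
  gives an integral over frequencies. Integrating over \<open>a\<close> and \<open>s\<close> first
  leaves the constant \<open>calderon \<psi>\<close> at every frequency off the null set where the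
  first coordinate is zero.\<close>

theorem shear_transform_isometry:
  assumes \<psi>1: "integrable lborel \<psi>" and \<psi>2: "\<psi> \<in> Lp_space lborel 2" and h: "h \<in> Lp_space lborel 2"
  shows "(\<integral>\<^sup>+g. ennreal ((norm (shear_transform \<psi> h g))\<^sup>2) \<partial>shear_haar) = calderon \<psi> * ennreal (sqnorm lborel h)"
proof -
  have [measurable]: "ft \<psi> \<in> borel_measurable borel" using \<psi>1 by (intro ft_measurable) auto
  have [measurable]: "\<psi> \<in> borel_measurable borel" "h \<in> borel_measurable borel" using \<psi>1 L2_measurable[OF h] by auto
  obtain w where w: "w \<in> Lp_space lborel 2" "sqnorm lborel w = 4 * pi\<^sup>2 * sqnorm lborel h"
    and corr: "\<And>\<phi>. integrable lborel \<phi> \<Longrightarrow> \<phi> \<in> Lp_space lborel 2 \<Longrightarrow>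
       4 * pi\<^sup>2 * sqnorm lborel (cross_correlation h \<phi>) = sqnorm lborel (\<lambda>\<xi>. w \<xi> * cnj (ft \<phi> \<xi>))"
    using Plancherel_L2[OF h] by blast
  have [measurable]: "w \<in> borel_measurable borel" using L2_measurable[OF w(1)] by simp
  define W where "W \<xi> = ennreal ((norm (w \<xi>))\<^sup>2)" for \<xi>
  define P where "P a s \<xi> = ennreal (jac a * (norm (ft \<psi> (vec2 (a * \<xi> $ 1, kappa a * (s * \<xi> $ 1 + \<xi> $ 2)))))\<^sup>2)" for a s and \<xi> :: "real ^ 2"
  define v where "v = (\<lambda>(a, s, t). cross_correlation h (atom \<psi> a s) t)"
  have v_meas [measurable]: "v \<in> borel_measurable (borel \<Otimes>\<^sub>M borel \<Otimes>\<^sub>M borel)"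
    unfolding v_def by (rule cross_correlation_atom_measurable) measurable
  have [measurable]: "W \<in> borel_measurable borel" unfolding W_def by measurable
  have P_meas [measurable]: "(\<lambda>(a, s, \<xi>). P a s \<xi>) \<in> borel_measurable (borel \<Otimes>\<^sub>M borel \<Otimes>\<^sub>M borel)"
    unfolding P_def case_prod_unfold by measurable
  \<comment> \<open>Plancherel's constant stays as a factor on the left to avoid division in
    \<open>ennreal\<close>; it is cancelled at the end.\<close>
  define p2 where "p2 = ennreal (4 * pi\<^sup>2)"
  have inner: "p2 * (\<integral>\<^sup>+t. ennreal ((norm (v (a, s, t)))\<^sup>2) \<partial>lborel) = (\<integral>\<^sup>+\<xi>. W \<xi> * P a s \<xi> \<partial>lborel)" if a: "a \<noteq> 0" for a s
  proof -
    let ?\<phi> = "atom \<psi> a s"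
    have \<phi>: "integrable lborel ?\<phi>" "?\<phi> \<in> Lp_space lborel 2" by (rule atom_integrable[OF a \<psi>1]) (rule atom_L2[OF a \<psi>2])
    have "p2 * (\<integral>\<^sup>+t. ennreal ((norm (v (a, s, t)))\<^sup>2) \<partial>lborel) = p2 * ennreal (sqnorm lborel (cross_correlation h ?\<phi>))"
      unfolding v_def using ennreal_sqnorm[OF cross_correlation_L2(1)[OF h \<phi>(1)]] by simp
    also have "\<dots> = ennreal (sqnorm lborel (\<lambda>\<xi>. w \<xi> * cnj (ft ?\<phi> \<xi>)))"
      unfolding corr[OF \<phi>, symmetric] p2_def by (rule ennreal_mult[symmetric]) auto
    also have "\<dots> = (\<integral>\<^sup>+\<xi>. ennreal ((norm (w \<xi> * cnj (ft ?\<phi> \<xi>)))\<^sup>2) \<partial>lborel)"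
    proof (rule ennreal_sqnorm[symmetric])
      have "ft ?\<phi> \<in> borel_measurable borel" using \<phi> by (intro ft_measurable) auto
      then show "(\<lambda>\<xi>. w \<xi> * cnj (ft ?\<phi> \<xi>)) \<in> Lp_space lborel 2"
        using norm_ft_le[of ?\<phi>] by (intro L2_bounded_mult(1)[OF w(1)]) auto
    qed
    also have "\<dots> = (\<integral>\<^sup>+\<xi>. W \<xi> * P a s \<xi> \<partial>lborel)"
      unfolding ft_atom[OF a \<psi>1] W_def P_def
      by (simp add: norm_mult power_mult_distrib ennreal_mult[symmetric])
    finally show ?thesis .
  qed
  have "p2 * (\<integral>\<^sup>+g. ennreal ((norm (shear_transform \<psi> h g))\<^sup>2) \<partial>shear_haar) =
      p2 * (\<integral>\<^sup>+g. ennreal ((norm (v g))\<^sup>2) \<partial>shear_haar)"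
    by (intro arg_cong2[where f = "(*)"] refl nn_integral_cong) (auto simp: v_def shear_transform_eq)
  also have "\<dots> = p2 * (\<integral>\<^sup>+a. \<integral>\<^sup>+s. \<integral>\<^sup>+t. ennreal (1 / \<bar>a\<bar> ^ 3) * ennreal ((norm (v (a, s, t)))\<^sup>2) \<partial>lborel \<partial>lborel \<partial>lborel)"
    using v_meas by (subst nn_integral_shear_haar) (simp_all add: borel_prod)
  also have "\<dots> = (\<integral>\<^sup>+a. \<integral>\<^sup>+s. p2 * (\<integral>\<^sup>+t. ennreal (1 / \<bar>a\<bar> ^ 3) * ennreal ((norm (v (a, s, t)))\<^sup>2) \<partial>lborel) \<partial>lborel \<partial>lborel)"
    by (subst nn_integral_cmult[symmetric], measurable)+
  also have "\<dots> = (\<integral>\<^sup>+a. \<integral>\<^sup>+s. \<integral>\<^sup>+\<xi>. W \<xi> * (ennreal (1 / \<bar>a\<bar> ^ 3) * P a s \<xi>) \<partial>lborel \<partial>lborel \<partial>lborel)"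
  proof (intro nn_integral_cong)
    fix a s :: real
    show "p2 * (\<integral>\<^sup>+t. ennreal (1 / \<bar>a\<bar> ^ 3) * ennreal ((norm (v (a, s, t)))\<^sup>2) \<partial>lborel) =
        (\<integral>\<^sup>+\<xi>. W \<xi> * (ennreal (1 / \<bar>a\<bar> ^ 3) * P a s \<xi>) \<partial>lborel)"
    proof (cases "a = 0")
      case False
      have "p2 * (\<integral>\<^sup>+t. ennreal (1 / \<bar>a\<bar> ^ 3) * ennreal ((norm (v (a, s, t)))\<^sup>2) \<partial>lborel) =
          ennreal (1 / \<bar>a\<bar> ^ 3) * (p2 * (\<integral>\<^sup>+t. ennreal ((norm (v (a, s, t)))\<^sup>2) \<partial>lborel))"
        by (simp add: nn_integral_cmult mult.left_commute)
      also have "\<dots> = (\<integral>\<^sup>+\<xi>. W \<xi> * (ennreal (1 / \<bar>a\<bar> ^ 3) * P a s \<xi>) \<partial>lborel)"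
        unfolding inner[OF False] by (subst nn_integral_cmult[symmetric]) (simp_all add: mult.left_commute)
      finally show ?thesis .
    qed simp
  qed
  \<comment> \<open>Tonelli's theorem twice, to make the frequency the outermost variable.\<close>
  also have "\<dots> = (\<integral>\<^sup>+a. \<integral>\<^sup>+\<xi>. \<integral>\<^sup>+s. W \<xi> * (ennreal (1 / \<bar>a\<bar> ^ 3) * P a s \<xi>) \<partial>lborel \<partial>lborel \<partial>lborel)"
    by (intro nn_integral_cong lborel_pair.Fubini') measurable
  also have "\<dots> = (\<integral>\<^sup>+\<xi>. \<integral>\<^sup>+a. \<integral>\<^sup>+s. W \<xi> * (ennreal (1 / \<bar>a\<bar> ^ 3) * P a s \<xi>) \<partial>lborel \<partial>lborel \<partial>lborel)"
    unfolding P_def by (intro lborel_pair.Fubini') measurable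
  also have "\<dots> = (\<integral>\<^sup>+\<xi>. W \<xi> * (\<integral>\<^sup>+a. \<integral>\<^sup>+s. ennreal (1 / \<bar>a\<bar> ^ 3) * P a s \<xi> \<partial>lborel \<partial>lborel) \<partial>lborel)"
    unfolding P_def by (simp add: nn_integral_cmult)
  also have "\<dots> = (\<integral>\<^sup>+\<xi>. W \<xi> * calderon \<psi> \<partial>lborel)"
  proof (rule nn_integral_cong_AE)
    show "AE \<xi> in lborel. W \<xi> * (\<integral>\<^sup>+a. \<integral>\<^sup>+s. ennreal (1 / \<bar>a\<bar> ^ 3) * P a s \<xi> \<partial>lborel \<partial>lborel) = W \<xi> * calderon \<psi>"
      using AE_lborel_R2_nonzero
    proof eventually_elim
      case (elim \<xi>)
      show ?case unfolding P_def calderon_eq[OF \<psi>1 elim] ..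
    qed
  qed
  also have "\<dots> = ennreal (sqnorm lborel w) * calderon \<psi>"
    unfolding W_def by (subst nn_integral_multc) (simp_all add: ennreal_sqnorm[OF w(1)])
  also have "\<dots> = p2 * (calderon \<psi> * ennreal (sqnorm lborel h))"
    unfolding w(2) p2_def by (simp add: ennreal_mult mult_ac)
  finally have eq: "p2 * (\<integral>\<^sup>+g. ennreal ((norm (shear_transform \<psi> h g))\<^sup>2) \<partial>shear_haar) =
      p2 * (calderon \<psi> * ennreal (sqnorm lborel h))" .
  have p2: "ennreal (1 / (4 * pi\<^sup>2)) * (p2 * x) = x" for x
    unfolding p2_def by (simp add: mult.assoc[symmetric] ennreal_mult[symmetric])
  show ?thesis using arg_cong[OF eq, of "\<lambda>x. ennreal (1 / (4 * pi\<^sup>2)) * x"] unfolding p2 .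
qed

section \<open>Embedding into the anti-dual\<close>

lemma group_weight_measurable:
  assumes "group_weight \<omega>"
  shows "\<omega> \<in> borel_measurable shear_haar"
  using assms unfolding group_weight_def measurable_shear_haar_iff
  by (intro borel_measurable_continuous_on_restrict) simp

lemma H1_iff:
  assumes \<omega>: "group_weight \<omega>" and \<psi>: "\<psi> \<in> Lp_space lborel 2"
  shows "h \<in> H1 \<omega> \<psi> \<longleftrightarrow> h \<in> Lp_space lborel 2 \<and>
    integrable shear_haar (\<lambda>g. norm (of_real (\<omega> g) * shear_transform \<psi> h g))"
  using shear_transform_measurable[OF \<psi>, of h] group_weight_measurable[OF \<omega>]
  by (auto simp: H1_def Lpw_space_def Lp_space_def[of shear_haar])

lemma H1_norm_eq: "H1_norm \<omega> \<psi> h = (\<integral>g. norm (of_real (\<omega> g) * shear_transform \<psi> h g) \<partial>shear_haar)"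
  by (simp add: H1_norm_def Lpw_norm_def Lp_norm_def)

lemma H1_norm_nonneg: "0 \<le> H1_norm \<omega> \<psi> h"
  unfolding H1_norm_eq by (rule Bochner_Integration.integral_nonneg) simp

lemma shear_transform_rep:
  assumes "h \<in> shearlet_group" "g \<in> shearlet_group" "f \<in> Lp_space lborel 2" "\<psi> \<in> Lp_space lborel 2"
  shows "shear_transform \<psi> (shear_rep h f) (shear_mult h g) = shear_transform \<psi> f g"
  unfolding shear_transform_def shear_rep_mult[OF assms(1,2), symmetric]
  by (intro L2_inner_shear_rep shear_rep_L2 assms)

text \<open>Left translation by \<open>h\<close> undoes the representation inside the transform, and
  submultiplicativity of the weight costs the finite factor \<open>\<omega> h\<close>. Hence
  anti-dual elements can be paired with every shearlet.\<close>

lemma shear_rep_H1: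
  assumes \<omega>: "group_weight \<omega>" and \<psi>: "\<psi> \<in> Lp_space lborel 2" and f: "f \<in> H1 \<omega> \<psi>" and h: "h \<in> shearlet_group"
  shows "shear_rep h f \<in> H1 \<omega> \<psi>"
proof -
  have fL: "f \<in> Lp_space lborel 2" and fI: "integrable shear_haar (\<lambda>g. norm (of_real (\<omega> g) * shear_transform \<psi> f g))"
    using f by (auto simp: H1_iff[OF \<omega> \<psi>])
  have hf: "shear_rep h f \<in> Lp_space lborel 2" by (rule shear_rep_L2(1)[OF h fL])
  note [measurable] = group_weight_measurable[OF \<omega>] shear_transform_measurable[OF \<psi> hf] shear_transform_measurable[OF \<psi> fL]
  define k where "k g = ennreal (norm (of_real (\<omega> g) * shear_transform \<psi> (shear_rep h f) g))" for g
  have "k \<in> borel_measurable shear_haar" unfolding k_def by measurable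
  then have "k \<in> borel_measurable (restrict_space borel shearlet_group)"
    by (simp only: measurable_shear_haar_iff)
  \<comment> \<open>Extension by zero off the group gives a Borel function on the whole parameter
    space, as left invariance is stated for such functions.\<close>
  then have k': "(\<lambda>g. k g * indicator shearlet_group g) \<in> borel_measurable borel"
    by (subst (asm) borel_measurable_restrict_space_iff_ennreal) auto
  have \<omega>h: "0 \<le> \<omega> h" using \<omega> h by (force simp: group_weight_def)
  have "(\<integral>\<^sup>+g. k g \<partial>shear_haar) = (\<integral>\<^sup>+g. k g * indicator shearlet_group g \<partial>shear_haar)"
    by (intro nn_integral_cong) simp
  also have "\<dots> = (\<integral>\<^sup>+g. k (shear_mult h g) * indicator shearlet_group (shear_mult h g) \<partial>shear_haar)"
    by (rule nn_integral_shear_haar_left[OF h k', symmetric])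
  also have "\<dots> \<le> (\<integral>\<^sup>+g. ennreal (\<omega> h) * ennreal (norm (of_real (\<omega> g) * shear_transform \<psi> f g)) \<partial>shear_haar)"
  proof (rule nn_integral_mono)
    fix g assume "g \<in> space shear_haar"
    then have g: "g \<in> shearlet_group" by simp
    have hg: "shear_mult h g \<in> shearlet_group" by (rule shear_mult_in_group[OF h g])
    have "0 \<le> \<omega> (shear_mult h g)" "0 \<le> \<omega> g" using \<omega> g hg by (force simp: group_weight_def)+
    moreover have "\<omega> (shear_mult h g) \<le> \<omega> h * \<omega> g" using \<omega> g h by (auto simp: group_weight_def)
    ultimately have "norm (of_real (\<omega> (shear_mult h g)) * shear_transform \<psi> f g) \<le> \<omega> h * norm (of_real (\<omega> g) * shear_transform \<psi> f g)"
      by (simp add: norm_mult mult.assoc[symmetric] mult_right_mono)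
    then show "k (shear_mult h g) * indicator shearlet_group (shear_mult h g) \<le>
        ennreal (\<omega> h) * ennreal (norm (of_real (\<omega> g) * shear_transform \<psi> f g))"
      using hg \<omega>h unfolding k_def shear_transform_rep[OF h g fL \<psi>] ennreal_mult[OF \<omega>h norm_ge_zero, symmetric]
      by (simp add: ennreal_leI)
  qed
  also have "\<dots> = ennreal (\<omega> h) * (\<integral>\<^sup>+g. ennreal (norm (of_real (\<omega> g) * shear_transform \<psi> f g)) \<partial>shear_haar)"
    by (rule nn_integral_cmult) measurable
  also have "\<dots> < \<infinity>"
    using nn_integral_eq_integral[OF fI] by (simp add: ennreal_mult_less_top)
  finally have "integrable shear_haar (\<lambda>g. norm (of_real (\<omega> g) * shear_transform \<psi> (shear_rep h f) g))"
    unfolding k_def by (intro integrableI_nonneg) auto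
  with hf show ?thesis by (simp only: H1_iff[OF \<omega> \<psi>] simp_thms)
qed

lemma shear_transform_comb:
  assumes "g \<in> shearlet_group" "\<psi> \<in> Lp_space lborel 2" "h \<in> Lp_space lborel 2" "k \<in> Lp_space lborel 2"
  shows "shear_transform \<psi> (\<lambda>x. a * h x + b * k x) g = a * shear_transform \<psi> h g + b * shear_transform \<psi> k g"
proof -
  note r = shear_rep_L2(1)[OF assms(1,2)]
  show ?thesis
    using L2_mult_integrable[OF assms(3) r] L2_mult_integrable[OF assms(4) r]
    by (simp add: shear_transform_def L2_inner_def distrib_right mult.assoc)
qed

lemma H1_comb:
  assumes \<omega>: "group_weight \<omega>" and \<psi>: "\<psi> \<in> Lp_space lborel 2" and h: "h \<in> H1 \<omega> \<psi>" and k: "k \<in> H1 \<omega> \<psi>"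
  shows "(\<lambda>x. a * h x + b * k x) \<in> H1 \<omega> \<psi>"
proof -
  have hL: "h \<in> Lp_space lborel 2" and kL: "k \<in> Lp_space lborel 2"
    and hI: "integrable shear_haar (\<lambda>g. norm (of_real (\<omega> g) * shear_transform \<psi> h g))"
    and kI: "integrable shear_haar (\<lambda>g. norm (of_real (\<omega> g) * shear_transform \<psi> k g))"
    using h k by (auto simp: H1_iff[OF \<omega> \<psi>])
  have L: "(\<lambda>x. a * h x + b * k x) \<in> Lp_space lborel 2" by (intro L2_add L2_scale hL kL)
  note [measurable] = group_weight_measurable[OF \<omega>] shear_transform_measurable[OF \<psi> L]
  let ?b = "\<lambda>g. norm a * norm (of_real (\<omega> g) * shear_transform \<psi> h g) + norm b * norm (of_real (\<omega> g) * shear_transform \<psi> k g)"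
  have "integrable shear_haar (\<lambda>g. norm (of_real (\<omega> g) * shear_transform \<psi> (\<lambda>x. a * h x + b * k x) g))"
  proof (rule Bochner_Integration.integrable_bound)
    show "integrable shear_haar ?b"
      by (intro Bochner_Integration.integrable_add integrable_mult_right hI kI)
    show "AE g in shear_haar. norm (norm (of_real (\<omega> g) * shear_transform \<psi> (\<lambda>x. a * h x + b * k x) g)) \<le> norm (?b g)"
    proof (rule AE_I2)
      fix g assume "g \<in> space shear_haar"
      then have g: "g \<in> shearlet_group" by simp
      have "norm (of_real (\<omega> g) * shear_transform \<psi> (\<lambda>x. a * h x + b * k x) g) =
          norm (a * (of_real (\<omega> g) * shear_transform \<psi> h g) + b * (of_real (\<omega> g) * shear_transform \<psi> k g))"
        unfolding shear_transform_comb[OF g \<psi> hL kL] by (simp add: algebra_simps)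
      also have "\<dots> \<le> ?b g"
        using norm_triangle_ineq[of "a * (of_real (\<omega> g) * shear_transform \<psi> h g)" "b * (of_real (\<omega> g) * shear_transform \<psi> k g)"]
        by (simp only: norm_mult)
      finally show "norm (norm (of_real (\<omega> g) * shear_transform \<psi> (\<lambda>x. a * h x + b * k x) g)) \<le> norm (?b g)"
        by simp
    qed
  qed measurable
  with L show ?thesis by (simp only: H1_iff[OF \<omega> \<psi>] simp_thms)
qed

text \<open>The constant may be infinite, so it is capped at 1 before passing to the reals.\<close>

lemma calderon_lower:
  assumes "integrable lborel \<psi>" "\<psi> \<in> Lp_space lborel 2" "\<not> (AE x in lborel. \<psi> x = 0)"
  obtains k where "k > 0" "ennreal k \<le> calderon \<psi>"
proof
  have fin: "min 1 (calderon \<psi>) < \<top>" by (simp add: min_less_iff_disj)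
  then show "enn2real (min 1 (calderon \<psi>)) > 0"
    using calderon_nonzero[OF assms] by (simp add: enn2real_positive_iff zero_less_iff_neq_zero)
  show "ennreal (enn2real (min 1 (calderon \<psi>))) \<le> calderon \<psi>"
    using fin by simp
qed

text \<open>The isometry bounds \<open>norm h\<close> by the square integral of the transform \<open>V h\<close>, and
  \<open>\<bar>V h\<bar> \<le> norm h * norm \<psi>\<close> turns one factor of \<open>V h\<close> back into \<open>norm h\<close>.\<close>

lemma L2_le_H1_norm:
  assumes \<omega>: "group_weight \<omega>" and \<psi>1: "integrable lborel \<psi>" and \<psi>: "\<psi> \<in> Lp_space lborel 2"
    and nz: "\<not> (AE x in lborel. \<psi> x = 0)"
  obtains C where "0 \<le> C" "\<And>h. h \<in> H1 \<omega> \<psi> \<Longrightarrow> sqrt (sqnorm lborel h) \<le> C * H1_norm \<omega> \<psi> h"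
proof -
  obtain c where c: "c > 0" "ennreal c \<le> calderon \<psi>" using calderon_lower[OF \<psi>1 \<psi> nz] .
  have "sqrt (sqnorm lborel h) \<le> sqrt (sqnorm lborel \<psi>) / c * H1_norm \<omega> \<psi> h" if h: "h \<in> H1 \<omega> \<psi>" for h
  proof -
    have hL: "h \<in> Lp_space lborel 2" and hI: "integrable shear_haar (\<lambda>g. norm (of_real (\<omega> g) * shear_transform \<psi> h g))"
      using h by (auto simp: H1_iff[OF \<omega> \<psi>])
    define B where "B = sqrt (sqnorm lborel h) * sqrt (sqnorm lborel \<psi>)"
    have B: "0 \<le> B" by (simp add: B_def)
    note [measurable] = group_weight_measurable[OF \<omega>] shear_transform_measurable[OF \<psi> hL]
    have "ennreal (c * sqnorm lborel h) \<le> calderon \<psi> * ennreal (sqnorm lborel h)"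
      using c by (simp add: ennreal_mult mult_right_mono)
    also have "\<dots> = (\<integral>\<^sup>+g. ennreal ((norm (shear_transform \<psi> h g))\<^sup>2) \<partial>shear_haar)"
      by (rule shear_transform_isometry[OF \<psi>1 \<psi> hL, symmetric])
    also have "\<dots> \<le> (\<integral>\<^sup>+g. ennreal B * ennreal (norm (of_real (\<omega> g) * shear_transform \<psi> h g)) \<partial>shear_haar)"
    proof (rule nn_integral_mono)
      fix g assume "g \<in> space shear_haar"
      then have g: "g \<in> shearlet_group" by simp
      have "(norm (shear_transform \<psi> h g))\<^sup>2 \<le> B\<^sup>2"
        using L2_Cauchy_Schwarz[OF hL shear_rep_L2(1)[OF g \<psi>]]
        by (simp add: shear_transform_def L2_inner_def shear_rep_L2(2)[OF g \<psi>] B_def power_mult_distrib)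
      then have 1: "norm (shear_transform \<psi> h g) \<le> B" using B by (rule power2_le_imp_le)
      have "1 \<le> \<omega> g" using \<omega> g by (auto simp: group_weight_def)
      then have 2: "norm (shear_transform \<psi> h g) \<le> norm (of_real (\<omega> g) * shear_transform \<psi> h g)"
        by (simp add: norm_mult mult_le_cancel_right1)
      have "(norm (shear_transform \<psi> h g))\<^sup>2 \<le> B * norm (of_real (\<omega> g) * shear_transform \<psi> h g)"
        unfolding power2_eq_square using 1 2 B by (intro mult_mono) auto
      then show "ennreal ((norm (shear_transform \<psi> h g))\<^sup>2) \<le> ennreal B * ennreal (norm (of_real (\<omega> g) * shear_transform \<psi> h g))"
        unfolding ennreal_mult[OF B norm_ge_zero, symmetric] by (rule ennreal_leI)
    qed
    also have "\<dots> = ennreal B * (\<integral>\<^sup>+g. ennreal (norm (of_real (\<omega> g) * shear_transform \<psi> h g)) \<partial>shear_haar)"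
      by (rule nn_integral_cmult) measurable
    also have "\<dots> = ennreal (B * H1_norm \<omega> \<psi> h)"
      using nn_integral_eq_integral[OF hI] B by (simp add: H1_norm_eq ennreal_mult)
    finally have "c * sqnorm lborel h \<le> B * H1_norm \<omega> \<psi> h"
      using B H1_norm_nonneg by (subst (asm) ennreal_le_iff) auto
    then have le: "sqrt (sqnorm lborel h) * (c * sqrt (sqnorm lborel h)) \<le>
        sqrt (sqnorm lborel h) * (sqrt (sqnorm lborel \<psi>) * H1_norm \<omega> \<psi> h)"
      by (simp add: B_def mult_ac)
    show ?thesis
    proof (cases "sqrt (sqnorm lborel h) = 0")
      case True
      then show ?thesis using c H1_norm_nonneg by simp
    next
      case False
      moreover have "0 \<le> sqrt (sqnorm lborel h)" by simp
      ultimately have "0 < sqrt (sqnorm lborel h)" by linarith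
      then have "c * sqrt (sqnorm lborel h) \<le> sqrt (sqnorm lborel \<psi>) * H1_norm \<omega> \<psi> h"
        using le mult_le_cancel_left_pos by blast
      then show ?thesis using c by (simp add: field_simps)
    qed
  qed
  moreover have "0 \<le> sqrt (sqnorm lborel \<psi>) / c" using c by simp
  ultimately show thesis using that by blast
qed

lemma embed_in_antidual:
  assumes \<omega>: "group_weight \<omega>" and \<psi>1: "integrable lborel \<psi>" and \<psi>: "\<psi> \<in> Lp_space lborel 2"
    and nz: "\<not> (AE x in lborel. \<psi> x = 0)" and f: "f \<in> Lp_space lborel 2"
  shows "embed \<omega> \<psi> f \<in> antidual \<omega> \<psi>"
proof -
  have L: "h \<in> Lp_space lborel 2" if "h \<in> H1 \<omega> \<psi>" for h using that by (simp add: H1_def)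
  obtain C where C: "0 \<le> C" "\<And>h. h \<in> H1 \<omega> \<psi> \<Longrightarrow> sqrt (sqnorm lborel h) \<le> C * H1_norm \<omega> \<psi> h"
    using L2_le_H1_norm[OF \<omega> \<psi>1 \<psi> nz] by blast
  have add: "embed \<omega> \<psi> f (\<lambda>x. h x + k x) = embed \<omega> \<psi> f h + embed \<omega> \<psi> f k" if "h \<in> H1 \<omega> \<psi>" "k \<in> H1 \<omega> \<psi>" for h k
    using H1_comb[OF \<omega> \<psi> that, of 1 1] that L2_mult_integrable[OF f L[OF that(1)]] L2_mult_integrable[OF f L[OF that(2)]]
    by (simp add: embed_def L2_inner_def distrib_left)
  have scale: "embed \<omega> \<psi> f (\<lambda>x. z * h x) = cnj z * embed \<omega> \<psi> f h" if "h \<in> H1 \<omega> \<psi>" for h z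
    using H1_comb[OF \<omega> \<psi> that that, of z 0] that
    by (simp add: embed_def L2_inner_def mult.left_commute)
  have bound: "norm (embed \<omega> \<psi> f h) \<le> (sqrt (sqnorm lborel f) * C) * H1_norm \<omega> \<psi> h" if "h \<in> H1 \<omega> \<psi>" for h
  proof -
    have "norm (L2_inner f h) \<le> sqrt (sqnorm lborel f * sqnorm lborel h)"
      using L2_Cauchy_Schwarz[OF f L[OF that]] unfolding L2_inner_def by (rule real_le_rsqrt)
    also have "\<dots> \<le> sqrt (sqnorm lborel f) * (C * H1_norm \<omega> \<psi> h)"
      unfolding real_sqrt_mult using C(2)[OF that] by (intro mult_left_mono) auto
    finally show ?thesis using that by (simp add: embed_def mult.assoc)
  qed
  have off: "embed \<omega> \<psi> f h = 0" if "h \<notin> H1 \<omega> \<psi>" for h using that by (simp add: embed_def)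
  show ?thesis
    unfolding antidual_def mem_Collect_eq using off add scale bound by (intro conjI allI ballI exI impI)
qed

text \<open>Two comparisons are chained: the isometry bounds \<open>f\<close> by its transform with
  factor \<open>1 / k\<close>, and the frame inequality at exponent 2 bounds the transform by the
  coefficients with factor \<open>1 / c\<^sup>2\<close>.\<close>

lemma shearlet_coefficient_frame:
  assumes set: "shearlet_setting \<omega> \<psi> L par"
  obtains C where "coefficient_frame (cbox 0 1) L (shearlet_system \<psi> par) C"
    "\<And>r. 1 \<le> r \<Longrightarrow> r \<le> 2 \<Longrightarrow>
       shearlet_X \<omega> \<psi> r = {f \<in> L2_on (cbox 0 1). coeffs (shearlet_system \<psi> par) f \<in> ell L r}"
proof -
  have \<omega>: "group_weight \<omega>" and \<psi>: "\<psi> \<in> Lp_space lborel 2" and nz: "\<not> (AE x in lborel. \<psi> x = 0)"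
    and cpt: "compact (closure {x. \<psi> x \<noteq> 0})" and \<psi>H: "\<psi> \<in> H1 \<omega> \<psi>" and par: "\<And>l. l \<in> L \<Longrightarrow> par l \<in> shearlet_group"
    and frame: "\<And>r. 1 \<le> r \<Longrightarrow> r \<le> 2 \<Longrightarrow> banach_frame \<omega> \<psi> L par r (\<lambda>g. 1)"
    using set by (auto simp: shearlet_setting_def admissible_def)
  obtain R where R: "\<forall>x\<in>closure {x. \<psi> x \<noteq> 0}. norm x \<le> R"
    using compact_imp_bounded[OF cpt] unfolding bounded_iff by blast
  then have "closure {x. \<psi> x \<noteq> 0} \<subseteq> cball 0 R" by auto
  then have "\<psi> x = 0" if "x \<notin> cball 0 R" for x
    using that closure_subset[of "{x. \<psi> x \<noteq> 0}"] by blast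
  then have \<psi>1: "integrable lborel \<psi>" by (rule L2_bounded_support_integrable[OF \<psi>])
  obtain k where k: "k > 0" "ennreal k \<le> calderon \<psi>" using calderon_lower[OF \<psi>1 \<psi> nz] .
  have repH: "shear_rep g \<psi> \<in> H1 \<omega> \<psi>" if "g \<in> shearlet_group" for g
    by (rule shear_rep_H1[OF \<omega> \<psi> \<psi>H that])
  have anti: "embed \<omega> \<psi> f \<in> antidual \<omega> \<psi>" if "f \<in> L2_on (cbox 0 1)" for f
    using that by (intro embed_in_antidual[OF \<omega> \<psi>1 \<psi> nz]) (simp add: L2_on_def)
  \<comment> \<open>The shearlets lie in \<open>H1 \<omega> \<psi>\<close>, so \<open>embed\<close>
    does not cut their pairing to zero, and functional and function have the same coefficients on
    \<open>L\<close>.\<close>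
  have M: "embed \<omega> \<psi> f (shearlet_system \<psi> par l) = coeffs (shearlet_system \<psi> par) f l" if "l \<in> L" for f l
    using repH[OF par[OF that]] by (simp add: embed_def coeffs_def shearlet_system_def)
  have coorbit: "embed \<omega> \<psi> f \<in> shearlet_coorbit \<omega> \<psi> r (\<lambda>g. 1) \<longleftrightarrow> coeffs (shearlet_system \<psi> par) f \<in> ell L r"
    if "f \<in> L2_on (cbox 0 1)" "1 \<le> r" "r \<le> 2" for f r
  proof -
    have "embed \<omega> \<psi> f \<in> shearlet_coorbit \<omega> \<psi> r (\<lambda>g. 1) \<longleftrightarrow> (\<lambda>l. embed \<omega> \<psi> f (shearlet_system \<psi> par l)) \<in> ell L r"
      using frame[OF that(2,3)] anti[OF that(1)] unfolding banach_frame_def Let_def by blast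
    also have "\<dots> \<longleftrightarrow> coeffs (shearlet_system \<psi> par) f \<in> ell L r"
      by (rule Lp_space_count_cong) (rule M)
    finally show ?thesis .
  qed
  have X: "shearlet_X \<omega> \<psi> r = {f \<in> L2_on (cbox 0 1). coeffs (shearlet_system \<psi> par) f \<in> ell L r}" if "1 \<le> r" "r \<le> 2" for r
    unfolding shearlet_X_def using coorbit[OF _ that] by blast
  obtain c where c: "c > 0" "\<And>F. F \<in> shearlet_coorbit \<omega> \<psi> 2 (\<lambda>g. 1) \<Longrightarrow>
      c * shearlet_coorbit_norm \<psi> 2 (\<lambda>g. 1) F \<le> ell_norm L 2 (\<lambda>l. F (shearlet_system \<psi> par l))"
    using frame[of 2] unfolding banach_frame_def Let_def by auto
  have "coefficient_frame (cbox 0 1) L (shearlet_system \<psi> par) (1 / k * (1 / c\<^sup>2))"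
  proof
    show "shearlet_system \<psi> par l \<in> Lp_space lborel 2" if "l \<in> L" for l
      unfolding shearlet_system_def by (rule shear_rep_L2(1)[OF par[OF that] \<psi>])
    fix f assume f: "f \<in> L2_on (cbox 0 1)" and cf: "coeffs (shearlet_system \<psi> par) f \<in> ell L 2"
    let ?q = "sqnorm (count_space L) (coeffs (shearlet_system \<psi> par) f)"
    have fL: "f \<in> Lp_space lborel 2" using f by (simp add: L2_on_def)
    have F: "embed \<omega> \<psi> f \<in> shearlet_coorbit \<omega> \<psi> 2 (\<lambda>g. 1)" using coorbit[OF f] cf by simp
    \<comment> \<open>The trivial weight is kept as a factor 1, so that \<open>V\<close> matches the
      definitions of the weighted space and norm literally.\<close>
    define V where "V = (\<lambda>g. complex_of_real 1 * voice \<psi> (embed \<omega> \<psi> f) g)"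
    have V: "V g = shear_transform \<psi> f g" if "g \<in> shearlet_group" for g
      using repH[OF that] by (simp add: V_def voice_def embed_def shear_transform_def)
    have VL: "V \<in> Lp_space shear_haar 2"
      using F unfolding shearlet_coorbit_def Lpw_space_def V_def by simp
    have "ennreal (k * sqnorm lborel f) \<le> calderon \<psi> * ennreal (sqnorm lborel f)"
      using k by (simp add: ennreal_mult mult_right_mono)
    also have "\<dots> = (\<integral>\<^sup>+g. ennreal ((norm (shear_transform \<psi> f g))\<^sup>2) \<partial>shear_haar)"
      by (rule shear_transform_isometry[OF \<psi>1 \<psi> fL, symmetric])
    also have "\<dots> = (\<integral>\<^sup>+g. ennreal ((norm (V g))\<^sup>2) \<partial>shear_haar)"
      by (intro nn_integral_cong) (simp add: V)
    also have "\<dots> = ennreal (sqnorm shear_haar V)" by (rule ennreal_sqnorm[OF VL])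
    finally have 1: "k * sqnorm lborel f \<le> sqnorm shear_haar V" by (subst (asm) ennreal_le_iff) auto
    have "shearlet_coorbit_norm \<psi> 2 (\<lambda>g. 1) (embed \<omega> \<psi> f) = sqrt (sqnorm shear_haar V)"
      unfolding shearlet_coorbit_norm_def Lpw_norm_def V_def by (rule Lp_norm_2)
    moreover have "ell_norm L 2 (\<lambda>l. embed \<omega> \<psi> f (shearlet_system \<psi> par l)) = sqrt ?q"
      unfolding Lp_norm_2 by (intro arg_cong[where f = sqrt] sqnorm_count_cong M)
    ultimately have "c * sqrt (sqnorm shear_haar V) \<le> sqrt ?q" using c(2)[OF F] by simp
    then have 2: "sqnorm shear_haar V \<le> (1 / c\<^sup>2) * ?q" by (intro sqnorm_le_of_sqrt_le[OF c(1)]) auto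
    have "sqnorm lborel f = 1 / k * (k * sqnorm lborel f)" using k by simp
    also have "\<dots> \<le> 1 / k * ((1 / c\<^sup>2) * ?q)" using k 1 2 by (intro mult_left_mono) auto
    finally show "sqnorm lborel f \<le> 1 / k * (1 / c\<^sup>2) * ?q" by simp
  qed
  with X show thesis by (rule that[rotated -1])
qed

theorem corollary5p3:
  fixes U :: "'u::topological_space set" and u :: "nat \<Rightarrow> 'u" and N :: nat
    and g :: "nat \<Rightarrow> 'v::{real_inner, complete_space}" and \<alpha> :: real and p :: "nat \<Rightarrow> real"
  assumes "N \<ge> 1" and "\<forall>n\<in>{1..N}. u n \<in> U" and "\<alpha> > 0"
    and "\<forall>n. 1 < p n \<and> p n < 2" and "decseq p" and "p \<longlonglongrightarrow> 1"
  shows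
    "(\<forall>(\<Omega> :: (real ^ 'd) set) (L :: 'l set) \<psi>
        (A :: (real ^ 'd \<Rightarrow> complex) \<Rightarrow> 'u \<Rightarrow> 'v) (f :: real \<Rightarrow> real ^ 'd \<Rightarrow> complex).
        besov_setting \<Omega> L \<psi> \<longrightarrow>
        forward_operator L \<psi> (besov_X \<Omega> 2) A U N u \<longrightarrow>
        (\<forall>q\<in>{1..<2}. the_minimizer (J_functional L \<psi> A N u g \<alpha> q) (besov_X \<Omega> q) (f q)) \<longrightarrow>
        (\<lambda>n. X_norm L \<psi> 2 (\<lambda>x. f (p n) x - f 1 x)) \<longlonglongrightarrow> 0)
     \<and>
     (\<forall>\<omega> (\<psi> :: real ^ 2 \<Rightarrow> complex) (L :: 'l set) par
        (A :: (real ^ 2 \<Rightarrow> complex) \<Rightarrow> 'u \<Rightarrow> 'v) (f :: real \<Rightarrow> real ^ 2 \<Rightarrow> complex).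
        shearlet_setting \<omega> \<psi> L par \<longrightarrow>
        forward_operator L (shearlet_system \<psi> par) (shearlet_X \<omega> \<psi> 2) A U N u \<longrightarrow>
        (\<forall>q\<in>{1..<2}. the_minimizer (J_functional L (shearlet_system \<psi> par) A N u g \<alpha> q)
                       (shearlet_X \<omega> \<psi> q) (f q)) \<longrightarrow>
        (\<lambda>n. X_norm L (shearlet_system \<psi> par) 2 (\<lambda>x. f (p n) x - f 1 x)) \<longlonglongrightarrow> 0)"
proof (intro conjI allI impI)
  fix \<Omega> :: "(real ^ 'd) set" and L :: "'l set" and \<psi>
    and A :: "(real ^ 'd \<Rightarrow> complex) \<Rightarrow> 'u \<Rightarrow> 'v" and f :: "real \<Rightarrow> real ^ 'd \<Rightarrow> complex"
  assume set: "besov_setting \<Omega> L \<psi>" and A: "forward_operator L \<psi> (besov_X \<Omega> 2) A U N u"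
    and min: "\<forall>q\<in>{1..<2}. the_minimizer (J_functional L \<psi> A N u g \<alpha> q) (besov_X \<Omega> q) (f q)"
  obtain C where frame: "coefficient_frame \<Omega> L \<psi> C"
    and X: "\<And>r. 1 \<le> r \<Longrightarrow> r \<le> 2 \<Longrightarrow> besov_X \<Omega> r = {f \<in> L2_on \<Omega>. coeffs \<psi> f \<in> ell L r}"
    using besov_coefficient_frame[OF set] by blast
  interpret coefficient_frame \<Omega> L \<psi> C by (rule frame)
  interpret sampled_problem \<Omega> L \<psi> C A U N u g \<alpha> p "besov_X \<Omega>" f
    by unfold_locales (use assms A min X in auto)
  show "(\<lambda>n. X_norm L \<psi> 2 (\<lambda>x. f (p n) x - f 1 x)) \<longlonglongrightarrow> 0" by (rule minimizers_tendsto)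
next
  fix \<omega> and \<psi> :: "real ^ 2 \<Rightarrow> complex" and L :: "'l set" and par :: "'l \<Rightarrow> shear_par"
    and A :: "(real ^ 2 \<Rightarrow> complex) \<Rightarrow> 'u \<Rightarrow> 'v" and f :: "real \<Rightarrow> real ^ 2 \<Rightarrow> complex"
  let ?\<psi> = "shearlet_system \<psi> par"
  assume set: "shearlet_setting \<omega> \<psi> L par" and A: "forward_operator L ?\<psi> (shearlet_X \<omega> \<psi> 2) A U N u"
    and min: "\<forall>q\<in>{1..<2}. the_minimizer (J_functional L ?\<psi> A N u g \<alpha> q) (shearlet_X \<omega> \<psi> q) (f q)"
  obtain C where frame: "coefficient_frame (cbox 0 1) L ?\<psi> C"
    and X: "\<And>r. 1 \<le> r \<Longrightarrow> r \<le> 2 \<Longrightarrow> shearlet_X \<omega> \<psi> r = {f \<in> L2_on (cbox 0 1). coeffs ?\<psi> f \<in> ell L r}"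
    using shearlet_coefficient_frame[OF set] by blast
  interpret coefficient_frame "cbox 0 1" L ?\<psi> C by (rule frame)
  interpret sampled_problem "cbox 0 1" L ?\<psi> C A U N u g \<alpha> p "shearlet_X \<omega> \<psi>" f
    by unfold_locales (use assms A min X in auto)
  show "(\<lambda>n. X_norm L ?\<psi> 2 (\<lambda>x. f (p n) x - f 1 x)) \<longlonglongrightarrow> 0" by (rule minimizers_tendsto)
qed

end
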